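(* Let $n\ge 2$, and let $\phi\colon J^{n+1}\to J^{n+1}$ be a local contact transformation establishing a local equivalence of two scalar ordinary differential equations $\mathcal E,\overline{\mathcal E}\subset J^{n+1}$ of order $n+1$ (that is, $\phi$ maps $\mathcal E$ onto $\overline{\mathcal E}$ locally). Let $E$ (resp. $\overline E$) be the line bundle on $\mathcal E$ (resp. $\overline{\mathcal E}$) tangent to the foliation by lifted solutions, and let $\mathcal W_i\in\Gamma(S^iE^* )$ (resp. $\overline{\mathcal W}_i\in\Gamma(S^i\overline E^* )$), $i=3,\dots,n+1$, be the generalized Wilczynski invariants of $\mathcal E$ (resp. $\overline{\mathcal E}$). Then $$\phi_*(E)=\overline E\qquad\text{and}\qquad \phi^*\overline{\mathcal W}_i=\mathcal W_i\quad\text{for all } i=3,\dots,n+1 .$$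
   Context: Everything is smooth. $J^k=J^k(\mathbb R^2)$ is the space of $k$-jets of non-parametrized curves in the plane. Any local coordinates $(x,y)$ on the plane induce local coordinates $(x,y_0,y_1,\dots,y_k)$ on $J^k$ such that the lift of the graph of $y(x)$ is $(x,y(x),y'(x),\dots,y^{(k)}(x))$. The contact distribution $C^k$ on $J^k$ is generated by the tangent lines to lifts of plane curves; in coordinates $C^k=\langle \partial_{y_k},\ \partial_x+y_1\partial_{y_0}+\dots+y_k\partial_{y_{k-1}}\rangle$. A (local) contact transformation of $J^{n+1}$ is a local diffeomorphism of $J^{n+1}$ preserving the class of lifts of plane curves (preserving $C^{n+1}$). A scalar ODE of order $n+1$ is a codimension-one submanifold $\mathcal E\subset J^{n+1}$ given in local coordinates by $y_{n+1}=f(x,y_0,\dots,y_n)$; then $(x,y_0,\dots,y_n)$ are local coordinates on $\mathcal E$. The line bundle $E\subset T\mathcal E$ is $E_p=T_p\mathcal E\cap C^{n+1}_p$; it is spanned by $$D=\partial_x+y_1\partial_{y_0}+\dots+y_n\partial_{y_{n-1}}+f\,\partial_{y_n},$$ and its integral curves are the lifts of solutions. Classical Wilczynski invariants. Consider a linear ODE $y^{(n+1)}+p_n(x)y^{(n)}+\dots+p_0(x)y=0$. Locally there is a transformation $(x,y)\mapsto(\tilde x,\tilde y)=(\lambda(x),\mu(x)y)$ bringing it to the Laguerre–Forsyth form $\tilde y^{(n+1)}+q_{n-2}(\tilde x)\tilde y^{(n-2)}+\dots+q_0(\tilde x)\tilde y=0$. For $k=3,\dots,n+1$ put $$\tilde\theta_k=\sum_{j=1}^{k-2}(-1)^{j+1}\frac{(2k-j-1)!\,(n-k+j)!}{(k-j)!\,(j-1)!}\,q_{n-k+j}^{(j-1)},\qquad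 \theta_k(x)=(\lambda'(x))^k\,\tilde\theta_k(\lambda(x)).$$ By classical results of Wilczynski, $\theta_k$ does not depend on the choice of $(\lambda,\mu)$ and is a universal polynomial in the $p_i$ and their derivatives. Generalized Wilczynski invariants. The linearization of $y^{(n+1)}=f(x,y,y',\dots,y^{(n)})$ along a solution $y(x)$ is the linear ODE $h^{(n+1)}=\sum_{i=0}^n\frac{\partial f}{\partial y_i}h^{(i)}$, with coefficients evaluated along the solution. Define $W_k$ ($k=3,\dots,n+1$) to be the function on $\mathcal E$ whose restriction to each lifted solution is the invariant $\theta_k$ of the linearization along this solution; equivalently, substitute $p_i=-\partial f/\partial y_i$ and replace $d/dx$ by $D$ in the polynomial $\theta_k$. The generalized Wilczynski invariant $\mathcal W_k$ is the section of $S^kE^*$ with $\mathcal W_k(D,\dots,D)=W_k$. The plane coordinates $(x,y)$ used to compute the invariants of $\mathcal E$ and of $\overline{\mathcal E}$ are arbitrary. *)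

theory Defs
  imports "HOL-Analysis.Analysis"
begin

primrec Ck_on :: "nat \<Rightarrow> 'a::real_normed_vector set \<Rightarrow> ('a \<Rightarrow> 'b::real_normed_vector) \<Rightarrow> bool" where
  "Ck_on 0 S f \<longleftrightarrow> continuous_on S f"
| "Ck_on (Suc k) S f \<longleftrightarrow>
     (\<forall>x\<in>S. f differentiable (at x)) \<and> (\<forall>v. Ck_on k S (\<lambda>x. frechet_derivative f (at x) v))"

text \<open>Only used for open \<open>S\<close>.\<close>

definition smooth_on :: "'a::real_normed_vector set \<Rightarrow> ('a \<Rightarrow> 'b::real_normed_vector) \<Rightarrow> bool" where
  "smooth_on S f \<longleftrightarrow> (\<forall>k. Ck_on k S f)"

definition diffeo :: "'a::real_normed_vector set \<Rightarrow> 'b::real_normed_vector set \<Rightarrow> ('a \<Rightarrow> 'b) \<Rightarrow> bool" where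
  "diffeo A B g \<longleftrightarrow>
     open A \<and> open B \<and> bij_betw g A B \<and> smooth_on A g \<and> smooth_on B (the_inv_into A g)"

definition open_interval :: "real set \<Rightarrow> bool" where
  "open_interval I \<longleftrightarrow> open I \<and> is_interval I"


section \<open>Linear equations and their Wilczynski invariants\<close>

text \<open>The left-hand side of \<open>y^(n+1) + p_n y^(n) + ... + p_0 y = 0\<close>.\<close>

definition linear_lhs :: "nat \<Rightarrow> (nat \<Rightarrow> real \<Rightarrow> real) \<Rightarrow> (real \<Rightarrow> real) \<Rightarrow> real \<Rightarrow> real" where
  "linear_lhs n p y t = (deriv ^^ (n + 1)) y t + (\<Sum>i\<le>n. p i t * (deriv ^^ i) y t)"

text \<open>The left-hand side of \<open>y^(n+1) + q_(n-2) y^(n-2) + ... + q_0 y = 0\<close>; \<open>n \<ge> 2\<close> is intended.\<close>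

definition lf_lhs :: "nat \<Rightarrow> (nat \<Rightarrow> real \<Rightarrow> real) \<Rightarrow> (real \<Rightarrow> real) \<Rightarrow> real \<Rightarrow> real" where
  "lf_lhs n q y t = (deriv ^^ (n + 1)) y t + (\<Sum>i\<le>n - 2. q i t * (deriv ^^ i) y t)"

text \<open>The transformation \<open>(x, y) \<mapsto> (l x, m x * y)\<close>, defined for \<open>x \<in> I\<close>, brings the linear
  equation with coefficients \<open>p\<close> to the Laguerre-Forsyth form with coefficients \<open>q\<close>: its
  prolongation to jets maps the one equation onto the other, that is, the graph of a function
  satisfies the first equation at the parameter \<open>t\<close> iff the image graph satisfies the second
  one at \<open>l t\<close>.\<close>

definition brings_to_lf ::
  "nat \<Rightarrow> (nat \<Rightarrow> real \<Rightarrow> real) \<Rightarrow> real set \<Rightarrow> (real \<Rightarrow> real) \<Rightarrow> (real \<Rightarrow> real) \<Rightarrow> (nat \<Rightarrow> real \<Rightarrow> real) \<Rightarrow> bool"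
  where
  "brings_to_lf n p I l m q \<longleftrightarrow>
     open_interval I \<and> diffeo I (l ` I) l \<and>
     smooth_on I m \<and> (\<forall>t\<in>I. m t \<noteq> 0) \<and>
     (\<forall>i\<le>n - 2. smooth_on (l ` I) (q i)) \<and>
     (\<forall>y z. smooth_on I y \<longrightarrow> smooth_on (l ` I) z \<longrightarrow> (\<forall>t\<in>I. z (l t) = m t * y t) \<longrightarrow>
        (\<forall>t\<in>I. linear_lhs n p y t = 0 \<longleftrightarrow> lf_lhs n q z (l t) = 0))"

text \<open>Used for \<open>3 \<le> k \<le> n + 1\<close>, so that no subtraction truncates.\<close>

definition theta_lf :: "nat \<Rightarrow> (nat \<Rightarrow> real \<Rightarrow> real) \<Rightarrow> nat \<Rightarrow> real \<Rightarrow> real" where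
  "theta_lf n q k s =
     (\<Sum>j = 1..k - 2. (-1) ^ (j + 1) * (fact (2 * k - j - 1) * fact (n + j - k))
        / (fact (k - j) * fact (j - 1)) * (deriv ^^ (j - 1)) (q (n + j - k)) s)"

text \<open>The value does not depend on the local transformation chosen around \<open>x\<close>
  (Wilczynski's theorem), whence the definite description.\<close>

definition wilczynski_theta :: "nat \<Rightarrow> (nat \<Rightarrow> real \<Rightarrow> real) \<Rightarrow> nat \<Rightarrow> real \<Rightarrow> real" where
  "wilczynski_theta n p k x =
     (THE t. \<exists>I l m q. x \<in> I \<and> brings_to_lf n p I l m q \<and> t = deriv l x ^ k * theta_lf n q k (l x))"


section \<open>Jets in coordinates\<close>

text \<open>A choice of plane coordinates \<open>(x, y)\<close> identifies an open part of \<open>J^n\<close>, for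
  \<open>n + 1 = CARD('l)\<close>, with an open subset of the type \<open>'l jet\<close> of coordinate tuples
  \<open>(x, (y_0, ..., y_n))\<close>, and an open part of \<open>J^(n+1)\<close> with an open subset of \<open>'l jet \<times> real\<close>, the
  last component being \<open>y_(n+1)\<close>.  The linear order of the index type \<open>'l\<close> numbers the
  coordinates: \<open>i\<close> is the index of \<open>y_(ynum i)\<close>, and \<open>yidx k\<close> is the index of \<open>y_k\<close>.\<close>

type_synonym 'l jet = "real \<times> (real ^ 'l)"

definition ynum :: "'l::{finite,linorder} \<Rightarrow> nat" where
  "ynum i = card {..<i}"

definition yidx :: "nat \<Rightarrow> 'l::{finite,linorder}" where
  "yidx k = inv ynum k"

definition lift_jet :: "(real \<Rightarrow> real) \<Rightarrow> real \<Rightarrow> 'l::{finite,linorder} jet" where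
  "lift_jet y t = (t, \<chi> i. (deriv ^^ ynum i) y t)"

definition d_dy :: "nat \<Rightarrow> ('l::{finite,linorder} jet \<Rightarrow> real) \<Rightarrow> 'l jet \<Rightarrow> real" where
  "d_dy k f u = frechet_derivative f (at u) (0, axis (yidx k) 1)"

text \<open>The contact distribution \<open>C^(n+1)\<close> at the point \<open>(u, c)\<close> of \<open>J^(n+1)\<close>, with \<open>c = y_(n+1)\<close>: the
  generators are \<open>\<partial>_(y_(n+1))\<close> and \<open>\<partial>_x + y_1 \<partial>_(y_0) + ... + y_n \<partial>_(y_(n-1)) + c \<partial>_(y_n)\<close>.\<close>

definition contact_plane :: "nat \<Rightarrow> 'l::{finite,linorder} jet \<times> real \<Rightarrow> ('l jet \<times> real) set" where
  "contact_plane n = (\<lambda>(u, c). span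
     { ((0, 0), 1),
       ((1, \<chi> i. if ynum i < n then snd u $ yidx (ynum i + 1) else c), 0) })"

text \<open>A local contact transformation between the open subsets \<open>U\<close> and \<open>V\<close> of \<open>J^(n+1)\<close>, written in
  coordinates.  The plane coordinates used around \<open>U\<close> and around \<open>V\<close> are unrelated; a change of
  plane coordinates is itself the case of the identity of \<open>J^(n+1)\<close>.\<close>

definition contact_transformation ::
  "nat \<Rightarrow> ('l::{finite,linorder} jet \<times> real) set \<Rightarrow> ('l jet \<times> real) set
     \<Rightarrow> ('l jet \<times> real \<Rightarrow> 'l jet \<times> real) \<Rightarrow> bool" where
  "contact_transformation n U V \<phi> \<longleftrightarrow>
     diffeo U V \<phi> \<and>
     (\<forall>p\<in>U. frechet_derivative \<phi> (at p) ` contact_plane n p = contact_plane n (\<phi> p))"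


section \<open>Scalar ordinary differential equations\<close>

text \<open>The submanifold \<open>y_(n+1) = f (x, y_0, ..., y_n)\<close>, where \<open>(x, y_0, ..., y_n)\<close> ranges over the
  domain \<open>A\<close> of \<open>f\<close>.\<close>

definition equation :: "'l jet set \<Rightarrow> ('l jet \<Rightarrow> real) \<Rightarrow> ('l jet \<times> real) set" where
  "equation A f = {(u, f u) | u. u \<in> A}"

text \<open>Intended for embedded submanifolds \<open>M\<close>.\<close>

definition tangent_space :: "'a::real_normed_vector set \<Rightarrow> 'a \<Rightarrow> 'a set" where
  "tangent_space M p =
     {v. \<exists>\<gamma> e. e > 0 \<and> smooth_on {-e<..<e} \<gamma> \<and> (\<forall>t\<in>{-e<..<e}. \<gamma> t \<in> M) \<and>
           \<gamma> 0 = p \<and> (\<gamma> has_vector_derivative v) (at (0::real))}"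

definition line_bundle ::
  "nat \<Rightarrow> ('l::{finite,linorder} jet \<times> real) set \<Rightarrow> 'l jet \<times> real \<Rightarrow> ('l jet \<times> real) set" where
  "line_bundle n M p = tangent_space M p \<inter> contact_plane n p"

definition solution_on ::
  "nat \<Rightarrow> 'l::{finite,linorder} jet set \<Rightarrow> ('l jet \<Rightarrow> real) \<Rightarrow> real set \<Rightarrow> (real \<Rightarrow> real) \<Rightarrow> bool" where
  "solution_on n A f I y \<longleftrightarrow>
     open_interval I \<and> smooth_on I y \<and>
     (\<forall>t\<in>I. lift_jet y t \<in> A \<and> (deriv ^^ (n + 1)) y t = f (lift_jet y t))"

text \<open>The function \<open>W_k\<close> in the coordinates \<open>u = (x, y_0, ..., y_n)\<close> of the equation: its value at
  \<open>u\<close> is the invariant \<open>\<theta>_k\<close>, at \<open>x\<close>, of the linearization along the solution through \<open>u\<close>.\<close>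

definition wilczynski_fun ::
  "nat \<Rightarrow> 'l::{finite,linorder} jet set \<Rightarrow> ('l jet \<Rightarrow> real) \<Rightarrow> nat \<Rightarrow> 'l jet \<Rightarrow> real" where
  "wilczynski_fun n A f k u =
     (THE w. \<exists>I y. solution_on n A f I y \<and> fst u \<in> I \<and> lift_jet y (fst u) = u \<and>
        w = wilczynski_theta n (\<lambda>i t. - d_dy i f (lift_jet y t)) k (fst u))"

text \<open>The symmetric \<open>k\<close>-form on the line \<open>E_p\<close> with value \<open>W_k\<close> on \<open>(D, ..., D)\<close>, evaluated on the
  vectors \<open>vs 0, ..., vs (k - 1)\<close> of \<open>E_p\<close>; here, in the coordinates \<open>(x, y_0, ..., y_n)\<close>,
  \<open>D = \<partial>_x + y_1 \<partial>_(y_0) + ... + y_n \<partial>_(y_(n-1)) + f \<partial>_(y_n)\<close>.  As \<open>D\<close> spans \<open>E_p\<close> and has \<open>x\<close>-component 1, a vector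
  \<open>v\<close> of \<open>E_p\<close> equals \<open>a D\<close> for \<open>a\<close> its own \<open>x\<close>-component \<open>fst (fst v)\<close>.\<close>

definition wilczynski_form ::
  "nat \<Rightarrow> 'l::{finite,linorder} jet set \<Rightarrow> ('l jet \<Rightarrow> real) \<Rightarrow> nat \<Rightarrow> 'l jet \<times> real
     \<Rightarrow> (nat \<Rightarrow> 'l jet \<times> real) \<Rightarrow> real" where
  "wilczynski_form n A f k p vs = wilczynski_fun n A f k (fst p) * (\<Prod>i<k. fst (fst (vs i)))"

end

theory Submission
  imports Defs
begin

text \<open>Lifts of solutions are integral curves of \<open>E\<close>, and a contact transformation \<open>\<phi>\<close> maps them to
  lifts of solutions.  Differentiating the contact condition along the lifts of \<open>y + \<epsilon> h\<close> shows that
  \<open>\<phi>\<close> preserves the derived flag of the contact distribution, so it multiplies the form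
  \<open>dy_0 - y_1 dx\<close> by a function \<open>\<mu>\<close>.  Together with the change \<open>\<lambda>\<close> of the independent variable
  along a solution, \<open>\<mu>\<close> gives a transformation \<open>(x, h) \<mapsto> (\<lambda>(x), \<mu>(x) h)\<close> between the linearizations
  of the two equations along corresponding solutions.  Under such a transformation Wilczynski's invariant
  \<open>\<theta>_k\<close> acquires the factor \<open>\<lambda>'^k\<close>, which is how the \<open>x\<close>-components of vectors of \<open>E\<close> change.

  That \<open>\<theta>_k\<close> is well defined rests on the residual freedom in the Laguerre-Forsyth form: it consists of
  Moebius transformations \<open>l\<close> together with constant multiples of \<open>(l')^(n / 2)\<close>, and the covariance of
  \<open>\<theta>_k\<close> under them comes down to the vanishing of the \<open>N\<close>-th difference of a polynomial of degree
  less than \<open>N\<close>.\<close>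

section \<open>Smooth maps\<close>

text \<open>As \<open>wilczynski_theta\<close> is a definite description and not a polynomial in the
  coefficients, \<theta>_k is never computed for a general equation. That a value exists needs a
  local Laguerre-Forsyth form, hence integral curves of smooth fields; existence and local
  uniqueness of such curves also make \<open>wilczynski_fun\<close> well defined. That the value is
  unique concerns only pairs of equations already in Laguerre-Forsyth form: the two coefficients
  that vanish on either side force \<psi>' = - \<psi>^2 for \<psi> = - l'' / (2 l').

  On the geometric side h is an arbitrary function, not a solution of the linearized equation, since
  the contact condition holds on all of \<open>U\<close>. Let K_i be the value of dy_i - y_(i+1) dx
  on the image of the variation h. Then K_i' = \<lambda>' K_(i+1), so the K_i are the successive
  derivatives of K_0 = \<mu> h in the new variable. That h solves the linearization at a point means
  that its variation is tangent to the equation there, and \<phi> preserves tangency.\<close>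

lemma Ck_on_imp_continuous_on: "Ck_on k S f \<Longrightarrow> continuous_on S f"
  by (cases k) (auto intro!: continuous_at_imp_continuous_on differentiable_imp_continuous_within)

lemma Ck_on_SucD: "Ck_on (Suc k) S f \<Longrightarrow> Ck_on k S f"
proof (induction k arbitrary: f)
  case 0
  then show ?case using Ck_on_imp_continuous_on by (metis Ck_on.simps(1))
next
  case (Suc k)
  then show ?case by (subst Ck_on.simps) (auto dest: Suc.IH)
qed

lemma Ck_on_subset: "Ck_on k S f \<Longrightarrow> T \<subseteq> S \<Longrightarrow> Ck_on k T f"
  by (induction k arbitrary: f) (auto intro: continuous_on_subset)

abbreviation fderiv :: "('a::real_normed_vector \<Rightarrow> 'b::real_normed_vector) \<Rightarrow> 'a \<Rightarrow> 'a \<Rightarrow> 'b" where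
  "fderiv f x \<equiv> frechet_derivative f (at x)"

lemma frechet_derivative_cong_open:
  assumes "open S" "x \<in> S" "\<And>y. y \<in> S \<Longrightarrow> f y = g y"
  shows "fderiv f x = fderiv g x"
proof -
  have "(f has_derivative D) (at x) \<longleftrightarrow> (g has_derivative D) (at x)" for D
    using assms has_derivative_transform_within_open[of f D x UNIV S g]
      has_derivative_transform_within_open[of g D x UNIV S f] by auto
  then show ?thesis by (simp add: frechet_derivative_def)
qed

lemma differentiable_cong_open:
  assumes "open S" "x \<in> S" "\<And>y. y \<in> S \<Longrightarrow> f y = g y" "f differentiable (at x)"
  shows "g differentiable (at x)"
  using assms has_derivative_transform_within_open[of f _ x UNIV S g]
  unfolding differentiable_def by blast

lemma Ck_on_cong:
  assumes "open S" "\<And>x. x \<in> S \<Longrightarrow> f x = g x" "Ck_on k S f"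
  shows "Ck_on k S g"
  using assms(2,3)
proof (induction k arbitrary: f g)
  case 0
  then show ?case by (simp cong: continuous_on_cong)
next
  case (Suc k)
  have "g differentiable (at x)" if "x \<in> S" for x
    using differentiable_cong_open[OF assms(1) that, of f g] Suc.prems that by auto
  moreover have "Ck_on k S (\<lambda>x. fderiv g x v)" for v
    using Suc.IH[of "\<lambda>x. fderiv f x v" "\<lambda>x. fderiv g x v"]
      Suc.prems frechet_derivative_cong_open[OF assms(1), of _ f g] by fastforce
  ultimately show ?case by simp
qed

lemma Ck_on_SucI:
  assumes "open S" "\<And>x. x \<in> S \<Longrightarrow> (f has_derivative D x) (at x)" "\<And>v. Ck_on k S (\<lambda>x. D x v)"
  shows "Ck_on (Suc k) S f"
proof -
  have "D x = fderiv f x" if "x \<in> S" for x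
    using assms(2)[OF that] frechet_derivative_at by blast
  then have "Ck_on k S (\<lambda>x. fderiv f x v)" for v
    using Ck_on_cong[OF assms(1), of "\<lambda>x. D x v"] assms(3)[of v] by auto
  then show ?thesis using assms(2) by (auto simp: differentiable_def)
qed

lemma Ck_on_SucE:
  assumes "Ck_on (Suc k) S f"
  obtains D where "\<And>x. x \<in> S \<Longrightarrow> (f has_derivative D x) (at x)" "\<And>v. Ck_on k S (\<lambda>x. D x v)"
proof (rule that[of "\<lambda>x. fderiv f x"])
  show "(f has_derivative fderiv f x) (at x)" if "x \<in> S" for x
    using assms that by (auto simp: frechet_derivative_works)
qed (use assms in auto)

lemma Ck_on_const: "open S \<Longrightarrow> Ck_on k S (\<lambda>x. c)"
  by (induction k arbitrary: c) auto

lemma Ck_on_linear: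
  assumes "open S" "bounded_linear L"
  shows "Ck_on k S L"
proof (cases k)
  case 0
  then show ?thesis using assms by (simp add: linear_continuous_on)
next
  case (Suc j)
  show ?thesis unfolding Suc
    by (rule Ck_on_SucI[where D = "\<lambda>_. L"])
       (use assms in \<open>auto intro: bounded_linear_imp_has_derivative Ck_on_const\<close>)
qed

lemma Ck_on_add:
  assumes "open S"
  shows "Ck_on k S f \<Longrightarrow> Ck_on k S g \<Longrightarrow> Ck_on k S (\<lambda>x. f x + g x)"
proof (induction k arbitrary: f g)
  case 0
  then show ?case by (simp add: continuous_on_add)
next
  case (Suc k)
  obtain D where D: "\<And>x. x \<in> S \<Longrightarrow> (f has_derivative D x) (at x)" "\<And>v. Ck_on k S (\<lambda>x. D x v)"
    using Suc.prems(1) by (rule Ck_on_SucE) blast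
  obtain E where E: "\<And>x. x \<in> S \<Longrightarrow> (g has_derivative E x) (at x)" "\<And>v. Ck_on k S (\<lambda>x. E x v)"
    using Suc.prems(2) by (rule Ck_on_SucE) blast
  show ?case
    by (rule Ck_on_SucI[where D = "\<lambda>x v. D x v + E x v"])
       (auto intro!: assms has_derivative_add D E Suc.IH)
qed

lemma Ck_on_bilinear:
  assumes "open S" "bounded_bilinear B"
  shows "Ck_on k S f \<Longrightarrow> Ck_on k S g \<Longrightarrow> Ck_on k S (\<lambda>x. B (f x) (g x))"
proof (induction k arbitrary: f g)
  case 0
  then show ?case using bounded_bilinear.continuous_on[OF assms(2)] by auto
next
  case (Suc k)
  obtain D where D: "\<And>x. x \<in> S \<Longrightarrow> (f has_derivative D x) (at x)" "\<And>v. Ck_on k S (\<lambda>x. D x v)"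
    using Suc.prems(1) by (rule Ck_on_SucE) blast
  obtain E where E: "\<And>x. x \<in> S \<Longrightarrow> (g has_derivative E x) (at x)" "\<And>v. Ck_on k S (\<lambda>x. E x v)"
    using Suc.prems(2) by (rule Ck_on_SucE) blast
  show ?case
    by (rule Ck_on_SucI[where D = "\<lambda>x v. B (f x) (E x v) + B (D x v) (g x)"])
       (auto intro!: assms bounded_bilinear.FDERIV[OF assms(2)] Ck_on_add D E Suc.IH Ck_on_SucD[OF Suc.prems(1)] Ck_on_SucD[OF Suc.prems(2)])
qed

lemma Ck_on_linear_compose:
  assumes "open S" "bounded_linear L"
  shows "Ck_on k S f \<Longrightarrow> Ck_on k S (\<lambda>x. L (f x))"
proof (induction k arbitrary: f)
  case 0
  then show ?case using assms bounded_linear.continuous_on by auto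
next
  case (Suc k)
  obtain D where D: "\<And>x. x \<in> S \<Longrightarrow> (f has_derivative D x) (at x)" "\<And>v. Ck_on k S (\<lambda>x. D x v)"
    using Suc.prems(1) by (rule Ck_on_SucE) blast
  show ?case
    by (rule Ck_on_SucI[where D = "\<lambda>x v. L (D x v)"])
       (auto intro!: assms bounded_linear.has_derivative[OF assms(2)] D Suc.IH)
qed

lemma Ck_on_sum:
  assumes "open S" "\<And>i. i \<in> A \<Longrightarrow> Ck_on k S (f i)"
  shows "Ck_on k S (\<lambda>x. \<Sum>i\<in>A. f i x)"
  using assms(2)
proof (induction A rule: infinite_finite_induct)
  case (insert a A)
  then show ?case by (auto intro!: Ck_on_add assms(1))
qed (auto intro: Ck_on_const assms(1))

text \<open>\<open>Ck_on\<close> differentiates only in fixed directions, whereas the chain rule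
  gives \<open>E (f x) (D x v)\<close> with a direction that depends on \<open>x\<close>. Expanding
  this direction in \<open>Basis\<close> leaves products of functions to which the induction
  hypothesis applies.\<close>

lemma Ck_on_compose:
  fixes f :: "'a::real_normed_vector \<Rightarrow> 'b::euclidean_space"
  assumes "open S" "f ` S \<subseteq> T"
  shows "Ck_on k S f \<Longrightarrow> Ck_on k T g \<Longrightarrow> Ck_on k S (\<lambda>x. g (f x))"
proof (induction k arbitrary: g)
  case 0
  then show ?case using continuous_on_compose2[of T g S f] assms by auto
next
  case (Suc k)
  obtain D where D: "\<And>x. x \<in> S \<Longrightarrow> (f has_derivative D x) (at x)" "\<And>v. Ck_on k S (\<lambda>x. D x v)"
    using Suc.prems(1) by (rule Ck_on_SucE) blast
  obtain E where E: "\<And>x. x \<in> T \<Longrightarrow> (g has_derivative E x) (at x)" "\<And>v. Ck_on k T (\<lambda>x. E x v)"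
    using Suc.prems(2) by (rule Ck_on_SucE) blast
  show ?case
  proof (rule Ck_on_SucI[where D = "\<lambda>x v. \<Sum>b\<in>Basis. (D x v \<bullet> b) *\<^sub>R E (f x) b"])
    fix x assume x: "x \<in> S"
    then have fx: "f x \<in> T" using assms by auto
    have lin: "linear (E (f x))" using E(1)[OF fx] has_derivative_linear by blast
    have "E (f x) w = (\<Sum>b\<in>Basis. (w \<bullet> b) *\<^sub>R E (f x) b)" for w
    proof -
      have "E (f x) w = E (f x) (\<Sum>b\<in>Basis. (w \<bullet> b) *\<^sub>R b)" by (simp add: euclidean_representation)
      then show ?thesis by (simp add: linear_sum[OF lin] linear_scale[OF lin])
    qed
    from this[symmetric] have "(\<lambda>v. \<Sum>b\<in>Basis. (D x v \<bullet> b) *\<^sub>R E (f x) b) = E (f x) \<circ> D x"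
      by (intro ext) (simp only: o_def)
    then show "((\<lambda>x. g (f x)) has_derivative (\<lambda>v. \<Sum>b\<in>Basis. (D x v \<bullet> b) *\<^sub>R E (f x) b)) (at x)"
      using diff_chain_at[OF D(1)[OF x] E(1)[OF fx]] by (simp add: o_def)
  next
    fix v
    have "Ck_on k S (\<lambda>x. E (f x) b)" for b
      using Suc.IH[of "\<lambda>y. E y b"] Ck_on_SucD[OF Suc.prems(1)] E(2) by simp
    then show "Ck_on k S (\<lambda>x. \<Sum>b\<in>Basis. (D x v \<bullet> b) *\<^sub>R E (f x) b)"
      by (intro Ck_on_sum assms Ck_on_bilinear[OF assms(1) bounded_bilinear_scaleR]
          Ck_on_linear_compose[OF assms(1) bounded_linear_inner_left] D)
  qed (rule assms)
qed

lemma Ck_on_inverse: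
  fixes f :: "'a::real_normed_vector \<Rightarrow> real"
  assumes "open S" "\<And>x. x \<in> S \<Longrightarrow> f x \<noteq> 0"
  shows "Ck_on k S f \<Longrightarrow> Ck_on k S (\<lambda>x. inverse (f x))"
proof (induction k)
  case 0
  then show ?case using assms by (auto intro: continuous_on_inverse)
next
  case (Suc k)
  obtain D where D: "\<And>x. x \<in> S \<Longrightarrow> (f has_derivative D x) (at x)" "\<And>v. Ck_on k S (\<lambda>x. D x v)"
    using Suc.prems(1) by (rule Ck_on_SucE) blast
  have inv: "Ck_on k S (\<lambda>x. inverse (f x))" using Suc.IH Ck_on_SucD[OF Suc.prems] by simp
  show ?case
  proof (rule Ck_on_SucI[where D = "\<lambda>x v. - (inverse (f x) * D x v * inverse (f x))"])
    show "Ck_on k S (\<lambda>x. - (inverse (f x) * D x v * inverse (f x)))" for v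
      by (intro Ck_on_linear_compose[OF assms(1), where L = uminus] bounded_linear_minus bounded_linear_ident
          Ck_on_bilinear[OF assms(1) bounded_bilinear_mult] inv D)
  qed (use assms D in \<open>auto intro!: has_derivative_inverse\<close>)
qed


lemma smooth_on_imp_continuous_on: "smooth_on S f \<Longrightarrow> continuous_on S f"
  unfolding smooth_on_def using Ck_on_imp_continuous_on by blast

lemma smooth_on_has_derivative:
  "smooth_on S f \<Longrightarrow> x \<in> S \<Longrightarrow> (f has_derivative fderiv f x) (at x)"
  unfolding smooth_on_def using frechet_derivative_works Ck_on.simps(2) by blast

lemma smooth_on_frechet_derivative:
  "smooth_on S f \<Longrightarrow> smooth_on S (\<lambda>x. fderiv f x v)"
  unfolding smooth_on_def using Ck_on.simps(2) by blast

lemma smooth_on_subset: "smooth_on S f \<Longrightarrow> T \<subseteq> S \<Longrightarrow> smooth_on T f"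
  unfolding smooth_on_def using Ck_on_subset by blast

lemma smooth_on_cong:
  "open S \<Longrightarrow> (\<And>x. x \<in> S \<Longrightarrow> f x = g x) \<Longrightarrow> smooth_on S f \<Longrightarrow> smooth_on S g"
  unfolding smooth_on_def using Ck_on_cong by blast

lemma smooth_on_const: "open S \<Longrightarrow> smooth_on S (\<lambda>x. c)"
  by (simp add: smooth_on_def Ck_on_const)

lemma smooth_on_linear: "open S \<Longrightarrow> bounded_linear L \<Longrightarrow> smooth_on S L"
  by (simp add: smooth_on_def Ck_on_linear)

lemma smooth_on_ident: "open S \<Longrightarrow> smooth_on S (\<lambda>x. x)"
  by (simp add: smooth_on_linear)

lemma smooth_on_linear_compose:
  "bounded_linear L \<Longrightarrow> open S \<Longrightarrow> smooth_on S f \<Longrightarrow> smooth_on S (\<lambda>x. L (f x))"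
  by (simp add: smooth_on_def Ck_on_linear_compose)

lemmas smooth_on_fst = smooth_on_linear_compose[OF bounded_linear_fst]
  and smooth_on_snd = smooth_on_linear_compose[OF bounded_linear_snd]
  and smooth_on_vec_nth = smooth_on_linear_compose[OF bounded_linear_vec_nth]
  and smooth_on_minus = smooth_on_linear_compose[OF bounded_linear_minus[OF bounded_linear_ident]]

lemma smooth_on_add:
  "open S \<Longrightarrow> smooth_on S f \<Longrightarrow> smooth_on S g \<Longrightarrow> smooth_on S (\<lambda>x. f x + g x)"
  by (simp add: smooth_on_def Ck_on_add)

lemma smooth_on_diff:
  "open S \<Longrightarrow> smooth_on S f \<Longrightarrow> smooth_on S g \<Longrightarrow> smooth_on S (\<lambda>x. f x - g x)"
  using smooth_on_add[of S f "\<lambda>x. - g x"] smooth_on_minus[of S g] by simp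

lemma smooth_on_sum:
  "open S \<Longrightarrow> (\<And>i. i \<in> A \<Longrightarrow> smooth_on S (f i)) \<Longrightarrow> smooth_on S (\<lambda>x. \<Sum>i\<in>A. f i x)"
  by (simp add: smooth_on_def Ck_on_sum)

lemma smooth_on_bilinear:
  "bounded_bilinear B \<Longrightarrow> open S \<Longrightarrow> smooth_on S f \<Longrightarrow> smooth_on S g \<Longrightarrow> smooth_on S (\<lambda>x. B (f x) (g x))"
  by (simp add: smooth_on_def Ck_on_bilinear)

lemmas smooth_on_mult = smooth_on_bilinear[OF bounded_bilinear_mult]
  and smooth_on_scaleR = smooth_on_bilinear[OF bounded_bilinear_scaleR]

lemma smooth_on_inverse:
  fixes f :: "'a::real_normed_vector \<Rightarrow> real"
  shows "open S \<Longrightarrow> (\<And>x. x \<in> S \<Longrightarrow> f x \<noteq> 0) \<Longrightarrow> smooth_on S f \<Longrightarrow> smooth_on S (\<lambda>x. inverse (f x))"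
  by (simp add: smooth_on_def Ck_on_inverse)

lemma smooth_on_divide:
  fixes f :: "'a::real_normed_vector \<Rightarrow> real"
  shows "open S \<Longrightarrow> (\<And>x. x \<in> S \<Longrightarrow> g x \<noteq> 0) \<Longrightarrow> smooth_on S f \<Longrightarrow> smooth_on S g \<Longrightarrow> smooth_on S (\<lambda>x. f x / g x)"
  by (simp add: divide_inverse smooth_on_mult smooth_on_inverse)

lemma smooth_on_power:
  fixes f :: "'a::real_normed_vector \<Rightarrow> real"
  shows "open S \<Longrightarrow> smooth_on S f \<Longrightarrow> smooth_on S (\<lambda>x. f x ^ k)"
  by (induction k) (auto intro: smooth_on_const smooth_on_mult)

lemma smooth_on_compose:
  fixes f :: "'a::real_normed_vector \<Rightarrow> 'b::euclidean_space"
  shows "open S \<Longrightarrow> f ` S \<subseteq> T \<Longrightarrow> smooth_on S f \<Longrightarrow> smooth_on T g \<Longrightarrow> smooth_on S (\<lambda>x. g (f x))"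
  unfolding smooth_on_def using Ck_on_compose by blast

lemma smooth_on_Pair:
  assumes "open S" "smooth_on S f" "smooth_on S g"
  shows "smooth_on S (\<lambda>x. (f x, g x))"
proof -
  have "bounded_linear (\<lambda>a. (a, 0))" "bounded_linear (\<lambda>a. (0, a))"
    by (auto intro: bounded_linear_Pair bounded_linear_ident bounded_linear_zero)
  from smooth_on_add[OF assms(1) smooth_on_linear_compose[OF this(1) assms(1,2)]
      smooth_on_linear_compose[OF this(2) assms(1,3)]]
  show ?thesis by simp
qed

lemma smooth_on_vec_lambda:
  fixes f :: "'c::finite \<Rightarrow> _ \<Rightarrow> real"
  assumes "open S" "\<And>i. smooth_on S (f i)"
  shows "smooth_on S (\<lambda>x. \<chi> i. f i x)"
proof -
  have "(\<chi> i. f i x) = (\<Sum>i\<in>UNIV. f i x *\<^sub>R axis i 1)" for x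
    using basis_expansion[of "\<chi> i. f i x"] by (simp add: scalar_mult_eq_scaleR)
  then show ?thesis
    by (auto intro!: smooth_on_sum smooth_on_scaleR smooth_on_const assms)
qed

lemmas smooth_on_intros = smooth_on_const smooth_on_ident smooth_on_fst smooth_on_snd smooth_on_vec_nth
  smooth_on_minus smooth_on_add smooth_on_diff smooth_on_sum smooth_on_mult smooth_on_scaleR
  smooth_on_power smooth_on_Pair smooth_on_vec_lambda


section \<open>Smooth functions of one variable\<close>

lemma frechet_derivative_eq_deriv:
  fixes f :: "real \<Rightarrow> real"
  assumes "f differentiable (at x)"
  shows "fderiv f x v = v * deriv f x"
proof -
  have "(f has_derivative (\<lambda>v. v * deriv f x)) (at x)"
    using assms DERIV_deriv_iff_real_differentiable[of f x]
    by (simp add: has_field_derivative_def mult_commute_abs)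
  then show ?thesis by (metis frechet_derivative_at)
qed

lemma deriv_cong_open:
  fixes f g :: "real \<Rightarrow> real"
  assumes "open S" "x \<in> S" "\<And>y. y \<in> S \<Longrightarrow> f y = g y"
  shows "deriv f x = deriv g x"
  using assms by (intro deriv_cong_ev refl) (auto simp: eventually_nhds)

lemma funpow_deriv_cong_open:
  fixes f g :: "real \<Rightarrow> real"
  assumes "open S" "x \<in> S" "\<And>y. y \<in> S \<Longrightarrow> f y = g y"
  shows "(deriv ^^ i) f x = (deriv ^^ i) g x"
proof -
  have "\<forall>y\<in>S. (deriv ^^ i) f y = (deriv ^^ i) g y"
  proof (induction i)
    case (Suc i)
    then show ?case by (auto intro: deriv_cong_open[OF assms(1)])
  qed (simp add: assms(3))
  then show ?thesis using assms(2) by blast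
qed

lemma Ck_on_Suc_real:
  fixes f :: "real \<Rightarrow> real"
  assumes "open S"
  shows "Ck_on (Suc k) S f \<longleftrightarrow> (\<forall>x\<in>S. f differentiable (at x)) \<and> Ck_on k S (deriv f)"
proof safe
  assume *: "Ck_on (Suc k) S f"
  show "Ck_on k S (deriv f)"
    by (rule Ck_on_cong[of S "\<lambda>x. fderiv f x 1"])
       (use * assms frechet_derivative_eq_deriv in auto)
next
  assume *: "\<forall>x\<in>S. f differentiable (at x)" "Ck_on k S (deriv f)"
  have "Ck_on k S (\<lambda>x. fderiv f x v)" for v
    by (rule Ck_on_cong[of S "\<lambda>x. v * deriv f x"])
       (use * assms frechet_derivative_eq_deriv in \<open>auto intro!: Ck_on_bilinear[OF _ bounded_bilinear_mult] Ck_on_const\<close>)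
  then show "Ck_on (Suc k) S f" using * by simp
qed auto

lemma smooth_on_deriv:
  fixes f :: "real \<Rightarrow> real"
  shows "open S \<Longrightarrow> smooth_on S f \<Longrightarrow> smooth_on S (deriv f)"
  unfolding smooth_on_def using Ck_on_Suc_real by blast

lemma smooth_on_funpow_deriv:
  fixes f :: "real \<Rightarrow> real"
  shows "open S \<Longrightarrow> smooth_on S f \<Longrightarrow> smooth_on S ((deriv ^^ i) f)"
  by (induction i) (auto intro: smooth_on_deriv)

lemma smooth_on_DERIV:
  fixes f :: "real \<Rightarrow> real"
  shows "smooth_on S f \<Longrightarrow> x \<in> S \<Longrightarrow> (f has_real_derivative deriv f x) (at x)"
  using smooth_on_has_derivative DERIV_deriv_iff_real_differentiable differentiable_def by blast

lemma smooth_on_DERIV_funpow: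
  fixes f :: "real \<Rightarrow> real"
  shows "open S \<Longrightarrow> smooth_on S f \<Longrightarrow> x \<in> S \<Longrightarrow> ((deriv ^^ i) f has_real_derivative (deriv ^^ Suc i) f x) (at x)"
  using smooth_on_DERIV[OF smooth_on_funpow_deriv, of S f x i] by simp

text \<open>Bootstrapping: an integral curve gains one derivative from each use of the equation.\<close>

lemma smooth_on_integral_curve:
  fixes u :: "real \<Rightarrow> 'a::euclidean_space"
  assumes "open I" "open S" "smooth_on S F" "u ` I \<subseteq> S"
    and "\<And>t. t \<in> I \<Longrightarrow> (u has_vector_derivative F (u t)) (at t)"
  shows "smooth_on I u"
proof -
  have "Ck_on k I u" for k
  proof (induction k)
    case 0
    show ?case using assms(5)
      by (auto intro!: continuous_at_imp_continuous_on has_vector_derivative_continuous)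
  next
    case (Suc k)
    have "Ck_on k I (\<lambda>t. F (u t))"
      using assms(3) Ck_on_compose[OF assms(1,4) Suc] unfolding smooth_on_def by blast
    then show ?case
      by (intro Ck_on_SucI[where D = "\<lambda>t v. v *\<^sub>R F (u t)"])
         (use assms in \<open>auto simp: has_vector_derivative_def intro!: Ck_on_const Ck_on_bilinear[OF _ bounded_bilinear_scaleR]\<close>)
  qed
  then show ?thesis by (simp add: smooth_on_def)
qed

section \<open>Derivatives along lines and curves; symmetry of the second derivative\<close>

lemma has_vector_derivative_along_line:
  assumes "smooth_on S f" "p + s *\<^sub>R a \<in> S"
  shows "((\<lambda>s. f (p + s *\<^sub>R a)) has_vector_derivative fderiv f (p + s *\<^sub>R a) a) (at s)"
proof -
  have "((\<lambda>s. p + s *\<^sub>R a) has_vector_derivative a) (at s)"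
    by (auto intro!: derivative_eq_intros)
  from vector_derivative_diff_chain_within[OF this, of f "fderiv f (p + s *\<^sub>R a)"]
  show ?thesis using smooth_on_has_derivative[OF assms] by (simp add: o_def has_derivative_at_withinI)
qed

text \<open>Two applications of the mean value theorem, in direction \<open>a\<close> and then in
  \<open>b\<close>. The second difference is symmetric in \<open>a\<close> and \<open>b\<close>, so
  exchanging them compares the two mixed derivatives at nearby points.\<close>

lemma mixed_difference_mvt:
  fixes f :: "'a::real_normed_vector \<Rightarrow> real"
  assumes sm: "smooth_on S f" and h: "h > 0"
    and S: "\<And>s t. s \<in> {0..h} \<Longrightarrow> t \<in> {0..h} \<Longrightarrow> p + s *\<^sub>R a + t *\<^sub>R b \<in> S"
  shows "\<exists>s\<in>{0..h}. \<exists>t\<in>{0..h}.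
    f (p + h *\<^sub>R a + h *\<^sub>R b) - f (p + h *\<^sub>R a) - f (p + h *\<^sub>R b) + f p =
      h * h * fderiv (\<lambda>x. fderiv f x a) (p + s *\<^sub>R a + t *\<^sub>R b) b"
proof -
  let ?F = "\<lambda>x. fderiv f x a"
  define G where "G s = f (p + h *\<^sub>R b + s *\<^sub>R a) - f (p + s *\<^sub>R a)" for s
  have "(G has_real_derivative ?F (p + h *\<^sub>R b + s *\<^sub>R a) - ?F (p + s *\<^sub>R a)) (at s)"
    if s: "0 \<le> s" "s \<le> h" for s
    unfolding G_def has_real_derivative_iff_has_vector_derivative
    using S[of s h] S[of s 0] s h
    by (intro has_vector_derivative_diff has_vector_derivative_along_line[OF sm])
       (auto simp: add_ac)
  from MVT2[OF h this] obtain s where s: "0 < s" "s < h"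
    "G h - G 0 = (h - 0) * (?F (p + h *\<^sub>R b + s *\<^sub>R a) - ?F (p + s *\<^sub>R a))" by blast
  have "((\<lambda>t. ?F (p + s *\<^sub>R a + t *\<^sub>R b)) has_real_derivative fderiv ?F (p + s *\<^sub>R a + t *\<^sub>R b) b) (at t)"
    if t: "0 \<le> t" "t \<le> h" for t
    unfolding has_real_derivative_iff_has_vector_derivative
    using S[of s t] s t
    by (intro has_vector_derivative_along_line[OF smooth_on_frechet_derivative[OF sm]]) auto
  from MVT2[OF h this] obtain t where t: "0 < t" "t < h"
    "?F (p + s *\<^sub>R a + h *\<^sub>R b) - ?F (p + s *\<^sub>R a + 0 *\<^sub>R b) = (h - 0) * fderiv ?F (p + s *\<^sub>R a + t *\<^sub>R b) b" by blast
  have "f (p + h *\<^sub>R a + h *\<^sub>R b) - f (p + h *\<^sub>R a) - f (p + h *\<^sub>R b) + f p = G h - G 0"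
    by (simp add: G_def add_ac)
  also have "\<dots> = h * h * fderiv ?F (p + s *\<^sub>R a + t *\<^sub>R b) b"
    using s(3) t(3) by (simp add: add_ac)
  finally show ?thesis using s t by (intro bexI[of _ s] bexI[of _ t]) auto
qed

lemma smooth_on_frechet_derivative_linear_compose:
  assumes "open S" "smooth_on S f" "bounded_linear L" "x \<in> S"
  shows "fderiv (\<lambda>x. L (f x)) x v = L (fderiv f x v)"
  using frechet_derivative_at[OF bounded_linear.has_derivative[OF assms(3) smooth_on_has_derivative[OF assms(2,4)]]]
  by (metis (no_types, lifting))

lemma second_derivative_symmetric_real:
  fixes f :: "'a::real_normed_vector \<Rightarrow> real"
  assumes S: "open S" and sm: "smooth_on S f" and p: "p \<in> S"
  shows "fderiv (\<lambda>x. fderiv f x a) p b =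
         fderiv (\<lambda>x. fderiv f x b) p a" (is "?L p = ?R p")
proof (rule ccontr)
  assume "?L p \<noteq> ?R p"
  \<comment> \<open>Half the gap: no number is closer than this to both \<open>?L p\<close> and
    \<open>?R p\<close>, yet the mean value points found below produce such a number.\<close>
  define e where "e = \<bar>?L p - ?R p\<bar> / 2"
  have e: "e > 0" using \<open>?L p \<noteq> ?R p\<close> by (simp add: e_def)
  have "continuous (at p) ?L" "continuous (at p) ?R"
    using smooth_on_imp_continuous_on[OF smooth_on_frechet_derivative[OF smooth_on_frechet_derivative[OF sm]]]
    S p continuous_on_eq_continuous_at by blast+
  then obtain d1 d2 where d: "d1 > 0" "d2 > 0" "\<And>x. dist x p < d1 \<Longrightarrow> \<bar>?L x - ?L p\<bar> < e"
    "\<And>x. dist x p < d2 \<Longrightarrow> \<bar>?R x - ?R p\<bar> < e"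
    using e unfolding continuous_at_eps_delta dist_real_def by blast
  obtain r where r: "r > 0" "ball p r \<subseteq> S" using S p open_contains_ball by blast
  define c where "c = norm a + norm b + 1"
  define m where "m = min r (min d1 d2)"
  define h where "h = m / (2 * c)"
  have c: "c > 0" by (simp add: c_def add_nonneg_pos)
  have m: "m > 0" using r d by (simp add: m_def)
  have h: "h > 0" using c m by (simp add: h_def)
  have near: "dist (p + s *\<^sub>R a + t *\<^sub>R b) p < m" if "s \<in> {0..h}" "t \<in> {0..h}" for s t
  proof -
    have "dist (p + s *\<^sub>R a + t *\<^sub>R b) p = norm (s *\<^sub>R a + t *\<^sub>R b)" by (simp add: dist_norm add.assoc)
    also have "\<dots> \<le> s * norm a + t * norm b"
      using norm_triangle_ineq[of "s *\<^sub>R a" "t *\<^sub>R b"] that by simp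
    also have "\<dots> \<le> h * norm a + h * norm b"
      using that by (intro add_mono mult_right_mono) auto
    also have "\<dots> \<le> h * c" using h by (simp add: c_def algebra_simps)
    also have "\<dots> < m" using c m by (simp add: h_def)
    finally show ?thesis .
  qed
  have inS: "p + s *\<^sub>R a + t *\<^sub>R b \<in> S" if "s \<in> {0..h}" "t \<in> {0..h}" for s t
    using near[OF that] r by (auto simp: m_def dist_commute)
  have inS': "p + s *\<^sub>R b + t *\<^sub>R a \<in> S" if "s \<in> {0..h}" "t \<in> {0..h}" for s t
    using inS[OF that(2,1)] by (simp add: add_ac)
  obtain s t where st: "s \<in> {0..h}" "t \<in> {0..h}"
    "f (p + h *\<^sub>R a + h *\<^sub>R b) - f (p + h *\<^sub>R a) - f (p + h *\<^sub>R b) + f p = h * h * ?L (p + s *\<^sub>R a + t *\<^sub>R b)"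
    using mixed_difference_mvt[OF sm h inS] by blast
  obtain s' t' where st': "s' \<in> {0..h}" "t' \<in> {0..h}"
    "f (p + h *\<^sub>R b + h *\<^sub>R a) - f (p + h *\<^sub>R b) - f (p + h *\<^sub>R a) + f p = h * h * ?R (p + s' *\<^sub>R b + t' *\<^sub>R a)"
    using mixed_difference_mvt[OF sm h inS'] by blast
  have "h * h * ?L (p + s *\<^sub>R a + t *\<^sub>R b) = h * h * ?R (p + s' *\<^sub>R b + t' *\<^sub>R a)"
    unfolding st(3)[symmetric] st'(3)[symmetric] by (simp add: add_ac)
  then have "?L (p + s *\<^sub>R a + t *\<^sub>R b) = ?R (p + s' *\<^sub>R b + t' *\<^sub>R a)" using h by simp
  moreover have "\<bar>?L (p + s *\<^sub>R a + t *\<^sub>R b) - ?L p\<bar> < e"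
    using near[OF st(1,2)] by (intro d) (simp add: m_def)
  moreover have "\<bar>?R (p + s' *\<^sub>R b + t' *\<^sub>R a) - ?R p\<bar> < e"
    using near[OF st'(2,1)] by (intro d) (simp add: m_def add_ac)
  moreover have "\<bar>x - y\<bar> < \<bar>y - z\<bar> / 2 \<Longrightarrow> \<bar>x - z\<bar> < \<bar>y - z\<bar> / 2 \<Longrightarrow> False" for x y z :: real
    by (simp add: abs_real_def split: if_splits)
  ultimately show False unfolding e_def by metis
qed

lemma second_derivative_symmetric:
  fixes f :: "'a::real_normed_vector \<Rightarrow> 'b::euclidean_space"
  assumes S: "open S" and sm: "smooth_on S f" and p: "p \<in> S"
  shows "fderiv (\<lambda>x. fderiv f x a) p b =
         fderiv (\<lambda>x. fderiv f x b) p a"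
proof (rule euclidean_eqI)
  fix e :: 'b
  let ?g = "\<lambda>x. f x \<bullet> e"
  have g: "fderiv ?g x v = fderiv f x v \<bullet> e" if "x \<in> S" for x v
    by (rule smooth_on_frechet_derivative_linear_compose[OF S sm bounded_linear_inner_left that])
  have "fderiv (\<lambda>x. fderiv ?g x a) p b =
        fderiv (\<lambda>x. fderiv f x a) p b \<bullet> e" for a b
    using frechet_derivative_cong_open[OF S p, of "\<lambda>x. fderiv ?g x a" "\<lambda>x. fderiv f x a \<bullet> e"]
      g smooth_on_frechet_derivative_linear_compose[OF S smooth_on_frechet_derivative[OF sm] bounded_linear_inner_left p]
    by simp
  then show "fderiv (\<lambda>x. fderiv f x a) p b \<bullet> e =
         fderiv (\<lambda>x. fderiv f x b) p a \<bullet> e"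
    using second_derivative_symmetric_real[OF S smooth_on_linear_compose[OF bounded_linear_inner_left S sm] p]
    by metis
qed

lemma frechet_derivative_basis_sum:
  fixes f :: "'a::euclidean_space \<Rightarrow> 'b::real_normed_vector"
  assumes "f differentiable (at x)"
  shows "fderiv f x v = (\<Sum>b\<in>Basis. (v \<bullet> b) *\<^sub>R fderiv f x b)"
proof -
  have lin: "linear (fderiv f x)"
    using assms by (rule linear_frechet_derivative)
  have "fderiv f x v = fderiv f x (\<Sum>b\<in>Basis. (v \<bullet> b) *\<^sub>R b)"
    by (simp add: euclidean_representation)
  then show ?thesis by (simp add: linear_sum[OF lin] linear_scale[OF lin])
qed

lemma has_vector_derivative_chain:
  assumes "(g has_vector_derivative g') (at t)" "smooth_on S f" "g t \<in> S"
  shows "((\<lambda>s. f (g s)) has_vector_derivative fderiv f (g t) g') (at t)"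
  using vector_derivative_diff_chain_within[OF assms(1), of f "fderiv f (g t)"]
    smooth_on_has_derivative[OF assms(2,3)] by (simp add: o_def has_derivative_at_withinI)

text \<open>Base point and direction vary together. After expanding the direction in
  \<open>Basis\<close>, the product rule separates the second derivative of \<open>f\<close> from
  the derivative of \<open>J\<close>.\<close>

lemma has_vector_derivative_frechet_along_curve:
  fixes f :: "'a::euclidean_space \<Rightarrow> 'b::real_normed_vector"
  assumes S: "open S" and sm: "smooth_on S f" and t: "g t \<in> S"
    and g: "(g has_vector_derivative g') (at t)" and J: "(J has_vector_derivative J') (at t)"
  shows "((\<lambda>s. fderiv f (g s) (J s)) has_vector_derivative
     fderiv (\<lambda>x. fderiv f x (J t)) (g t) g' + fderiv f (g t) J') (at t)"
proof -
  let ?F = "\<lambda>b x. fderiv f x b"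
  have diff: "f differentiable (at x)" if "x \<in> S" for x
    using smooth_on_has_derivative[OF sm that] by (auto simp: differentiable_def)
  have F: "smooth_on S (?F b)" for b using sm by (rule smooth_on_frechet_derivative)
  have "((\<lambda>s. \<Sum>b\<in>Basis. (J s \<bullet> b) *\<^sub>R ?F b (g s)) has_vector_derivative
     (\<Sum>b\<in>Basis. (J t \<bullet> b) *\<^sub>R fderiv (?F b) (g t) g' + (J' \<bullet> b) *\<^sub>R ?F b (g t))) (at t)"
  proof (rule has_vector_derivative_sum)
    fix b :: 'a
    have "((\<lambda>s. J s \<bullet> b) has_real_derivative J' \<bullet> b) (at t)"
      using J bounded_linear.has_vector_derivative[OF bounded_linear_inner_left J]
      by (simp add: has_real_derivative_iff_has_vector_derivative)
    then show "((\<lambda>s. (J s \<bullet> b) *\<^sub>R ?F b (g s)) has_vector_derivative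
        (J t \<bullet> b) *\<^sub>R fderiv (?F b) (g t) g' + (J' \<bullet> b) *\<^sub>R ?F b (g t)) (at t)"
      by (rule has_vector_derivative_scaleR) (rule has_vector_derivative_chain[OF g F t])
  qed
  also have "(\<Sum>b\<in>Basis. (J t \<bullet> b) *\<^sub>R fderiv (?F b) (g t) g' + (J' \<bullet> b) *\<^sub>R ?F b (g t)) =
     (\<Sum>b\<in>Basis. (J t \<bullet> b) *\<^sub>R fderiv (?F b) (g t) g') + ?F J' (g t)"
    by (simp add: sum.distrib frechet_derivative_basis_sum[OF diff[OF t], of J'])
  also have "(\<Sum>b\<in>Basis. (J t \<bullet> b) *\<^sub>R fderiv (?F b) (g t) g') = fderiv (?F (J t)) (g t) g'"
  proof -
    have "((\<lambda>x. \<Sum>b\<in>Basis. (J t \<bullet> b) *\<^sub>R ?F b x) has_derivative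
       (\<lambda>v. \<Sum>b\<in>Basis. (J t \<bullet> b) *\<^sub>R fderiv (?F b) (g t) v)) (at (g t))"
      by (intro has_derivative_sum has_derivative_scaleR_right smooth_on_has_derivative[OF F t])
    then have "((\<lambda>x. ?F (J t) x) has_derivative
       (\<lambda>v. \<Sum>b\<in>Basis. (J t \<bullet> b) *\<^sub>R fderiv (?F b) (g t) v)) (at (g t))"
      by (rule has_derivative_transform_within_open[OF _ S t])
         (rule frechet_derivative_basis_sum[OF diff, symmetric])
    from fun_cong[OF frechet_derivative_at[OF this], of g'] show ?thesis .
  qed
  finally have D: "((\<lambda>s. \<Sum>b\<in>Basis. (J s \<bullet> b) *\<^sub>R ?F b (g s)) has_vector_derivative
     fderiv (?F (J t)) (g t) g' + ?F J' (g t)) (at t)" .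
  have "isCont g t" using g by (rule has_vector_derivative_continuous)
  then have "\<forall>\<^sub>F s in at t. g s \<in> S"
    using S t by (metis isCont_def tendsto_def)
  then have ev: "\<forall>\<^sub>F s in at t. (\<Sum>b\<in>Basis. (J s \<bullet> b) *\<^sub>R ?F b (g s)) = ?F (J s) (g s)"
    by eventually_elim (rule frechet_derivative_basis_sum[OF diff, symmetric])
  show ?thesis
    using D unfolding has_vector_derivative_def
    by (rule has_derivative_transform_eventually[OF _ ev])
       (simp_all add: frechet_derivative_basis_sum[OF diff[OF t], of "J t"])
qed


section \<open>Diffeomorphisms\<close>

lemma diffeo_inverse:
  assumes "diffeo A B g"
  shows "diffeo B A (the_inv_into A g)"
proof -
  have inj: "inj_on g A" "g ` A = B" using assms by (auto simp: diffeo_def bij_betw_def)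
  have "smooth_on A (the_inv_into B (the_inv_into A g))"
    by (rule smooth_on_cong[of A g])
       (use assms inj in \<open>auto simp: diffeo_def the_inv_into_f_f intro!: the_inv_into_f_eq[symmetric] bij_betw_imp_inj_on bij_betw_the_inv_into\<close>)
  then show ?thesis using assms bij_betw_the_inv_into by (auto simp: diffeo_def)
qed

lemma diffeo_image: "diffeo A B g \<Longrightarrow> B = g ` A"
  by (auto simp: diffeo_def bij_betw_def)

lemma diffeo_inv_eq: "diffeo A B g \<Longrightarrow> x \<in> A \<Longrightarrow> the_inv_into A g (g x) = x"
  by (auto simp: diffeo_def bij_betw_def the_inv_into_f_f)

lemma diffeo_eq_inv: "diffeo A B g \<Longrightarrow> y \<in> B \<Longrightarrow> g (the_inv_into A g y) = y"
  by (auto simp: diffeo_def bij_betw_def f_the_inv_into_f)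

lemma diffeo_inv_in: "diffeo A B g \<Longrightarrow> y \<in> B \<Longrightarrow> the_inv_into A g y \<in> A"
  by (auto simp: diffeo_def bij_betw_def the_inv_into_into)

lemma diffeo_derivative_inverse:
  assumes "diffeo A B g" "x \<in> A"
  shows "fderiv (the_inv_into A g) (g x) (fderiv g x v) = v"
proof -
  let ?k = "the_inv_into A g"
  have k: "smooth_on A g" "smooth_on B ?k" "open A" "g x \<in> B"
    using assms by (auto simp: diffeo_def bij_betw_def)
  have "((\<lambda>y. ?k (g y)) has_derivative fderiv ?k (g x) \<circ> fderiv g x) (at x)"
    using diff_chain_at[OF smooth_on_has_derivative[OF k(1) assms(2)] smooth_on_has_derivative[OF k(2,4)]]
    by (simp add: o_def)
  then have "((\<lambda>y. y) has_derivative fderiv ?k (g x) \<circ> fderiv g x) (at x)"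
    by (rule has_derivative_transform_within_open[OF _ k(3) assms(2)]) (rule diffeo_inv_eq[OF assms(1)])
  from has_derivative_unique[OF this has_derivative_ident] show ?thesis by (metis comp_apply)
qed

lemma diffeo_deriv_nonzero:
  assumes "diffeo I B (l :: real \<Rightarrow> real)" "t \<in> I"
  shows "deriv l t \<noteq> 0"
proof
  assume *: "deriv l t = 0"
  have "l differentiable (at t)"
    using assms smooth_on_has_derivative[of I l t] by (auto simp: diffeo_def differentiable_def)
  from frechet_derivative_eq_deriv[OF this] have "fderiv l t 1 = 0"
    using * by simp
  with diffeo_derivative_inverse[OF assms, of 1] diffeo_derivative_inverse[OF assms, of 0]
  show False using linear_0[OF linear_frechet_derivative[OF \<open>l differentiable (at t)\<close>]] by simp
qed

lemma open_interval_inter: "open_interval I \<Longrightarrow> open_interval J \<Longrightarrow> open_interval (I \<inter> J)"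
  by (simp add: open_interval_def open_Int is_interval_Int)

text \<open>On an interval a derivative without zeros excludes equal values, by the mean value
  theorem. The inverse g satisfies g' = 1 / (l' o g), so each order of differentiability of g yields
  the next.\<close>

lemma diffeo_intervalI:
  fixes l :: "real \<Rightarrow> real"
  assumes I: "open_interval I" and l: "smooth_on I l" and nz: "\<And>t. t \<in> I \<Longrightarrow> deriv l t \<noteq> 0"
  shows "diffeo I (l ` I) l"
proof -
  let ?g = "the_inv_into I l"
  have oI: "open I" and iI: "is_interval I" using I by (auto simp: open_interval_def)
  have False if "a \<in> I" "b \<in> I" "a < b" "l a = l b" for a b
  proof -
    have "x \<in> I" if "a \<le> x" "x \<le> b" for x
      using iI \<open>a \<in> I\<close> \<open>b \<in> I\<close> that mem_is_interval_1_I by blast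
    then obtain z where "a < z" "z < b" "l b - l a = (b - a) * deriv l z"
      using MVT2[OF \<open>a < b\<close>, of l "deriv l"] smooth_on_DERIV[OF l] by blast
    with that nz[of z] \<open>\<And>x. a \<le> x \<Longrightarrow> x \<le> b \<Longrightarrow> x \<in> I\<close> show False by auto
  qed
  then have inj: "inj_on l I" unfolding inj_on_def by (metis linorder_neqE_linordered_idom)
  have cont: "continuous_on I l" using l by (rule smooth_on_imp_continuous_on)
  have olI: "open (l ` I)" by (rule invariance_of_domain[OF cont oI inj])
  have gI: "?g s \<in> I" "l (?g s) = s" if "s \<in> l ` I" for s
    using that inj by (auto simp: the_inv_into_f_f)
  have der: "(?g has_real_derivative inverse (deriv l (?g s))) (at s)" if "s \<in> l ` I" for s
  proof -
    have "(?g has_derivative (\<lambda>v. inverse (deriv l (?g s)) * v)) (at (l (?g s)))"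
      by (rule has_derivative_inverse_strong[OF oI gI(1)[OF that] cont, where f' = "\<lambda>v. deriv l (?g s) * v"])
         (use that inj nz gI smooth_on_DERIV[OF l] in \<open>auto simp: the_inv_into_f_f has_field_derivative_def fun_eq_iff\<close>)
    then show ?thesis using gI[OF that] by (simp add: has_field_derivative_def)
  qed
  have "Ck_on k (l ` I) ?g" for k
  proof (induction k)
    case 0
    show ?case by (auto intro!: continuous_at_imp_continuous_on DERIV_isCont[OF der])
  next
    case (Suc k)
    have "Ck_on k (l ` I) (\<lambda>s. inverse (deriv l (?g s)))"
      using smooth_on_inverse[OF oI nz smooth_on_deriv[OF oI l]] Ck_on_compose[OF olI _ Suc, of I] gI
      by (force simp: smooth_on_def)
    then show ?case
      by (intro Ck_on_SucI[where D = "\<lambda>s v. inverse (deriv l (?g s)) * v"])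
         (use olI der in \<open>auto simp: has_field_derivative_def intro!: Ck_on_const Ck_on_bilinear[OF _ bounded_bilinear_mult]\<close>)
  qed
  then show ?thesis using oI olI inj l by (auto simp: diffeo_def bij_betw_def smooth_on_def)
qed

lemma open_interval_image:
  fixes l :: "real \<Rightarrow> real"
  assumes "open_interval I" "diffeo I J l"
  shows "open_interval J"
proof -
  have "connected I" using assms by (simp add: open_interval_def is_interval_connected_1)
  then have "connected (l ` I)"
    using connected_continuous_image smooth_on_imp_continuous_on assms by (auto simp: diffeo_def)
  then show ?thesis using assms diffeo_image[OF assms(2)]
    by (auto simp: open_interval_def is_interval_connected_1 diffeo_def)
qed

lemma diffeo_restrict:
  fixes l :: "real \<Rightarrow> real"
  assumes "diffeo I J l" "open_interval I'" "I' \<subseteq> I"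
  shows "diffeo I' (l ` I') l"
  using assms diffeo_deriv_nonzero[OF assms(1)]
  by (intro diffeo_intervalI) (auto simp: diffeo_def intro: smooth_on_subset)

section \<open>Integral curves of smooth vector fields\<close>

text \<open>Bounds for the derivatives in the finitely many basis directions on a compact ball add
  up to a bound for the operator norm.\<close>

lemma smooth_on_lipschitz_cball:
  fixes F :: "'a::euclidean_space \<Rightarrow> 'b::real_normed_vector"
  assumes "smooth_on S F" "cball p r \<subseteq> S"
  shows "\<exists>L\<ge>0. \<forall>x\<in>cball p r. \<forall>y\<in>cball p r. norm (F x - F y) \<le> L * norm (x - y)"
proof -
  let ?D = "\<lambda>x. fderiv F x"
  have "\<exists>M. \<forall>x\<in>cball p r. norm (?D x b) \<le> M" for b
  proof -
    have "continuous_on (cball p r) (\<lambda>x. ?D x b)"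
      using smooth_on_imp_continuous_on[OF smooth_on_frechet_derivative[OF assms(1)]] assms(2)
      by (rule continuous_on_subset)
    then have "bounded ((\<lambda>x. ?D x b) ` cball p r)"
      using compact_continuous_image compact_cball compact_imp_bounded by blast
    then show ?thesis by (auto simp: bounded_iff)
  qed
  then obtain M where M: "\<And>b x. x \<in> cball p r \<Longrightarrow> norm (?D x b) \<le> M b" by metis
  define L where "L = (\<Sum>b\<in>Basis. \<bar>M (b::'a)\<bar>)"
  have "onorm (?D x) \<le> L" if x: "x \<in> cball p r" for x
  proof (rule onorm_le)
    fix v :: 'a
    have "F differentiable (at x)"
      using smooth_on_has_derivative[OF assms(1)] x assms(2) unfolding differentiable_def by blast
    from frechet_derivative_basis_sum[OF this]
    have "norm (?D x v) = norm (\<Sum>b\<in>Basis. (v \<bullet> b) *\<^sub>R ?D x b)" by metis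
    also have "\<dots> \<le> (\<Sum>b\<in>Basis. norm v * \<bar>M b\<bar>)"
    proof (rule sum_norm_le)
      fix b :: 'a assume b: "b \<in> Basis"
      have "\<bar>v \<bullet> b\<bar> * norm (?D x b) \<le> norm v * \<bar>M b\<bar>"
        by (intro mult_mono Basis_le_norm b order_trans[OF M[OF x]]) auto
      then show "norm ((v \<bullet> b) *\<^sub>R ?D x b) \<le> norm v * \<bar>M b\<bar>" by simp
    qed
    also have "\<dots> = L * norm v" by (simp add: L_def sum_distrib_left mult.commute)
    finally show "norm (?D x v) \<le> L * norm v" .
  qed
  moreover have "(F has_derivative ?D x) (at x within cball p r)" if "x \<in> cball p r" for x
    using smooth_on_has_derivative[OF assms(1), of x] assms(2) that
    by (blast intro: has_derivative_at_withinI)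
  ultimately have "\<forall>x\<in>cball p r. \<forall>y\<in>cball p r. norm (F x - F y) \<le> L * norm (x - y)"
    by (intro ballI differentiable_bound[of "cball p r" F ?D L]) auto
  moreover have "L \<ge> 0" by (simp add: L_def sum_nonneg)
  ultimately show ?thesis by blast
qed

text \<open>Banach's theorem for the Picard operator. Its Lipschitz constant is at most
  \<open>4 * e * L\<close>: two integrals, each over a length of at most \<open>2 * e\<close>, are
  estimated.\<close>

lemma picard_fixed_point:
  fixes G :: "'a::euclidean_space \<Rightarrow> 'a"
  assumes lip: "\<And>x y. norm (G x - G y) \<le> L * norm (x - y)"
    and L: "L \<ge> 0" and e: "e > 0" "4 * e * L \<le> 1 / 2"
  shows "\<exists>u. continuous_on UNIV u \<and>
    (\<forall>t\<in>{t0-e..t0+e}. u t = u0 + (integral {t0-e..t} (\<lambda>s. G (u s)) - integral {t0-e..t0} (\<lambda>s. G (u s))))"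
proof -
  let ?a = "t0 - e" and ?b = "t0 + e"
  have contG: "continuous_on UNIV G"
    by (rule lipschitz_on_continuous_on[of L]) (use lip L in \<open>auto simp: lipschitz_on_def dist_norm\<close>)
  \<comment> \<open>An integral over a reversed interval is 0, so the signed integral from
    \<open>t0\<close> to \<open>t\<close> is written as a difference of two integrals from the left
    end.\<close>
  define P where "P u t = u0 + (integral {?a..t} (\<lambda>s. G (u s)) - integral {?a..t0} (\<lambda>s. G (u s)))"
    for u :: "real \<Rightarrow>\<^sub>C 'a" and t
  \<comment> \<open>Clamping the argument to the interval turns \<open>P u\<close> into a bounded
    continuous function on the whole line, a point of a complete space.\<close>
  define cl where "cl t = max ?a (min ?b t)" for t
  have cl: "cl t \<in> {?a..?b}" for t using e by (auto simp: cl_def)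
  have contGu: "continuous_on T (\<lambda>s. G (apply_bcontfun u s))" for T u
    by (rule continuous_on_compose2[OF contG]) auto
  have contP: "continuous_on {?a..?b} (P u)" for u
    unfolding P_def
    by (intro continuous_intros indefinite_integral_continuous_1 integrable_continuous_real contGu)
  have "(\<lambda>t. P u (cl t)) \<in> bcontfun" for u
  proof -
    have "continuous_on UNIV (\<lambda>t. P u (cl t))"
      by (rule continuous_on_compose2[OF contP]) (use cl in \<open>auto simp: cl_def intro!: continuous_intros\<close>)
    moreover have "bounded (range (\<lambda>t. P u (cl t)))"
      by (rule bounded_subset[OF compact_imp_bounded[OF compact_continuous_image[OF contP[of u] compact_Icc]]])
         (use cl in blast)
    ultimately show ?thesis by (simp add: bcontfun_def)
  qed
  then have app: "apply_bcontfun (Bcontfun (\<lambda>t. P u (cl t))) t = P u (cl t)" for u t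
    by (simp add: Bcontfun_inverse)
  have int: "norm (integral {?a..t} (\<lambda>s. G (u s)) - integral {?a..t} (\<lambda>s. G (v s))) \<le> 2 * e * L * dist u v"
    if t: "t \<in> {?a..?b}" for t and u v :: "real \<Rightarrow>\<^sub>C 'a"
  proof -
    have "norm (integral {?a..t} (\<lambda>s. G (u s) - G (v s))) \<le> (L * dist u v) * (t - ?a)"
    proof (rule integral_bound)
      fix s
      have "norm (G (u s) - G (v s)) \<le> L * dist (u s) (v s)" using lip by (simp add: dist_norm)
      also have "\<dots> \<le> L * dist u v" by (intro mult_left_mono dist_bounded L)
      finally show "norm (G (u s) - G (v s)) \<le> L * dist u v" .
    qed (use t in \<open>auto intro!: continuous_intros contGu\<close>)
    also have "\<dots> \<le> (L * dist u v) * (2 * e)" using t L by (intro mult_left_mono) auto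
    finally show ?thesis
      by (subst integral_diff[symmetric]) (auto intro!: integrable_continuous_real contGu simp: mult_ac)
  qed
  have "\<exists>!u. Bcontfun (\<lambda>t. P u (cl t)) = u"
  proof (rule banach_fix_type[of "1/2"])
    show "\<forall>u v. dist (Bcontfun (\<lambda>t. P u (cl t))) (Bcontfun (\<lambda>t. P v (cl t))) \<le> 1 / 2 * dist u v"
    proof (intro allI dist_bound)
      fix u v :: "real \<Rightarrow>\<^sub>C 'a" and t
      let ?d = "\<lambda>t. integral {?a..t} (\<lambda>s. G (u s)) - integral {?a..t} (\<lambda>s. G (v s))"
      have "dist (P u (cl t)) (P v (cl t)) = norm (?d (cl t) - ?d t0)"
        by (simp add: P_def dist_norm algebra_simps)
      also have "\<dots> \<le> norm (?d (cl t)) + norm (?d t0)" by (rule norm_triangle_ineq4)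
      also have "\<dots> \<le> 2 * e * L * dist u v + 2 * e * L * dist u v"
        using cl e by (intro add_mono int) auto
      also have "\<dots> = (4 * e * L) * dist u v" by simp
      also have "\<dots> \<le> 1 / 2 * dist u v" by (intro mult_right_mono e) auto
      finally show "dist (apply_bcontfun (Bcontfun (\<lambda>t. P u (cl t))) t) (apply_bcontfun (Bcontfun (\<lambda>t. P v (cl t))) t) \<le> 1 / 2 * dist u v"
        by (simp add: app)
    qed
  qed auto
  then obtain u where u: "Bcontfun (\<lambda>t. P u (cl t)) = u" by blast
  have "apply_bcontfun u t = P u t" if "t \<in> {?a..?b}" for t
    using app[of u t] that unfolding u by (simp add: cl_def)
  then show ?thesis
    by (intro exI[of _ "apply_bcontfun u"]) (auto simp: P_def)
qed

text \<open>Outside a ball around \<open>p\<close> the vector field is cut off by composing it with the closest point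
  projection, which makes it bounded and globally Lipschitz.\<close>

theorem integral_curve_exists:
  fixes F :: "'a::euclidean_space \<Rightarrow> 'a"
  assumes "open S" "smooth_on S F" "p \<in> S"
  shows "\<exists>e>0. \<exists>u. u t0 = p \<and>
    (\<forall>t\<in>{t0-e<..<t0+e}. u t \<in> S \<and> (u has_vector_derivative F (u t)) (at t))"
proof -
  obtain r where r: "r > 0" "cball p r \<subseteq> S" using assms open_contains_cball by blast
  obtain L where L: "L \<ge> 0" "\<forall>x\<in>cball p r. \<forall>y\<in>cball p r. norm (F x - F y) \<le> L * norm (x - y)"
    using smooth_on_lipschitz_cball[OF assms(2) r(2)] by blast
  define G where "G x = F (closest_point (cball p r) x)" for x
  have cp: "closest_point (cball p r) x \<in> cball p r" for x
    using r by (intro closest_point_in_set) auto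
  have lip: "norm (G x - G y) \<le> L * norm (x - y)" for x y
  proof -
    have "norm (G x - G y) \<le> L * norm (closest_point (cball p r) x - closest_point (cball p r) y)"
      using L cp by (auto simp: G_def)
    also have "\<dots> \<le> L * norm (x - y)"
      using closest_point_lipschitz[of "cball p r" x y] r L
      by (intro mult_left_mono) (auto simp: dist_norm)
    finally show ?thesis .
  qed
  have "continuous_on (cball p r) F"
    using smooth_on_imp_continuous_on[OF assms(2)] r(2) by (rule continuous_on_subset)
  then have "bounded (F ` cball p r)"
    using compact_continuous_image compact_cball compact_imp_bounded by blast
  then obtain M where M: "M > 0" "\<And>x. norm (G x) \<le> M"
    using cp unfolding bounded_pos G_def by (metis imageI)
  \<comment> \<open>The first bound makes the Picard operator a contraction; the second keeps the
    curve within \<open>4 * e * M \<le> r\<close> of \<open>p\<close>, where \<open>G\<close> and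
    \<open>F\<close> agree.\<close>
  define e where "e = min (1 / (8 * (L + 1))) (r / (4 * M))"
  have e: "e > 0" using L M r by (simp add: e_def)
  have "4 * e * L \<le> 4 * (1 / (8 * (L + 1))) * L" using L by (intro mult_right_mono) (auto simp: e_def)
  also have "\<dots> \<le> 1 / 2" using L by (simp add: field_simps)
  finally have e1: "4 * e * L \<le> 1 / 2" .
  have "4 * e * M \<le> 4 * (r / (4 * M)) * M" using M by (intro mult_right_mono) (auto simp: e_def)
  then have e2: "4 * e * M \<le> r" using M by simp
  obtain u where u: "continuous_on UNIV u" "\<And>t. t \<in> {t0-e..t0+e} \<Longrightarrow>
      u t = p + (integral {t0-e..t} (\<lambda>s. G (u s)) - integral {t0-e..t0} (\<lambda>s. G (u s)))"
    using picard_fixed_point[OF lip L(1) e e1, of t0 p] by blast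
  have contG: "continuous_on UNIV G"
    by (rule lipschitz_on_continuous_on[of L]) (use lip L in \<open>auto simp: lipschitz_on_def dist_norm\<close>)
  have contGu: "continuous_on T (\<lambda>s. G (u s))" for T
    by (rule continuous_on_compose2[OF contG]) (use u(1) continuous_on_subset in auto)
  have int: "norm (integral {t0-e..t} (\<lambda>s. G (u s))) \<le> M * (2 * e)" if "t \<in> {t0-e..t0+e}" for t
  proof -
    have "norm (integral {t0-e..t} (\<lambda>s. G (u s))) \<le> M * (t - (t0 - e))"
      using that by (intro integral_bound contGu M) auto
    also have "\<dots> \<le> M * (2 * e)" using that M by (intro mult_left_mono) auto
    finally show ?thesis .
  qed
  have ball: "u t \<in> cball p r" if "t \<in> {t0-e..t0+e}" for t
  proof -
    have "dist p (u t) = norm (integral {t0-e..t} (\<lambda>s. G (u s)) - integral {t0-e..t0} (\<lambda>s. G (u s)))"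
      using u(2)[OF that] by (metis add_diff_cancel_left' dist_commute dist_norm)
    also have "\<dots> \<le> M * (2 * e) + M * (2 * e)"
      using that e by (intro order_trans[OF norm_triangle_ineq4] add_mono int) auto
    also have "\<dots> \<le> r" using e2 by (simp add: mult_ac)
    finally show ?thesis by simp
  qed
  have "(u has_vector_derivative F (u t)) (at t)" if t: "t \<in> {t0-e<..<t0+e}" for t
  proof -
    have "((\<lambda>t. integral {t0-e..t} (\<lambda>s. G (u s))) has_vector_derivative G (u t)) (at t within {t0-e..t0+e})"
      using t by (intro integral_has_vector_derivative contGu) auto
    then have "((\<lambda>t. integral {t0-e..t} (\<lambda>s. G (u s))) has_vector_derivative G (u t)) (at t)"
      using t at_within_interior[of t "{t0-e..t0+e}"] by simp
    then have "((\<lambda>t. p + (integral {t0-e..t} (\<lambda>s. G (u s)) - integral {t0-e..t0} (\<lambda>s. G (u s)))) has_vector_derivative G (u t)) (at t)"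
      by (auto intro!: derivative_eq_intros)
    then have "(u has_vector_derivative G (u t)) (at t)"
      by (rule has_vector_derivative_transform_within_open[where S = "{t0-e<..<t0+e}"])
         (use t u(2) in auto)
    moreover have "G (u t) = F (u t)"
      using ball[of t] t by (simp add: G_def closest_point_self)
    ultimately show ?thesis by simp
  qed
  moreover have "u t0 = p" using u(2)[of t0] e by simp
  ultimately show ?thesis
    using e ball r(2) by (intro exI[of _ e] conjI exI[of _ u]) auto
qed

text \<open>Gronwall's argument for w = |u - v|^2. Since |w'| \<le> 2 L w, the function exp(-2 L t)
  w is nonincreasing to the right of \<open>t0\<close> and exp(2 L t) w is nondecreasing to the
  left, whence w \<le> 0.\<close>

lemma integral_curve_unique_local:
  fixes F :: "'a::euclidean_space \<Rightarrow> 'a"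
  assumes "open S" "smooth_on S F" and I: "open I" "t0 \<in> I"
    and u: "\<And>t. t \<in> I \<Longrightarrow> u t \<in> S \<and> (u has_vector_derivative F (u t)) (at t)"
    and v: "\<And>t. t \<in> I \<Longrightarrow> v t \<in> S \<and> (v has_vector_derivative F (v t)) (at t)"
    and eq: "u t0 = v t0"
  shows "\<exists>e>0. \<forall>t\<in>{t0-e<..<t0+e}. t \<in> I \<and> u t = v t"
proof -
  obtain r where r: "r > 0" "cball (u t0) r \<subseteq> S" using assms(1) u[OF I(2)] open_contains_cball by blast
  obtain L where L: "L \<ge> 0"
    "\<forall>x\<in>cball (u t0) r. \<forall>y\<in>cball (u t0) r. norm (F x - F y) \<le> L * norm (x - y)"
    using smooth_on_lipschitz_cball[OF assms(2) r(2)] by blast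
  have "isCont u t0" "isCont v t0" using u v I(2) has_vector_derivative_continuous by blast+
  then obtain d1 d2 where d: "d1 > 0" "d2 > 0" "\<And>t. dist t t0 < d1 \<Longrightarrow> dist (u t) (u t0) < r"
    "\<And>t. dist t t0 < d2 \<Longrightarrow> dist (v t) (v t0) < r"
    using r(1) unfolding continuous_at_eps_delta by metis
  obtain d3 where d3: "d3 > 0" "ball t0 d3 \<subseteq> I" using I open_contains_ball by blast
  define e where "e = min d3 (min d1 d2)"
  have e: "e > 0" using d d3 by (simp add: e_def)
  have near: "t \<in> I" "u t \<in> cball (u t0) r" "v t \<in> cball (u t0) r" if "t \<in> {t0-e<..<t0+e}" for t
  proof -
    have "dist t t0 < e" using that by (auto simp: dist_real_def abs_if)
    then show "t \<in> I" "u t \<in> cball (u t0) r" "v t \<in> cball (u t0) r"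
      using d(3)[of t] d(4)[of t] d3 eq by (auto simp: e_def dist_commute)
  qed
  define w where "w t = (u t - v t) \<bullet> (u t - v t)" for t
  define w' where "w' t = 2 * ((u t - v t) \<bullet> (F (u t) - F (v t)))" for t
  have w: "(w has_real_derivative w' t) (at t)" if "t \<in> {t0-e<..<t0+e}" for t
  proof -
    have "((\<lambda>t. u t - v t) has_vector_derivative F (u t) - F (v t)) (at t)"
      using u v near(1)[OF that] by (intro has_vector_derivative_diff) auto
    from bounded_bilinear.has_vector_derivative[OF bounded_bilinear_inner this this]
    show ?thesis unfolding w_def w'_def has_real_derivative_iff_has_vector_derivative
      by (simp add: inner_commute)
  qed
  have bound: "\<bar>w' t\<bar> \<le> 2 * L * w t" if "t \<in> {t0-e<..<t0+e}" for t
  proof -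
    have "\<bar>w' t\<bar> \<le> 2 * (norm (u t - v t) * norm (F (u t) - F (v t)))"
      unfolding w'_def using Cauchy_Schwarz_ineq2[of "u t - v t" "F (u t) - F (v t)"] by simp
    also have "\<dots> \<le> 2 * (norm (u t - v t) * (L * norm (u t - v t)))"
      using L near(2,3)[OF that] by (intro mult_left_mono) auto
    also have "\<dots> = 2 * L * w t"
      by (simp add: w_def power2_eq_square flip: power2_norm_eq_inner)
    finally show ?thesis .
  qed
  have expw: "((\<lambda>t. exp (c * t) * w t) has_real_derivative exp (c * t) * (w' t + c * w t)) (at t)"
    if "t \<in> {t0-e<..<t0+e}" for c t
    by (rule derivative_eq_intros w[OF that] refl)+ (simp add: algebra_simps)
  have w0: "w t0 = 0" using eq by (simp add: w_def)
  have "w t \<le> 0" if t: "t \<in> {t0-e<..<t0+e}" for t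
  proof (cases "t0 \<le> t")
    case True
    have "exp (- 2 * L * t) * w t \<le> exp (- 2 * L * t0) * w t0"
    proof (rule DERIV_nonpos_imp_nonincreasing[OF True])
      fix x assume "t0 \<le> x" "x \<le> t"
      then have x: "x \<in> {t0-e<..<t0+e}" using t e by auto
      show "\<exists>y. ((\<lambda>t. exp (- 2 * L * t) * w t) has_real_derivative y) (at x) \<and> y \<le> 0"
        using expw[OF x, of "- 2 * L"] bound[OF x]
        by (intro exI conjI) (assumption, auto simp: mult_le_0_iff)
    qed
    then show ?thesis using w0 by (simp add: mult_le_0_iff)
  next
    case False
    have "exp (2 * L * t) * w t \<le> exp (2 * L * t0) * w t0"
    proof (rule DERIV_nonneg_imp_nondecreasing[where f = "\<lambda>t. exp (2 * L * t) * w t"])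
      show "t \<le> t0" using False by simp
      fix x assume "t \<le> x" "x \<le> t0"
      then have x: "x \<in> {t0-e<..<t0+e}" using t e by auto
      show "\<exists>y. ((\<lambda>t. exp (2 * L * t) * w t) has_real_derivative y) (at x) \<and> 0 \<le> y"
        using expw[OF x, of "2 * L"] bound[OF x]
        by (intro exI conjI) (assumption, auto)
    qed
    then show ?thesis using w0 by (simp add: mult_le_0_iff)
  qed
  then have "u t = v t" if "t \<in> {t0-e<..<t0+e}" for t
    using that inner_ge_zero[of "u t - v t"] by (metis w_def antisym inner_eq_zero_iff right_minus_eq)
  then show ?thesis using e near(1) by blast
qed

section \<open>Transformations of linear equations\<close>

text \<open>The \<open>i\<close>-th derivative of \<open>\<kappa> (z \<circ> l)\<close> is the combination of the functions \<open>z^(j) \<circ> l\<close> with the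
  coefficients \<open>pull_coeff \<kappa> l i j\<close>.\<close>

primrec pull_coeff :: "(real \<Rightarrow> real) \<Rightarrow> (real \<Rightarrow> real) \<Rightarrow> nat \<Rightarrow> nat \<Rightarrow> real \<Rightarrow> real" where
  "pull_coeff \<kappa> l 0 j = (\<lambda>t. if j = 0 then \<kappa> t else 0)"
| "pull_coeff \<kappa> l (Suc i) j =
     (\<lambda>t. deriv (pull_coeff \<kappa> l i j) t + (if j = 0 then 0 else deriv l t * pull_coeff \<kappa> l i (j - 1) t))"

lemma pull_coeff_eq_0: "i < j \<Longrightarrow> pull_coeff \<kappa> l i j = (\<lambda>t. 0)"
  by (induction i arbitrary: j) auto

lemma pull_coeff_diag: "pull_coeff \<kappa> l i i t = \<kappa> t * deriv l t ^ i"
  by (induction i arbitrary: t) (auto simp: pull_coeff_eq_0)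

lemma smooth_on_pull_coeff:
  assumes "open I" "smooth_on I \<kappa>" "smooth_on I l"
  shows "smooth_on I (pull_coeff \<kappa> l i j)"
proof (induction i arbitrary: j)
  case 0
  then show ?case using assms by (cases "j = 0") (auto intro: smooth_on_const)
next
  case (Suc i)
  then show ?case using assms
    by (cases "j = 0") (auto intro!: smooth_on_add smooth_on_mult smooth_on_deriv)
qed

lemma funpow_deriv_pullback:
  assumes I: "open I" "smooth_on I \<kappa>" "smooth_on I l" and J: "open J" "smooth_on J z" "l ` I \<subseteq> J"
  shows "t \<in> I \<Longrightarrow> (deriv ^^ i) (\<lambda>t. \<kappa> t * z (l t)) t = (\<Sum>j\<le>i. pull_coeff \<kappa> l i j t * (deriv ^^ j) z (l t))"
proof (induction i arbitrary: t)
  case (Suc i)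
  let ?c = "pull_coeff \<kappa> l"
  have trm: "((\<lambda>t. ?c i j t * (deriv ^^ j) z (l t)) has_real_derivative
     deriv (?c i j) t * (deriv ^^ j) z (l t) + ?c i j t * (deriv l t * (deriv ^^ Suc j) z (l t))) (at t)" for j
  proof -
    have "((\<lambda>t. (deriv ^^ j) z (l t)) has_real_derivative (deriv ^^ Suc j) z (l t) * deriv l t) (at t)"
      by (rule DERIV_chain2[OF smooth_on_DERIV_funpow[OF J(1,2)] smooth_on_DERIV[OF I(3) Suc.prems]])
         (use J Suc.prems in auto)
    from DERIV_mult[OF smooth_on_DERIV[OF smooth_on_pull_coeff[OF I] Suc.prems] this]
    show ?thesis by (simp add: mult_ac add_ac)
  qed
  have "(deriv ^^ Suc i) (\<lambda>t. \<kappa> t * z (l t)) t = deriv (\<lambda>t. \<Sum>j\<le>i. ?c i j t * (deriv ^^ j) z (l t)) t"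
    using deriv_cong_open[OF I(1) Suc.prems Suc.IH] by simp
  also have "\<dots> = (\<Sum>j\<le>i. deriv (?c i j) t * (deriv ^^ j) z (l t) + ?c i j t * (deriv l t * (deriv ^^ Suc j) z (l t)))"
    by (intro DERIV_imp_deriv DERIV_sum trm)
  also have "\<dots> = (\<Sum>j\<le>Suc i. deriv (?c i j) t * (deriv ^^ j) z (l t)) +
      (\<Sum>j\<le>i. deriv l t * ?c i j t * (deriv ^^ Suc j) z (l t))"
    by (simp add: sum.distrib pull_coeff_eq_0 mult_ac)
  also have "(\<Sum>j\<le>i. deriv l t * ?c i j t * (deriv ^^ Suc j) z (l t)) =
      (\<Sum>j\<le>Suc i. (if j = 0 then 0 else deriv l t * ?c i (j - 1) t) * (deriv ^^ j) z (l t))"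
    by (subst sum.atMost_Suc_shift) simp
  finally show ?case by (simp add: algebra_simps sum.distrib)
qed simp

text \<open>The coefficients of the linear operator \<open>z \<mapsto> linear_lhs n p (\<kappa> (z \<circ> l))\<close>.\<close>

definition pull_lin :: "nat \<Rightarrow> (nat \<Rightarrow> real \<Rightarrow> real) \<Rightarrow> (real \<Rightarrow> real) \<Rightarrow> (real \<Rightarrow> real) \<Rightarrow> nat \<Rightarrow> real \<Rightarrow> real" where
  "pull_lin n p \<kappa> l j t = pull_coeff \<kappa> l (n + 1) j t + (\<Sum>i\<le>n. p i t * pull_coeff \<kappa> l i j t)"

lemma pull_lin_top: "pull_lin n p \<kappa> l (n + 1) t = \<kappa> t * deriv l t ^ (n + 1)"
  unfolding pull_lin_def pull_coeff_diag by (simp add: pull_coeff_eq_0)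

lemma linear_lhs_pullback:
  assumes I: "open I" "smooth_on I \<kappa>" "smooth_on I l" and J: "open J" "smooth_on J z" "l ` I \<subseteq> J"
    and t: "t \<in> I"
  shows "linear_lhs n p (\<lambda>t. \<kappa> t * z (l t)) t = (\<Sum>j\<le>n + 1. pull_lin n p \<kappa> l j t * (deriv ^^ j) z (l t))"
proof -
  have ext: "(\<Sum>j\<le>i. pull_coeff \<kappa> l i j t * (deriv ^^ j) z (l t)) =
      (\<Sum>j\<le>n + 1. pull_coeff \<kappa> l i j t * (deriv ^^ j) z (l t))" if "i \<le> n + 1" for i
    using that by (intro sum.mono_neutral_left) (auto simp: pull_coeff_eq_0)
  have "linear_lhs n p (\<lambda>t. \<kappa> t * z (l t)) t =
      (\<Sum>j\<le>n + 1. pull_coeff \<kappa> l (n + 1) j t * (deriv ^^ j) z (l t)) +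
      (\<Sum>i\<le>n. \<Sum>j\<le>n + 1. p i t * pull_coeff \<kappa> l i j t * (deriv ^^ j) z (l t))"
  proof -
    have "p i t * (\<Sum>j\<le>i. pull_coeff \<kappa> l i j t * (deriv ^^ j) z (l t)) =
        (\<Sum>j\<le>n + 1. p i t * pull_coeff \<kappa> l i j t * (deriv ^^ j) z (l t))" if "i \<le> n" for i
      using that ext[of i] by (simp only: trans_le_add1 sum_distrib_left mult.assoc)
    then show ?thesis
      unfolding linear_lhs_def funpow_deriv_pullback[OF I J t] by (intro arg_cong2[where f = "(+)"] sum.cong) auto
  qed
  also have "\<dots> = (\<Sum>j\<le>n + 1. pull_lin n p \<kappa> l j t * (deriv ^^ j) z (l t))"
    by (subst sum.swap) (simp only: pull_lin_def sum.distrib[symmetric] sum_distrib_right distrib_right)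
  finally show ?thesis .
qed

lemma linear_lhs_cong:
  assumes "open I" "t \<in> I" "\<And>s. s \<in> I \<Longrightarrow> y s = y' s"
  shows "linear_lhs n p y t = linear_lhs n p y' t"
  unfolding linear_lhs_def by (simp only: funpow_deriv_cong_open[OF assms])

text \<open>The relation of \<open>brings_to_lf\<close> with an arbitrary linear equation as target,
  so that transformations can be composed and inverted.\<close>

definition linear_equiv ::
  "nat \<Rightarrow> (nat \<Rightarrow> real \<Rightarrow> real) \<Rightarrow> real set \<Rightarrow> (real \<Rightarrow> real) \<Rightarrow> (real \<Rightarrow> real) \<Rightarrow> (nat \<Rightarrow> real \<Rightarrow> real) \<Rightarrow> bool"
  where
  "linear_equiv n p I l m p' \<longleftrightarrow>
     open_interval I \<and> diffeo I (l ` I) l \<and> smooth_on I m \<and> (\<forall>t\<in>I. m t \<noteq> 0) \<and>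
     (\<forall>y z. smooth_on I y \<longrightarrow> smooth_on (l ` I) z \<longrightarrow> (\<forall>t\<in>I. z (l t) = m t * y t) \<longrightarrow>
        (\<forall>t\<in>I. linear_lhs n p y t = 0 \<longleftrightarrow> linear_lhs n p' z (l t) = 0))"

lemma funpow_deriv_monomial:
  "(deriv ^^ i) (\<lambda>x. c * (x - s) ^ j / fact j) =
     (\<lambda>x::real. if i \<le> j then c * (x - s) ^ (j - i) / fact (j - i) else 0)"
proof (induction i)
  case (Suc i)
  show ?case
  proof (cases "i < j")
    case True
    then obtain k where k: "j - i = Suc k" by (metis Suc_diff_Suc)
    have "((\<lambda>x. c * (x - s) ^ Suc k / fact (Suc k)) has_real_derivative c * (x - s) ^ k / fact k) (at x)" for x
    proof -
      have "((\<lambda>x. c / fact (Suc k) * (x - s) ^ Suc k) has_real_derivative c / fact (Suc k) * (real (Suc k) * (x - s) ^ k)) (at x)"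
        by (rule DERIV_cmult, rule DERIV_cong, rule DERIV_power, rule DERIV_diff, rule DERIV_ident, rule DERIV_const) simp
      moreover have "c / fact (Suc k) * (real (Suc k) * (x - s) ^ k) = c * (x - s) ^ k / fact k"
        by (simp add: divide_simps del: of_nat_Suc)
      ultimately show ?thesis by simp
    qed
    moreover have "j - Suc i = k" using k by simp
    ultimately show ?thesis using True k DERIV_imp_deriv
      by (auto simp: Suc fun_eq_iff simp del: fact_Suc power_Suc)
  next
    case False
    then show ?thesis unfolding funpow.simps comp_def Suc by (cases "i = j") auto
  qed
qed simp

lemma smooth_on_monomial: "open S \<Longrightarrow> smooth_on S (\<lambda>x::real. c * (x - s) ^ j / fact j)"
  unfolding divide_inverse by (intro smooth_on_intros)

lemma funpow_deriv_add:
  fixes f g :: "real \<Rightarrow> real"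
  assumes "open S" "smooth_on S f" "smooth_on S g" "x \<in> S"
  shows "(deriv ^^ i) (\<lambda>x. f x + g x) x = (deriv ^^ i) f x + (deriv ^^ i) g x"
proof -
  have "\<forall>x\<in>S. (deriv ^^ i) (\<lambda>x. f x + g x) x = (deriv ^^ i) f x + (deriv ^^ i) g x"
  proof (induction i)
    case (Suc i)
    show ?case
    proof
      fix x assume x: "x \<in> S"
      have "deriv ((deriv ^^ i) (\<lambda>x. f x + g x)) x = deriv (\<lambda>x. (deriv ^^ i) f x + (deriv ^^ i) g x) x"
        by (rule deriv_cong_open[OF assms(1) x]) (use Suc in blast)
      also have "\<dots> = (deriv ^^ Suc i) f x + (deriv ^^ Suc i) g x"
        using assms(1-3) x by (intro DERIV_imp_deriv DERIV_add smooth_on_DERIV_funpow)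
      finally show "(deriv ^^ Suc i) (\<lambda>x. f x + g x) x = (deriv ^^ Suc i) f x + (deriv ^^ Suc i) g x" by simp
    qed
  qed simp
  then show ?thesis using assms(4) by blast
qed

text \<open>At each point the condition compares the zero sets of two linear forms on jets of order
  n + 1. Jets at a point can be prescribed, so equal zero sets mean proportional coefficients, and
  the factor is the leading one.\<close>

lemma linear_equiv_iff:
  "linear_equiv n p I l m p' \<longleftrightarrow>
     open_interval I \<and> diffeo I (l ` I) l \<and> smooth_on I m \<and> (\<forall>t\<in>I. m t \<noteq> 0) \<and>
     (\<forall>t\<in>I. \<forall>j\<le>n. pull_lin n p (\<lambda>t. inverse (m t)) l j t =
        pull_lin n p (\<lambda>t. inverse (m t)) l (n + 1) t * p' j (l t))"
  (is "_ \<longleftrightarrow> _ \<and> _ \<and> _ \<and> _ \<and> ?rest")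
proof -
  let ?\<kappa> = "\<lambda>t. inverse (m t)"
  let ?A = "pull_lin n p ?\<kappa> l"
  have "linear_equiv n p I l m p' \<longleftrightarrow> ?rest" if
    oint: "open_interval I" and diff: "diffeo I (l ` I) l" and m: "smooth_on I m" "\<forall>t\<in>I. m t \<noteq> 0"
  proof -
    have I: "open I" "smooth_on I ?\<kappa>" "smooth_on I l" and J: "open (l ` I)"
      using oint diff m by (auto simp: open_interval_def diffeo_def intro!: smooth_on_inverse)
    have top: "?A (n + 1) t \<noteq> 0" if "t \<in> I" for t
      unfolding pull_lin_top using diffeo_deriv_nonzero[OF diff that] m that by simp
    show ?thesis
    proof
      assume eq: "linear_equiv n p I l m p'"
      show ?rest
      proof (intro ballI allI impI)
        fix t j assume t: "t \<in> I" and j: "j \<le> n"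
        \<comment> \<open>The polynomial \<open>z\<close> satisfies the target equation at the
          single point \<open>l t\<close>: its only nonzero derivatives there are the one of order
          \<open>j\<close>, equal to 1, and possibly the one of order n + 1, equal to
          \<open>c\<close>.\<close>
        define c where "c = - p' j (l t)"
        define z where "z x = 1 * (x - l t) ^ j / fact j + c * (x - l t) ^ (n + 1) / fact (n + 1)" for x
        define y where "y s = ?\<kappa> s * z (l s)" for s
        have z: "smooth_on T z" if "open T" for T
          unfolding z_def by (intro smooth_on_add smooth_on_monomial that)
        have zi: "(deriv ^^ i) z (l t) = (if i = j then 1 else 0) + (if i = n + 1 then c else 0)" for i
          unfolding z_def funpow_deriv_add[OF open_UNIV smooth_on_monomial smooth_on_monomial, OF open_UNIV open_UNIV UNIV_I]
          unfolding funpow_deriv_monomial by (auto simp: power_0_left simp del: power_Suc fact_Suc)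
        have y: "smooth_on I y"
          unfolding y_def by (intro smooth_on_mult I smooth_on_compose[OF I(1) _ I(3) z[OF J]]) auto
        have "linear_lhs n p' z (l t) = c + (\<Sum>i\<le>n. p' i (l t) * (if i = j then 1 else 0))"
          unfolding linear_lhs_def zi using j by (auto intro!: arg_cong2[where f = "(+)"] sum.cong)
        also have "\<dots> = 0" using j by (simp add: c_def if_distrib cong: if_cong)
        finally have "linear_lhs n p y t = 0"
          using eq t y z[OF J] m unfolding linear_equiv_def y_def by (auto simp: field_simps)
        then have "0 = (\<Sum>i\<le>n + 1. ?A i t * (deriv ^^ i) z (l t))"
          unfolding y_def linear_lhs_pullback[OF I J z[OF J] order_refl t] by simp
        also have "\<dots> = ?A j t + c * ?A (n + 1) t"
          unfolding zi distrib_left sum.distrib using j by (simp add: mult_delta_right del: sum.atMost_Suc)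
        finally show "?A j t = ?A (n + 1) t * p' j (l t)" by (simp add: c_def)
      qed
    next
      assume rest: ?rest
      show "linear_equiv n p I l m p'"
        unfolding linear_equiv_def
      proof (intro conjI allI impI ballI oint diff m(1))
        fix y z t assume y: "smooth_on I y" and z: "smooth_on (l ` I) z"
          and yz: "\<forall>t\<in>I. z (l t) = m t * y t" and t: "t \<in> I"
        have "linear_lhs n p y t = linear_lhs n p (\<lambda>t. ?\<kappa> t * z (l t)) t"
          using yz m by (intro linear_lhs_cong[OF I(1) t]) auto
        also have "\<dots> = (\<Sum>j\<le>n. ?A j t * (deriv ^^ j) z (l t)) + ?A (n + 1) t * (deriv ^^ (n + 1)) z (l t)"
          by (subst linear_lhs_pullback[OF I J z order_refl t]) simp
        also have "\<dots> = ?A (n + 1) t * linear_lhs n p' z (l t)"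
          using rest t by (simp add: linear_lhs_def sum_distrib_left distrib_left mult_ac)
        finally show "linear_lhs n p y t = 0 \<longleftrightarrow> linear_lhs n p' z (l t) = 0"
          using top[OF t] by simp
      qed (use m in auto)
    qed
  qed
  then show ?thesis unfolding linear_equiv_def by blast
qed

lemma linear_equiv_restrict:
  assumes "linear_equiv n p I l m p'" "open_interval I'" "I' \<subseteq> I"
  shows "linear_equiv n p I' l m p'"
  using assms unfolding linear_equiv_iff by (auto intro: diffeo_restrict smooth_on_subset)

lemma deriv_diffeo_compose:
  fixes l l' :: "real \<Rightarrow> real"
  assumes "smooth_on I l" "smooth_on J l'" "t \<in> I" "l t \<in> J"
  shows "deriv (\<lambda>t. l' (l t)) t = deriv l' (l t) * deriv l t"
  using DERIV_chain2[OF smooth_on_DERIV[OF assms(2,4)] smooth_on_DERIV[OF assms(1,3)]]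
  by (rule DERIV_imp_deriv)

lemma linear_equiv_compose:
  assumes 1: "linear_equiv n p I l m p'" and 2: "linear_equiv n p' (l ` I) l' m' p''"
  shows "linear_equiv n p I (\<lambda>t. l' (l t)) (\<lambda>t. m' (l t) * m t) p''"
proof -
  let ?J = "l ` I" and ?g = "the_inv_into I l"
  have I: "open_interval I" "open I" "smooth_on I l" "smooth_on I m" "\<And>t. t \<in> I \<Longrightarrow> m t \<noteq> 0"
    and dl: "diffeo I ?J l"
    using 1 by (auto simp: linear_equiv_def open_interval_def diffeo_def)
  have J: "open ?J" "smooth_on ?J l'" "smooth_on ?J m'" "\<And>s. s \<in> ?J \<Longrightarrow> m' s \<noteq> 0"
    and dl': "diffeo ?J (l' ` ?J) l'"
    using 2 by (auto simp: linear_equiv_def open_interval_def diffeo_def)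
  have g: "smooth_on ?J ?g" "\<And>s. s \<in> ?J \<Longrightarrow> ?g s \<in> I" "\<And>t. t \<in> I \<Longrightarrow> ?g (l t) = t"
    using dl diffeo_inv_in[OF dl] diffeo_inv_eq[OF dl] by (auto simp: diffeo_def)
  have comp: "smooth_on I (\<lambda>t. l' (l t))" "smooth_on I (\<lambda>t. m' (l t) * m t)"
    by (auto intro!: smooth_on_mult smooth_on_compose[OF I(2) order_refl I(3)] I J)
  show ?thesis unfolding linear_equiv_def
  proof (intro conjI allI impI ballI)
    show "diffeo I ((\<lambda>t. l' (l t)) ` I) (\<lambda>t. l' (l t))"
      using deriv_diffeo_compose[OF I(3) J(2)] diffeo_deriv_nonzero[OF dl] diffeo_deriv_nonzero[OF dl']
      by (intro diffeo_intervalI I comp) auto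
  next
    fix y z t
    assume y: "smooth_on I y" and z: "smooth_on ((\<lambda>t. l' (l t)) ` I) z"
      and yz: "\<forall>t\<in>I. z (l' (l t)) = m' (l t) * m t * y t" and t: "t \<in> I"
    define w where "w s = m (?g s) * y (?g s)" for s
    have w: "smooth_on ?J w"
      unfolding w_def using g by (intro smooth_on_mult smooth_on_compose[OF J(1) _ g(1), of I] J I y) auto
    have wl: "w (l t) = m t * y t" if "t \<in> I" for t
      using g(3)[OF that] by (simp add: w_def)
    have "linear_lhs n p y t = 0 \<longleftrightarrow> linear_lhs n p' w (l t) = 0"
      using 1 y w wl t unfolding linear_equiv_def by blast
    also have "\<dots> \<longleftrightarrow> linear_lhs n p'' z (l' (l t)) = 0"
      using 2 w z wl t yz unfolding linear_equiv_def by (auto simp: image_image mult.assoc)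
    finally show "linear_lhs n p y t = 0 \<longleftrightarrow> linear_lhs n p'' z (l' (l t)) = 0" .
  qed (use I J comp in auto)
qed

lemma linear_equiv_inverse:
  assumes "linear_equiv n p I l m p'"
  shows "linear_equiv n p' (l ` I) (the_inv_into I l) (\<lambda>s. inverse (m (the_inv_into I l s))) p"
proof -
  let ?J = "l ` I" and ?g = "the_inv_into I l"
  have I: "open_interval I" "open I" "smooth_on I l" "smooth_on I m" "\<And>t. t \<in> I \<Longrightarrow> m t \<noteq> 0"
    and dl: "diffeo I ?J l"
    using assms by (auto simp: linear_equiv_def open_interval_def diffeo_def)
  have J: "open ?J" using dl by (auto simp: diffeo_def)
  have g: "smooth_on ?J ?g" "\<And>s. s \<in> ?J \<Longrightarrow> ?g s \<in> I" "\<And>t. t \<in> I \<Longrightarrow> ?g (l t) = t" "?g ` ?J = I"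
    using dl diffeo_inv_in[OF dl] diffeo_inv_eq[OF dl] by (auto simp: diffeo_def image_image)
  show ?thesis unfolding linear_equiv_def
  proof (intro conjI allI impI ballI)
    show "open_interval ?J" using open_interval_image[OF I(1) dl] .
    show "diffeo ?J (?g ` ?J) ?g" using diffeo_inverse[OF dl] g(4) by simp
    show "smooth_on ?J (\<lambda>s. inverse (m (?g s)))"
      using g(4) by (intro smooth_on_inverse smooth_on_compose[OF J _ g(1) I(4)]) (auto simp: J I g)
    show "inverse (m (?g s)) \<noteq> 0" if "s \<in> ?J" for s using I g that by auto
  next
    fix y z s assume y: "smooth_on ?J y" and z: "smooth_on (?g ` ?J) z"
      and yz: "\<forall>s\<in>?J. z (?g s) = inverse (m (?g s)) * y s" and s: "s \<in> ?J"
    then obtain t where t: "t \<in> I" "s = l t" by blast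
    have "\<forall>t\<in>I. y (l t) = m t * z t"
      using yz g(3) I(5) by (auto simp: field_simps)
    then show "linear_lhs n p' y s = 0 \<longleftrightarrow> linear_lhs n p z (?g s) = 0"
      using assms y z t g(3,4) unfolding linear_equiv_def by auto
  qed
qed

text \<open>Padding with zeros in the orders n - 1 and n makes a Laguerre-Forsyth form a general
  linear equation, to which \<open>linear_equiv\<close> applies.\<close>

definition lf_coeffs :: "nat \<Rightarrow> (nat \<Rightarrow> real \<Rightarrow> real) \<Rightarrow> nat \<Rightarrow> real \<Rightarrow> real" where
  "lf_coeffs n q i = (if i \<le> n - 2 then q i else (\<lambda>s. 0))"

lemma brings_to_lf_iff:
  assumes "n \<ge> 2"
  shows "brings_to_lf n p I l m q \<longleftrightarrow>
    linear_equiv n p I l m (lf_coeffs n q) \<and> (\<forall>i\<le>n - 2. smooth_on (l ` I) (q i))"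
proof -
  have "lf_lhs n q z s = linear_lhs n (lf_coeffs n q) z s" for z s
  proof -
    have "(\<Sum>i\<le>n - 2. q i s * (deriv ^^ i) z s) = (\<Sum>i\<le>n - 2. lf_coeffs n q i s * (deriv ^^ i) z s)"
      by (intro sum.cong) (auto simp: lf_coeffs_def)
    also have "\<dots> = (\<Sum>i\<le>n. lf_coeffs n q i s * (deriv ^^ i) z s)"
      by (intro sum.mono_neutral_left) (auto simp: lf_coeffs_def)
    finally show ?thesis by (simp add: lf_lhs_def linear_lhs_def)
  qed
  then show ?thesis unfolding brings_to_lf_def linear_equiv_def by auto
qed

section \<open>Binomial sums\<close>

text \<open>Pascal's rule: the alternating sum of order N + 1 is the one of order N for the first
  differences.\<close>

lemma alternating_binomial_sum_Suc:
  "(\<Sum>i\<le>Suc N. (-1) ^ i * real (Suc N choose i) * f i) =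
     (\<Sum>i\<le>N. (-1) ^ i * real (N choose i) * (f i - f (Suc i)))"
proof -
  have "(\<Sum>i\<le>Suc N. (-1) ^ i * real (Suc N choose i) * f i) =
      f 0 + (\<Sum>i\<le>N. (-1) ^ Suc i * real (N choose Suc i) * f (Suc i)) +
      (\<Sum>i\<le>N. (-1) ^ Suc i * real (N choose i) * f (Suc i))"
    by (subst sum.atMost_Suc_shift) (simp add: algebra_simps sum.distrib sum_negf sum_subtractf)
  also have "f 0 + (\<Sum>i\<le>N. (-1) ^ Suc i * real (N choose Suc i) * f (Suc i)) =
      (\<Sum>i\<le>Suc N. (-1) ^ i * real (N choose i) * f i)"
    by (subst sum.atMost_Suc_shift) simp
  also have "\<dots> = (\<Sum>i\<le>N. (-1) ^ i * real (N choose i) * f i)" by simp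
  finally show ?thesis by (simp add: algebra_simps sum.distrib sum_subtractf sum_negf)
qed

text \<open>As a function of i, the binomial (c + i) choose j is a polynomial of degree j, and each
  first difference lowers j by one.\<close>

lemma alternating_binomial_sum_eq_0:
  "j < N \<Longrightarrow> (\<Sum>i\<le>N. (-1) ^ i * real (N choose i) * real ((c + i) choose j)) = 0"
proof (induction N arbitrary: j)
  case (Suc N)
  show ?case
  proof (cases j)
    case 0
    then show ?thesis by (simp only: alternating_binomial_sum_Suc) simp
  next
    case (Suc k)
    have "(\<Sum>i\<le>Suc N. (-1) ^ i * real (Suc N choose i) * real ((c + i) choose j)) =
        - (\<Sum>i\<le>N. (-1) ^ i * real (N choose i) * real ((c + i) choose k))"
      unfolding alternating_binomial_sum_Suc by (simp add: Suc sum_negf[symmetric])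
    then show ?thesis using Suc.IH[of k] Suc.prems Suc by simp
  qed
qed simp

text \<open>The coefficients that arise when operators of the form \<open>F \<mapsto> u F'\<close> are iterated on products
  \<open>\<psi>^b u^c F\<close> with \<open>\<psi>' = - \<psi>\<^sup>2\<close> and \<open>u' = 2 \<psi> u\<close>.\<close>

primrec moebius_coeff :: "real \<Rightarrow> nat \<Rightarrow> nat \<Rightarrow> real" where
  "moebius_coeff r 0 a = (if a = 0 then 1 else 0)"
| "moebius_coeff r (Suc p) a =
     (r + real p + real a) * moebius_coeff r p a + (if a = 0 then 0 else moebius_coeff r p (a - 1))"

lemma moebius_coeff_eq_0: "p < a \<Longrightarrow> moebius_coeff r p a = 0"
  by (induction p arbitrary: a) auto

text \<open>For r = 0 these are the Lah numbers. The recursion for the closed form reduces to the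
  absorption identity a (p choose a) = (p - b) (p choose b) with a = b + 1.\<close>

lemma moebius_coeff_closed_form:
  "a \<le> p \<Longrightarrow> moebius_coeff r p a = real (p choose a) * pochhammer (r + real a) (p - a)"
proof (induction p arbitrary: a)
  case (Suc p)
  consider "a = 0" | "a = Suc p" | b where "a = Suc b" "a \<le> p"
    using Suc.prems by (metis le_SucE not0_implies_Suc)
  then show ?case
  proof cases
    case 1
    then show ?thesis using Suc.IH[of 0] by (simp add: pochhammer_Suc)
  next
    case 2
    then show ?thesis using Suc.IH[of p] by (simp add: moebius_coeff_eq_0)
  next
    case 3
    let ?P = "pochhammer (r + real a) (p - a)"
    have p: "p - b = Suc (p - a)" "Suc p - a = Suc (p - a)" using 3 by auto
    have P: "pochhammer (r + real b) (p - b) = (r + real b) * ?P"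
      unfolding p pochhammer_rec using 3 by (simp add: add_ac)
    have P': "pochhammer (r + real a) (Suc p - a) = ?P * (r + real p)"
      unfolding p pochhammer_Suc using 3 by (simp add: of_nat_diff)
    have "real a * real (p choose a) = real (p - b) * real (p choose b)"
      using binomial_absorb_comp[of p b] binomial_absorption[of b "p - 1"] 3
      by (metis Suc_pred binomial_absorb_comp le0 mult.commute of_nat_mult binomial_absorption diff_Suc_1)
    then have absorb: "real a * real (p choose a) = (real p - real b) * real (p choose b)"
      using 3 by (simp add: of_nat_diff)
    have "moebius_coeff r (Suc p) a =
        (r + real p + real a) * (real (p choose a) * ?P) + real (p choose b) * ((r + real b) * ?P)"
      using 3 Suc.IH[of a] Suc.IH[of b] P by simp
    also have "\<dots> = ?P * ((r + real p) * real (p choose a) + real a * real (p choose a) + (r + real b) * real (p choose b))"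
      by (simp add: algebra_simps)
    also have "\<dots> = real (Suc p choose a) * (?P * (r + real p))"
      unfolding absorb using 3 by (simp add: algebra_simps)
    finally show ?thesis unfolding P' .
  qed
qed simp

lemma pochhammer_of_nat_eq_fact: "pochhammer (real (Suc a)) d = fact (a + d) / fact a"
proof (induction d)
  case (Suc d)
  have "pochhammer (real (Suc a)) (Suc d) = fact (a + d) / fact a * (real (Suc a) + real d)"
    by (simp only: pochhammer_Suc Suc)
  also have "real (Suc a) + real d = real (Suc (a + d))" by simp
  also have "fact (a + d) / fact a * real (Suc (a + d)) = (fact (a + Suc d) / fact a :: real)"
    by (simp only: add_Suc_right fact_Suc) (simp add: mult.commute)
  finally show ?case .
qed simp

text \<open>The weights of \<^const>\<open>theta_lf\<close> once \<open>q_i\<close> is numbered by \<open>m = n + 1 - i\<close> and scaled by \<open>i!\<close>.\<close>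

definition theta_weight :: "nat \<Rightarrow> nat \<Rightarrow> real" where
  "theta_weight k m = (-1) ^ (k - m) * fact (k + m - 2) / (fact (m - 1) * fact (k - m))"

text \<open>The sum is the total coefficient of \<psi>^(k - m - a) Q_m^(a) in a transformed
  \<theta>_k. With M = m + i and N = k - m - a > 0, the summand is, up to a factor free of i, (-1)^i
  (N choose i) ((k + m - 2 + i) choose (N - 1)), which gives an N-th difference of a polynomial of
  degree N - 1. Only N = 0 survives.\<close>

lemma theta_weight_sum:
  assumes m: "3 \<le> m" "m + a \<le> k"
  shows "(\<Sum>M=m..k. theta_weight k M * real ((M - 1) choose (m - 1)) * moebius_coeff (real (m + M)) (k - M) a)
     = (if m + a = k then theta_weight k m else 0)"
proof -
  define N where "N = k - m - a"
  let ?T = "\<lambda>M. theta_weight k M * real ((M - 1) choose (m - 1)) * moebius_coeff (real (m + M)) (k - M) a"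
  have T: "?T (m + i) = fact (m + k - 1) / (fact (m - 1) * fact a) * (-1) ^ (k - m) *
      ((-1) ^ i * fact (k + m + i - 2) / (fact i * fact (N - i) * fact (2 * m + a + i - 1)))"
    if i: "i \<le> N" for i
  proof -
    let ?M = "m + i"
    have le: "?M + a \<le> k" using i m by (simp add: N_def)
    have s: "(-1 :: real) ^ (k - ?M) = (-1) ^ (k - m) * (-1) ^ i"
    proof -
      have "k - m = (k - ?M) + i" using le by simp
      then have "(-1 :: real) ^ (k - m) * (-1) ^ i = (-1) ^ (k - ?M) * ((-1) ^ i * (-1) ^ i)"
        by (simp only: power_add mult.assoc)
      then show ?thesis by (simp flip: power_mult_distrib)
    qed
    have b: "real ((?M - 1) choose (m - 1)) = fact (?M - 1) / (fact (m - 1) * fact i)"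
      using m by (subst binomial_fact[where ?'a = real]) auto
    have "pochhammer (real (m + ?M) + real a) (k - ?M - a) = fact (m + k - 1) / fact (2 * m + a + i - 1)"
    proof -
      have "real (m + ?M) + real a = real (Suc (2 * m + a + i - 1))" using m by simp
      then show ?thesis using m le by (simp only: pochhammer_of_nat_eq_fact) (simp add: mult_2 algebra_simps)
    qed
    then have e: "moebius_coeff (real (m + ?M)) (k - ?M) a =
        fact (k - ?M) / (fact a * fact (N - i)) * (fact (m + k - 1) / fact (2 * m + a + i - 1))"
      using le by (subst moebius_coeff_closed_form) (auto simp: binomial_fact[where ?'a = real] N_def algebra_simps)
    have "k + ?M - 2 = k + m + i - 2" by simp
    then show ?thesis
      unfolding theta_weight_def s b e by (simp add: field_simps)
  qed
  \<comment> \<open>Beyond M = k - a the terms vanish, because \<open>moebius_coeff\<close> is 0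
    when its last index \<open>a\<close> exceeds k - M.\<close>
  have "(\<Sum>M=m..k. ?T M) = (\<Sum>M=m..m + N. ?T M)"
    using m by (intro sum.mono_neutral_right) (auto simp: N_def moebius_coeff_eq_0)
  also have "\<dots> = (\<Sum>i\<le>N. ?T (m + i))"
    by (rule sum.reindex_bij_witness[of _ "\<lambda>i. m + i" "\<lambda>M. M - m"]) auto
  also have "\<dots> = fact (m + k - 1) / (fact (m - 1) * fact a) * (-1) ^ (k - m) *
      (\<Sum>i\<le>N. (-1) ^ i * fact (k + m + i - 2) / (fact i * fact (N - i) * fact (2 * m + a + i - 1)))"
    unfolding sum_distrib_left by (rule sum.cong[OF refl]) (rule T, simp)
  also have "\<dots> = (if m + a = k then theta_weight k m else 0)"
  proof (cases "N = 0")
    case True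
    then have k: "k = m + a" using m by (simp add: N_def)
    then show ?thesis using m True by (simp add: theta_weight_def field_simps flip: mult_2_right)
  next
    case False
    then obtain d where d: "N = Suc d" by (metis not0_implies_Suc)
    have k: "k = m + a + Suc d" using d m by (simp add: N_def)
    have "(\<Sum>i\<le>N. (-1) ^ i * fact (k + m + i - 2) / (fact i * fact (N - i) * fact (2 * m + a + i - 1))) =
        (\<Sum>i\<le>N. fact d / fact N * ((-1) ^ i * real (N choose i) * real ((k + m - 2 + i) choose d)))"
    proof (rule sum.cong)
      fix i assume "i \<in> {..N}"
      then have i: "i \<le> N" by simp
      have e: "k + m + i - 2 = k + m - 2 + i" "k + m - 2 + i - d = 2 * m + a + i - 1" "d \<le> k + m - 2 + i"
        using m k by auto
      show "(-1) ^ i * fact (k + m + i - 2) / (fact i * fact (N - i) * fact (2 * m + a + i - 1)) =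
          fact d / fact N * ((-1) ^ i * real (N choose i) * real ((k + m - 2 + i) choose d))"
        unfolding e(1) binomial_fact[OF i, where ?'a = real] binomial_fact[OF e(3), where ?'a = real] e(2) by simp
    qed simp
    also have "\<dots> = 0"
      unfolding sum_distrib_left[symmetric] using alternating_binomial_sum_eq_0[of d N "k + m - 2"] d by simp
    finally show ?thesis using k by simp
  qed
  finally show ?thesis .
qed

section \<open>The Laguerre-Forsyth form\<close>

text \<open>The factor of \<psi> in the subdiagonal coefficient
  \<open>pull_coeff \<kappa> l i (i - 1)\<close>. It is the sum of n - 2 q over q < i.\<close>

definition sub_coeff :: "nat \<Rightarrow> nat \<Rightarrow> real" where
  "sub_coeff n i = real i * (real n + 1 - real i)"

lemma sub_coeff_Suc: "sub_coeff n (Suc i) = sub_coeff n i + real n - 2 * real i"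
  by (simp add: sub_coeff_def algebra_simps)

definition sub_coeff_sum :: "nat \<Rightarrow> real" where
  "sub_coeff_sum n = (\<Sum>q\<le>n. sub_coeff n q)"

text \<open>\<open>sub_coeff_sum n\<close> is the factor of \<psi>' in the coefficient of order n -
  1. Because it is nonzero, the vanishing of that coefficient determines \<psi>'.\<close>

lemma sub_coeff_sum_pos: "n > 0 \<Longrightarrow> sub_coeff_sum n > 0"
  unfolding sub_coeff_sum_def sub_coeff_def by (intro sum_pos2[where i = n]) auto

text \<open>The sum telescopes because \<open>2 (n + 1 - 2 q) b_q = b_q b_(q+1) - b_(q-1) b_q\<close> for
  \<open>b_q = q (n + 1 - q)\<close>.\<close>

lemma sub_coeff_moment: "(\<Sum>q\<le>n. (real n - 2 * (real q - 1)) * sub_coeff n q) = sub_coeff_sum n"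
proof -
  have "(\<Sum>q<i. 2 * (real n + 1 - 2 * real q) * sub_coeff n q) =
      sub_coeff n i * ((real i - 1) * (real n + 2 - real i))" for i
    by (induction i) (auto simp: sub_coeff_def algebra_simps)
  from this[of "Suc n"] have "(\<Sum>q\<le>n. 2 * (real n + 1 - 2 * real q) * sub_coeff n q) = 0"
    by (simp add: sub_coeff_def lessThan_Suc_atMost del: sum.lessThan_Suc)
  then have "2 * (\<Sum>q\<le>n. (real n + 1 - 2 * real q) * sub_coeff n q) = 0"
    by (simp only: sum_distrib_left mult.assoc)
  then have "(\<Sum>q\<le>n. (real n + 1 - 2 * real q) * sub_coeff n q + sub_coeff n q) = sub_coeff_sum n"
    by (simp add: sum.distrib sub_coeff_sum_def)
  then show ?thesis by (simp add: algebra_simps)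
qed

text \<open>The transformation \<open>y = \<kappa> (z \<circ> l)\<close> is described by \<open>\<psi> = - l'' / (2 l')\<close> and by the
  deviation \<open>\<omega>\<close> of \<open>\<kappa>' / \<kappa>\<close> from \<open>n \<psi>\<close>, its value for \<open>\<kappa> = (l')^(- n / 2)\<close>.\<close>

locale pullback_parameters =
  fixes n :: nat and I :: "real set" and \<kappa> l \<psi> \<omega> :: "real \<Rightarrow> real"
  assumes open_I: "open I"
    and smooth: "smooth_on I \<kappa>" "smooth_on I l" "smooth_on I \<psi>" "smooth_on I \<omega>"
    and deriv_\<kappa>: "t \<in> I \<Longrightarrow> deriv \<kappa> t = (real n * \<psi> t + \<omega> t) * \<kappa> t"
    and deriv_l: "t \<in> I \<Longrightarrow> deriv (deriv l) t = - 2 * \<psi> t * deriv l t"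
begin

lemma DERIV_\<kappa>_power:
  assumes t: "t \<in> I"
  shows "((\<lambda>t. \<kappa> t * deriv l t ^ i) has_real_derivative
    \<kappa> t * deriv l t ^ i * (real n * \<psi> t + \<omega> t - 2 * real i * \<psi> t)) (at t)"
proof -
  have "(\<kappa> has_real_derivative (real n * \<psi> t + \<omega> t) * \<kappa> t) (at t)"
    using smooth_on_DERIV[OF smooth(1) t] deriv_\<kappa>[OF t] by simp
  moreover have "((\<lambda>t. deriv l t ^ i) has_real_derivative real i * (- 2 * \<psi> t * deriv l t * deriv l t ^ (i - Suc 0))) (at t)"
    using DERIV_power[OF smooth_on_DERIV[OF smooth_on_deriv[OF open_I smooth(2)] t], of i] deriv_l[OF t] by simp
  ultimately show ?thesis
    by (rule DERIV_cong[OF DERIV_mult]) (cases i; simp add: algebra_simps)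
qed

text \<open>Each step down the subdiagonal adds the derivative of a diagonal entry \<kappa> l'^q,
  whose logarithmic derivative is (n - 2 q) \<psi> + \<omega>. Summing over q \<le> i gives the
  bracket.\<close>

lemma pull_coeff_Suc:
  "t \<in> I \<Longrightarrow> pull_coeff \<kappa> l (Suc i) i t =
     \<kappa> t * deriv l t ^ i * (sub_coeff n (Suc i) * \<psi> t + real (Suc i) * \<omega> t)"
proof (induction i arbitrary: t)
  case 0
  then show ?case by (simp add: deriv_\<kappa> sub_coeff_def)
next
  case (Suc i)
  have diag: "pull_coeff \<kappa> l (Suc i) (Suc i) = (\<lambda>t. \<kappa> t * deriv l t ^ Suc i)"
    by (rule ext) (rule pull_coeff_diag)
  have "pull_coeff \<kappa> l (Suc (Suc i)) (Suc i) t =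
      deriv (\<lambda>t. \<kappa> t * deriv l t ^ Suc i) t + deriv l t * pull_coeff \<kappa> l (Suc i) i t"
    by (subst pull_coeff.simps(2)) (simp only: diag if_False diff_Suc_1 nat.distinct)
  also have "deriv (\<lambda>t. \<kappa> t * deriv l t ^ Suc i) t =
      \<kappa> t * deriv l t ^ Suc i * (real n * \<psi> t + \<omega> t - 2 * real (Suc i) * \<psi> t)"
    by (rule DERIV_imp_deriv[OF DERIV_\<kappa>_power[OF Suc.prems]])
  finally show ?case
    unfolding Suc.IH[OF Suc.prems] sub_coeff_Suc[of n "Suc i"] by (simp add: algebra_simps)
qed

text \<open>For i > 0, the derivative of the subdiagonal entry in row i divided by \<kappa> l'^(i -
  1); the shift i - 1 is the column of that entry.\<close>

definition second_coeff_term :: "nat \<Rightarrow> real \<Rightarrow> real" where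
  "second_coeff_term i t =
     (real n * \<psi> t + \<omega> t - 2 * (real i - 1) * \<psi> t) * (sub_coeff n i * \<psi> t + real i * \<omega> t) +
     sub_coeff n i * deriv \<psi> t + real i * deriv \<omega> t"

lemma deriv_pull_coeff_Suc:
  assumes t: "t \<in> I"
  shows "deriv (pull_coeff \<kappa> l (Suc i) i) t = \<kappa> t * deriv l t ^ i * second_coeff_term (Suc i) t"
proof -
    have "((\<lambda>t. \<kappa> t * deriv l t ^ i * (sub_coeff n (Suc i) * \<psi> t + real (Suc i) * \<omega> t)) has_real_derivative
       \<kappa> t * deriv l t ^ i * (real n * \<psi> t + \<omega> t - 2 * real i * \<psi> t) * (sub_coeff n (Suc i) * \<psi> t + real (Suc i) * \<omega> t)
       + (sub_coeff n (Suc i) * deriv \<psi> t + real (Suc i) * deriv \<omega> t) * (\<kappa> t * deriv l t ^ i)) (at t)"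
      by (intro DERIV_mult DERIV_add DERIV_cmult DERIV_\<kappa>_power smooth_on_DERIV[OF smooth(3)] smooth_on_DERIV[OF smooth(4)] t)
    from DERIV_imp_deriv[OF this] show ?thesis
      using deriv_cong_open[OF open_I t pull_coeff_Suc] by (simp add: second_coeff_term_def algebra_simps)
qed

text \<open>Entries two places off the diagonal accumulate the derivatives of the subdiagonal
  entries. The summand q = 0 vanishes; including it makes the range {..n} when i = n - 1.\<close>

lemma pull_coeff_Suc_Suc:
  "t \<in> I \<Longrightarrow> pull_coeff \<kappa> l (Suc (Suc i)) i t =
     \<kappa> t * deriv l t ^ i * (\<Sum>q<Suc (Suc i). second_coeff_term q t)"
proof (induction i arbitrary: t)
  case 0
  have "second_coeff_term 0 t = 0" by (simp add: second_coeff_term_def sub_coeff_def)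
  then show ?case using deriv_pull_coeff_Suc[OF 0, of 0]
    by (subst pull_coeff.simps(2)) (simp only: lessThan_Suc, simp)
next
  case (Suc i)
  have "pull_coeff \<kappa> l (Suc (Suc (Suc i))) (Suc i) t =
      deriv (pull_coeff \<kappa> l (Suc (Suc i)) (Suc i)) t + deriv l t * pull_coeff \<kappa> l (Suc (Suc i)) i t"
    by (subst pull_coeff.simps(2)) (simp only: if_False diff_Suc_1 nat.distinct)
  then show ?case unfolding Suc.IH[OF Suc.prems] deriv_pull_coeff_Suc[OF Suc.prems]
    by (simp only: sum.lessThan_Suc power_Suc) (simp only: algebra_simps)
qed

lemma pull_lin_n:
  assumes "t \<in> I"
  shows "pull_lin n p \<kappa> l n t = \<kappa> t * deriv l t ^ n * (real (n + 1) * \<omega> t + p n t)"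
proof -
  have "(\<Sum>i\<le>n. p i t * pull_coeff \<kappa> l i n t) = p n t * pull_coeff \<kappa> l n n t"
    using sum.mono_neutral_right[of "{..n}" "{n}" "\<lambda>i. p i t * pull_coeff \<kappa> l i n t"]
    by (simp add: pull_coeff_eq_0)
  then show ?thesis
    using pull_coeff_Suc[OF assms, of n]
    by (simp add: pull_lin_def pull_coeff_diag sub_coeff_def algebra_simps del: pull_coeff.simps)
qed

lemma pull_lin_pred:
  assumes t: "t \<in> I" and n: "n = Suc m"
  shows "pull_lin n p \<kappa> l m t = \<kappa> t * deriv l t ^ m *
    ((\<Sum>q\<le>n. second_coeff_term q t) + p n t * (sub_coeff n n * \<psi> t + real n * \<omega> t) + p m t)"
proof -
  have "(\<Sum>i\<le>n. p i t * pull_coeff \<kappa> l i m t) =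
      p m t * pull_coeff \<kappa> l m m t + p n t * pull_coeff \<kappa> l n m t"
    using sum.mono_neutral_right[of "{..n}" "{m, n}" "\<lambda>i. p i t * pull_coeff \<kappa> l i m t"]
    by (auto simp: pull_coeff_eq_0 n simp del: pull_coeff.simps)
  then show ?thesis
    using pull_coeff_Suc[OF t, of m] pull_coeff_Suc_Suc[OF t, of m]
    by (simp add: pull_lin_def pull_coeff_diag n algebra_simps lessThan_Suc_atMost del: pull_coeff.simps sum.lessThan_Suc sum.atMost_Suc)
qed

end

text \<open>Time-dependent equations are treated as autonomous systems with time as first component;
  this identifies that component with the parameter of the curve.\<close>

lemma unit_speed_eq:
  fixes f :: "real \<Rightarrow> real"
  assumes "is_interval I" "x \<in> I" "f x = x" "\<And>t. t \<in> I \<Longrightarrow> (f has_real_derivative 1) (at t)" "t \<in> I"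
  shows "f t = t"
proof -
  have "\<exists>c. \<forall>t\<in>I. f t - t = c"
  proof (rule has_field_derivative_zero_constant)
    show "convex I" using assms(1) by (simp add: is_interval_convex_1)
    show "((\<lambda>t. f t - t) has_real_derivative 0) (at t within I)" if "t \<in> I" for t
      using DERIV_diff[OF assms(4)[OF that] DERIV_ident] by (simp add: has_field_derivative_at_within)
  qed
  then obtain c where "\<forall>t\<in>I. f t - t = c" by blast
  then show ?thesis using assms(2,3,5) by (metis cancel_comm_monoid_add_class.diff_cancel right_minus_eq)
qed

text \<open>The two conditions on \<open>(\<kappa>, l)\<close> become \<open>\<omega> = - p_n / (n + 1)\<close> and an equation
  \<open>\<psi>' = G (t, \<psi>)\<close>, which is solved together with \<open>l'' = - 2 \<psi> l'\<close> and
  \<open>\<kappa>' = (n \<psi> + \<omega>) \<kappa>\<close> as one first-order system.\<close>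

theorem laguerre_forsyth_exists:
  assumes n: "n \<ge> 2" and N: "open_interval N" "x \<in> N" and p: "\<And>i. i \<le> n \<Longrightarrow> smooth_on N (p i)"
  shows "\<exists>I l m q. x \<in> I \<and> I \<subseteq> N \<and> brings_to_lf n p I l m q"
proof -
  have oN: "open N" using N by (simp add: open_interval_def)
  define \<omega> where "\<omega> t = - (inverse (real n + 1) * p n t)" for t
  \<comment> \<open>The sum of the \<open>second_coeff_term\<close> without its \<psi>' part, with
    \<open>a\<close> in the place of \<psi>. \<open>G\<close> then solves the vanishing of the
    coefficient of order n - 1 for \<psi>'.\<close>
  define H where "H t a = (\<Sum>q\<le>n. (real n * a + \<omega> t - 2 * (real q - 1) * a) *
      (sub_coeff n q * a + real q * \<omega> t) + real q * deriv \<omega> t)" for t a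
  define G where "G t a = - (inverse (sub_coeff_sum n) *
     (H t a + p n t * (sub_coeff n n * a + real n * \<omega> t) + p (n - 1) t))" for t a
  \<comment> \<open>The components are, in order, t, \<psi>, l, l' and \<kappa>.\<close>
  define F :: "real \<times> real \<times> real \<times> real \<times> real \<Rightarrow> real \<times> real \<times> real \<times> real \<times> real"
    where "F u = (1, G (fst u) (fst (snd u)), fst (snd (snd (snd u))),
      - 2 * fst (snd u) * fst (snd (snd (snd u))),
      (real n * fst (snd u) + \<omega> (fst u)) * snd (snd (snd (snd u))))" for u
  define S where "S = N \<times> (UNIV :: (real \<times> real \<times> real \<times> real) set)"
  have S: "open S" unfolding S_def by (intro open_Times oN open_UNIV)
  have \<omega>: "smooth_on N \<omega>"
    unfolding \<omega>_def using p by (intro smooth_on_intros oN) auto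
  have base: "smooth_on S (\<lambda>u. g (fst u))" if "smooth_on N g" for g :: "real \<Rightarrow> real"
    by (rule smooth_on_compose[OF S _ smooth_on_linear[OF S bounded_linear_fst] that]) (auto simp: S_def)
  have F: "smooth_on S F"
    unfolding F_def[abs_def] G_def H_def using p n
    by (intro smooth_on_intros S base \<omega> smooth_on_deriv oN) auto
  \<comment> \<open>Starting with l' = \<kappa> = 1 keeps both nonzero near \<open>x\<close>; the
    value 0 for \<psi> and l is a free choice.\<close>
  obtain e u where e: "e > 0" and ux: "u x = (x, 0, 0, 1, 1)"
    and u: "\<And>t. t \<in> {x-e<..<x+e} \<Longrightarrow> u t \<in> S \<and> (u has_vector_derivative F (u t)) (at t)"
    using integral_curve_exists[OF S F, of "(x, 0, 0, 1, 1)" x] N(2) by (auto simp: S_def)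
  define \<psi> l d \<kappa> where "\<psi> t = fst (snd (u t))" and "l t = fst (snd (snd (u t)))"
    and "d t = fst (snd (snd (snd (u t))))" and "\<kappa> t = snd (snd (snd (snd (u t))))" for t
  have der: "((\<lambda>t. fst (u t)) has_real_derivative 1) (at t)"
    "(\<psi> has_real_derivative G (fst (u t)) (\<psi> t)) (at t)" "(l has_real_derivative d t) (at t)"
    "(d has_real_derivative - 2 * \<psi> t * d t) (at t)"
    "(\<kappa> has_real_derivative (real n * \<psi> t + \<omega> (fst (u t))) * \<kappa> t) (at t)"
    if t: "t \<in> {x-e<..<x+e}" for t
  proof -
    note u1 = conjunct2[OF u[OF t]]
    note L1 = bounded_linear.has_vector_derivative[OF bounded_linear_fst]
      and L2 = bounded_linear.has_vector_derivative[OF bounded_linear_snd]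
    show "((\<lambda>t. fst (u t)) has_real_derivative 1) (at t)"
      using L1[OF u1] by (simp add: has_real_derivative_iff_has_vector_derivative F_def)
    show "(\<psi> has_real_derivative G (fst (u t)) (\<psi> t)) (at t)"
      using L1[OF L2[OF u1]] by (simp add: has_real_derivative_iff_has_vector_derivative F_def \<psi>_def[abs_def])
    show "(l has_real_derivative d t) (at t)"
      using L1[OF L2[OF L2[OF u1]]] by (simp add: has_real_derivative_iff_has_vector_derivative F_def l_def[abs_def] d_def)
    show "(d has_real_derivative - 2 * \<psi> t * d t) (at t)"
      using L1[OF L2[OF L2[OF L2[OF u1]]]] by (simp add: has_real_derivative_iff_has_vector_derivative F_def \<psi>_def d_def[abs_def])
    show "(\<kappa> has_real_derivative (real n * \<psi> t + \<omega> (fst (u t))) * \<kappa> t) (at t)"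
      using L2[OF L2[OF L2[OF L2[OF u1]]]] by (simp add: has_real_derivative_iff_has_vector_derivative F_def \<psi>_def \<kappa>_def[abs_def])
  qed
  have fstu: "fst (u t) = t" if "t \<in> {x-e<..<x+e}" for t
    by (rule unit_speed_eq[of "{x-e<..<x+e}" x]) (use that e ux der(1) in \<open>auto simp: is_interval_convex_1\<close>)
  have x: "x \<in> {x-e<..<x+e}" using e by simp
  have "isCont d x" "isCont \<kappa> x" using der(4,5)[OF x] DERIV_isCont by blast+
  moreover have "d x = 1" "\<kappa> x = 1" by (simp_all add: d_def \<kappa>_def ux)
  ultimately obtain e1 e2 where e12: "e1 > 0" "e2 > 0"
    "\<And>t. dist x t < e1 \<Longrightarrow> d t \<noteq> 0" "\<And>t. dist x t < e2 \<Longrightarrow> \<kappa> t \<noteq> 0"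
    using continuous_at_avoid[of x d 0] continuous_at_avoid[of x \<kappa> 0] by auto
  define r where "r = min e (min e1 e2)"
  define I where "I = {x-r<..<x+r}"
  have r: "r > 0" using e e12 by (simp add: r_def)
  have oI: "open I" "open_interval I" and xI: "x \<in> I"
    using r by (auto simp: I_def open_interval_def is_interval_convex_1)
  have sub: "t \<in> {x-e<..<x+e}" "d t \<noteq> 0" "\<kappa> t \<noteq> 0" "t \<in> N" if t: "t \<in> I" for t
  proof -
    have d: "dist x t < r" using t by (auto simp: I_def dist_real_def)
    show t': "t \<in> {x-e<..<x+e}" using t by (auto simp: I_def r_def)
    show "d t \<noteq> 0" "\<kappa> t \<noteq> 0" using d e12(3,4)[of t] by (auto simp: r_def)
    show "t \<in> N" using u[OF t'] fstu[OF t'] by (auto simp: S_def mem_Times_iff)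
  qed
  have "smooth_on I u"
    by (rule smooth_on_integral_curve[OF oI(1) S F]) (use u sub in auto)
  then have sm: "smooth_on I \<psi>" "smooth_on I l" "smooth_on I \<kappa>" "smooth_on I \<omega>"
    unfolding \<psi>_def[abs_def] l_def[abs_def] \<kappa>_def[abs_def]
    using sub(4) by (auto intro!: smooth_on_fst smooth_on_snd oI smooth_on_subset[OF \<omega>])
  have dl: "deriv l t = d t" if "t \<in> I" for t using der(3) sub(1)[OF that] by (metis DERIV_imp_deriv)
  interpret pullback_parameters n I \<kappa> l \<psi> \<omega>
  proof
    fix t assume t: "t \<in> I"
    note t' = sub(1)[OF t]
    show "deriv \<kappa> t = (real n * \<psi> t + \<omega> t) * \<kappa> t"
      using DERIV_imp_deriv[OF der(5)[OF t']] fstu[OF t'] by simp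
    show "deriv (deriv l) t = - 2 * \<psi> t * deriv l t"
      using deriv_cong_open[OF oI(1) t dl] DERIV_imp_deriv[OF der(4)[OF t']] dl[OF t] by simp
  qed (use oI sm in auto)
  have A1: "pull_lin n p \<kappa> l n t = 0" if "t \<in> I" for t
    using pull_lin_n[OF that, of p] by (simp add: \<omega>_def field_simps)
  have A2: "pull_lin n p \<kappa> l (n - 1) t = 0" if t: "t \<in> I" for t
  proof -
    have "deriv \<psi> t = G t (\<psi> t)"
      using DERIV_imp_deriv[OF der(2)[OF sub(1)[OF t]]] fstu[OF sub(1)[OF t]] by simp
    moreover have "sub_coeff_sum n > 0" using n by (intro sub_coeff_sum_pos) simp
    ultimately have "sub_coeff_sum n * deriv \<psi> t =
        - (H t (\<psi> t) + p n t * (sub_coeff n n * \<psi> t + real n * \<omega> t) + p (n - 1) t)"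
      by (simp add: G_def field_simps)
    moreover have "(\<Sum>q\<le>n. second_coeff_term q t) = sub_coeff_sum n * deriv \<psi> t + H t (\<psi> t)"
      by (simp add: H_def second_coeff_term_def sub_coeff_sum_def sum.distrib sum_distrib_right)
    ultimately show ?thesis using pull_lin_pred[OF t, of "n - 1" p] n by simp
  qed
  have diff: "diffeo I (l ` I) l"
    using dl sub(2) by (intro diffeo_intervalI oI sm) auto
  define g where "g = the_inv_into I l"
  have g: "smooth_on (l ` I) g" "\<And>t. t \<in> I \<Longrightarrow> g (l t) = t" "open (l ` I)"
    using diff diffeo_inv_eq[OF diff] by (auto simp: g_def diffeo_def)
  \<comment> \<open>The surviving coefficients, normalized by the leading one and expressed in the
    new variable.\<close>
  define q where "q j s = pull_lin n p \<kappa> l j (g s) / pull_lin n p \<kappa> l (n + 1) (g s)" for j s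
  define m where "m t = inverse (\<kappa> t)" for t
  have mk: "(\<lambda>t. inverse (m t)) = \<kappa>" by (simp add: m_def)
  have top: "pull_lin n p \<kappa> l (n + 1) t \<noteq> 0" if "t \<in> I" for t
    unfolding pull_lin_top using sub(2,3)[OF that] dl[OF that] by simp
  have "smooth_on I (pull_lin n p \<kappa> l j)" for j
    unfolding pull_lin_def[abs_def]
    using p sub(4) by (intro smooth_on_intros oI smooth_on_pull_coeff sm) (auto intro: smooth_on_subset)
  then have "smooth_on (l ` I) (q j)" for j
    unfolding q_def[abs_def]
    by (intro smooth_on_compose[OF g(3) _ g(1), of I "\<lambda>t. pull_lin n p \<kappa> l j t / pull_lin n p \<kappa> l (n + 1) t"] smooth_on_divide oI top)
       (auto simp: g(2))
  moreover have "linear_equiv n p I l m (lf_coeffs n q)"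
    unfolding linear_equiv_iff mk
  proof (intro conjI ballI allI impI oI diff)
    fix t j assume t: "t \<in> I" and j: "j \<le> n"
    then consider "j \<le> n - 2" | "j = n - 1" "\<not> j \<le> n - 2" | "j = n" "\<not> j \<le> n - 2" using n by linarith
    then show "pull_lin n p \<kappa> l j t = pull_lin n p \<kappa> l (n + 1) t * lf_coeffs n q j (l t)"
      by cases (use top[OF t] A1[OF t] A2[OF t] g(2)[OF t] in \<open>auto simp: lf_coeffs_def q_def\<close>)
  next
    show "smooth_on I m" unfolding m_def[abs_def] by (intro smooth_on_inverse oI sm sub)
    show "m t \<noteq> 0" if "t \<in> I" for t using sub(3)[OF that] by (simp add: m_def)
  qed
  ultimately have "brings_to_lf n p I l m q" using brings_to_lf_iff[OF n] by blast
  then show ?thesis using xI sub(4) by blast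
qed

section \<open>Invariance of the Wilczynski invariants\<close>

text \<open>With \<psi> = - l'' / (2 l'), the equation \<psi>' = - \<psi>^2 says that the Schwarzian
  derivative of \<open>l\<close> vanishes. \<open>l\<close> is never written as a fraction; the
  differential equations suffice.\<close>

locale projective_parameter =
  fixes I :: "real set" and l \<psi> :: "real \<Rightarrow> real"
  assumes open_I: "open I" and open_image: "open (l ` I)"
    and smooth_l: "smooth_on I l" and smooth_\<psi>: "smooth_on I \<psi>"
    and deriv_l_nonzero: "t \<in> I \<Longrightarrow> deriv l t \<noteq> 0"
    and deriv2_l: "t \<in> I \<Longrightarrow> deriv (deriv l) t = - 2 * \<psi> t * deriv l t"
    and deriv_\<psi>: "t \<in> I \<Longrightarrow> deriv \<psi> t = - (\<psi> t)\<^sup>2"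
begin

text \<open>The derivative of order p in the new variable, that is the p-fold iterate of F \<mapsto>
  F' / l', of the function \<psi>^(M - m) l'^(-M) Q.\<close>

definition transvection :: "(real \<Rightarrow> real) \<Rightarrow> nat \<Rightarrow> nat \<Rightarrow> nat \<Rightarrow> real \<Rightarrow> real" where
  "transvection Q m M p t = (\<Sum>a\<le>p. moebius_coeff (real (m + M)) p a *
     (\<psi> t ^ (M - m + (p - a)) * inverse (deriv l t) ^ (M + p)) * (deriv ^^ a) Q t)"

text \<open>As \<psi>' = - \<psi>^2 and (1 / l')' = 2 \<psi> / l', the derivative of \<psi>^b
  l'^(-c) is (2 c - b) \<psi>^(b + 1) l'^(-c). For b = M - m + p - a and c = M + p the factor is m +
  M + p + a, as in the recursion of \<open>moebius_coeff\<close>.\<close>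

lemma DERIV_transvection:
  assumes Q: "smooth_on I Q" and t: "t \<in> I" and mM: "m \<le> M"
  shows "(transvection Q m M p has_real_derivative deriv l t * transvection Q m M (Suc p) t) (at t)"
proof -
  let ?u = "\<lambda>t. inverse (deriv l t)" and ?e = "moebius_coeff (real (m + M))"
  have nz: "deriv l t \<noteq> 0" using t by (rule deriv_l_nonzero)
  have inv: "?u t ^ (M + p) = deriv l t * ?u t ^ (M + Suc p)" using nz by simp
  have u: "(?u has_real_derivative 2 * \<psi> t * ?u t) (at t)"
    by (rule DERIV_cong[OF DERIV_inverse'[OF smooth_on_DERIV[OF smooth_on_deriv[OF open_I smooth_l] t] nz]])
       (use nz in \<open>simp add: deriv2_l[OF t] field_simps\<close>)
  have \<psi>: "(\<psi> has_real_derivative - (\<psi> t)\<^sup>2) (at t)"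
    using smooth_on_DERIV[OF smooth_\<psi> t] deriv_\<psi>[OF t] by simp
  have powers: "((\<lambda>t. \<psi> t ^ b * ?u t ^ c) has_real_derivative (2 * real c - real b) * (\<psi> t ^ Suc b * ?u t ^ c)) (at t)" for b c
  proof (rule DERIV_cong[OF DERIV_mult[OF DERIV_power[OF \<psi>] DERIV_power[OF u]]])
    have 1: "real b * (- (\<psi> t)\<^sup>2 * \<psi> t ^ (b - Suc 0)) = - real b * \<psi> t ^ Suc b"
      by (cases b) (auto simp: power2_eq_square algebra_simps)
    have 2: "real c * (2 * \<psi> t * ?u t * ?u t ^ (c - Suc 0)) = 2 * real c * \<psi> t * ?u t ^ c"
      by (cases c) auto
    show "real b * (- (\<psi> t)\<^sup>2 * \<psi> t ^ (b - Suc 0)) * ?u t ^ c + real c * (2 * \<psi> t * ?u t * ?u t ^ (c - Suc 0)) * \<psi> t ^ b =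
        (2 * real c - real b) * (\<psi> t ^ Suc b * ?u t ^ c)"
      unfolding 1 2 by (simp add: algebra_simps)
  qed
  let ?X = "\<lambda>b. \<psi> t ^ (M - m + b) * ?u t ^ (M + p)"
  have "(transvection Q m M p has_real_derivative
     (\<Sum>a\<le>p. ?e p a * ((2 * real (M + p) - real (M - m + (p - a))) * (\<psi> t ^ Suc (M - m + (p - a)) * ?u t ^ (M + p))) * (deriv ^^ a) Q t +
       (deriv ^^ Suc a) Q t * (?e p a * ?X (p - a)))) (at t)"
    unfolding transvection_def[abs_def]
    by (intro DERIV_sum DERIV_mult DERIV_cmult powers smooth_on_DERIV_funpow[OF open_I Q t])
  also have "(\<Sum>a\<le>p. ?e p a * ((2 * real (M + p) - real (M - m + (p - a))) * (\<psi> t ^ Suc (M - m + (p - a)) * ?u t ^ (M + p))) * (deriv ^^ a) Q t +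
       (deriv ^^ Suc a) Q t * (?e p a * ?X (p - a))) =
     (\<Sum>a\<le>p. (real (m + M) + real p + real a) * ?e p a * ?X (Suc p - a) * (deriv ^^ a) Q t +
       ?e p a * ?X (Suc p - Suc a) * (deriv ^^ Suc a) Q t)" (is "?l = _")
  proof (rule sum.cong)
    fix a assume "a \<in> {..p}"
    then have a: "Suc (M - m + (p - a)) = M - m + (Suc p - a)"
      "2 * real (M + p) - real (M - m + (p - a)) = real (m + M) + real p + real a"
      using mM by (auto simp: of_nat_diff)
    show "?e p a * ((2 * real (M + p) - real (M - m + (p - a))) * (\<psi> t ^ Suc (M - m + (p - a)) * ?u t ^ (M + p))) * (deriv ^^ a) Q t +
       (deriv ^^ Suc a) Q t * (?e p a * ?X (p - a)) =
      (real (m + M) + real p + real a) * ?e p a * ?X (Suc p - a) * (deriv ^^ a) Q t +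
      ?e p a * ?X (Suc p - Suc a) * (deriv ^^ Suc a) Q t"
      unfolding a diff_Suc_Suc by (simp only: mult_ac)
  qed simp
  also have "\<dots> = (\<Sum>a\<le>Suc p. (real (m + M) + real p + real a) * ?e p a * ?X (Suc p - a) * (deriv ^^ a) Q t) +
     (\<Sum>a\<le>p. ?e p a * ?X (Suc p - Suc a) * (deriv ^^ Suc a) Q t)"
    by (simp add: sum.distrib moebius_coeff_eq_0)
  also have "(\<Sum>a\<le>p. ?e p a * ?X (Suc p - Suc a) * (deriv ^^ Suc a) Q t) =
     (\<Sum>a\<le>Suc p. (if a = 0 then 0 else ?e p (a - 1)) * ?X (Suc p - a) * (deriv ^^ a) Q t)"
    by (subst sum.atMost_Suc_shift) simp
  also have "(\<Sum>a\<le>Suc p. (real (m + M) + real p + real a) * ?e p a * ?X (Suc p - a) * (deriv ^^ a) Q t) + \<dots> =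
     deriv l t * transvection Q m M (Suc p) t"
    unfolding transvection_def sum_distrib_left sum.distrib[symmetric]
    unfolding inv moebius_coeff.simps by (intro sum.cong refl) (simp only: distrib_right distrib_left mult_ac)
  finally show ?thesis .
qed

lemma funpow_deriv_transvection:
  assumes Q: "\<And>m. m \<in> {3..M} \<Longrightarrow> smooth_on I (Q m)" and Q': "smooth_on (l ` I) Q'"
    and rel: "\<And>t. t \<in> I \<Longrightarrow> deriv l t ^ M * Q' (l t) =
      (\<Sum>m=3..M. real ((M - 1) choose (m - 1)) * \<psi> t ^ (M - m) * Q m t)"
  shows "t \<in> I \<Longrightarrow> (deriv ^^ p) Q' (l t) =
    (\<Sum>m=3..M. real ((M - 1) choose (m - 1)) * transvection (Q m) m M p t)"
proof (induction p arbitrary: t)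
  case 0
  have "Q' (l t) = inverse (deriv l t) ^ M * (deriv l t ^ M * Q' (l t))"
    using deriv_l_nonzero[OF 0] by (simp add: field_simps)
  then show ?case
    unfolding rel[OF 0] sum_distrib_left by (simp add: transvection_def mult_ac)
next
  case (Suc p)
  have "((\<lambda>t. (deriv ^^ p) Q' (l t)) has_real_derivative (deriv ^^ Suc p) Q' (l t) * deriv l t) (at t)"
    by (rule DERIV_chain2[OF smooth_on_DERIV_funpow[OF open_image Q'] smooth_on_DERIV[OF smooth_l Suc.prems]])
       (use Suc.prems in auto)
  from DERIV_imp_deriv[OF this]
  have "(deriv ^^ Suc p) Q' (l t) * deriv l t = deriv (\<lambda>t. (deriv ^^ p) Q' (l t)) t" by (rule sym)
  also have "\<dots> = deriv (\<lambda>t. \<Sum>m=3..M. real ((M - 1) choose (m - 1)) * transvection (Q m) m M p t) t"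
    by (rule deriv_cong_open[OF open_I Suc.prems Suc.IH])
  also have "\<dots> = (\<Sum>m=3..M. real ((M - 1) choose (m - 1)) * (deriv l t * transvection (Q m) m M (Suc p) t))"
    using Suc.prems Q by (intro DERIV_imp_deriv DERIV_sum DERIV_cmult DERIV_transvection) auto
  also have "\<dots> = (\<Sum>m=3..M. real ((M - 1) choose (m - 1)) * transvection (Q m) m M (Suc p) t) * deriv l t"
    unfolding sum_distrib_right by (simp only: mult_ac)
  finally show ?case using deriv_l_nonzero[OF Suc.prems] by (simp only: mult_cancel_right) blast
qed

text \<open>Expanded in the products \<psi>^(k - m - a) Q_m^(a), the left-hand side has the
  coefficients of \<open>theta_weight_sum\<close>, so only the terms a = k - m, free of \<psi>,
  remain.\<close>

lemma theta_transform:
  assumes Q: "\<And>m. m \<in> {3..k} \<Longrightarrow> smooth_on I (Q m)" and Q': "\<And>m. m \<in> {3..k} \<Longrightarrow> smooth_on (l ` I) (Q' m)"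
    and rel: "\<And>M t. M \<in> {3..k} \<Longrightarrow> t \<in> I \<Longrightarrow> deriv l t ^ M * Q' M (l t) =
      (\<Sum>m=3..M. real ((M - 1) choose (m - 1)) * \<psi> t ^ (M - m) * Q m t)"
    and t: "t \<in> I"
  shows "deriv l t ^ k * (\<Sum>m=3..k. theta_weight k m * (deriv ^^ (k - m)) (Q' m) (l t)) =
    (\<Sum>m=3..k. theta_weight k m * (deriv ^^ (k - m)) (Q m) t)"
proof -
  let ?e = "\<lambda>m M. moebius_coeff (real (m + M)) (k - M)"
  let ?g = "\<lambda>M m. (\<Sum>a\<le>k - m. theta_weight k M * real ((M - 1) choose (m - 1)) * ?e m M a *
      (\<psi> t ^ (k - m - a) * (deriv ^^ a) (Q m) t))"
  have trans: "deriv l t ^ k * transvection (Q m) m M (k - M) t =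
      (\<Sum>a\<le>k - m. ?e m M a * (\<psi> t ^ (k - m - a) * (deriv ^^ a) (Q m) t))"
    if "m \<in> {3..M}" "M \<in> {3..k}" for m M
  proof -
    have "deriv l t ^ k * transvection (Q m) m M (k - M) t =
        (\<Sum>a\<le>k - M. ?e m M a * (\<psi> t ^ (k - m - a) * (deriv ^^ a) (Q m) t))"
      unfolding transvection_def sum_distrib_left
    proof (rule sum.cong)
      fix a assume "a \<in> {..k - M}"
      then have "M - m + (k - M - a) = k - m - a" "M + (k - M) = k" using that by auto
      then show "deriv l t ^ k * (?e m M a * (\<psi> t ^ (M - m + (k - M - a)) * inverse (deriv l t) ^ (M + (k - M))) * (deriv ^^ a) (Q m) t) =
          ?e m M a * (\<psi> t ^ (k - m - a) * (deriv ^^ a) (Q m) t)"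
        using deriv_l_nonzero[OF t] by (simp add: field_simps)
    qed simp
    \<comment> \<open>The added terms are 0, and the range no longer depends on \<open>M\<close>, so
      the sums over \<open>a\<close> and \<open>M\<close> can be interchanged.\<close>
    also have "\<dots> = (\<Sum>a\<le>k - m. ?e m M a * (\<psi> t ^ (k - m - a) * (deriv ^^ a) (Q m) t))"
      using that by (intro sum.mono_neutral_left) (auto simp: moebius_coeff_eq_0)
    finally show ?thesis .
  qed
  have "deriv l t ^ k * (\<Sum>M=3..k. theta_weight k M * (deriv ^^ (k - M)) (Q' M) (l t)) =
      (\<Sum>M=3..k. \<Sum>m=3..M. theta_weight k M * real ((M - 1) choose (m - 1)) * (deriv l t ^ k * transvection (Q m) m M (k - M) t))"
    unfolding sum_distrib_left
  proof (rule sum.cong)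
    fix M assume M: "M \<in> {3..k}"
    have "(deriv ^^ (k - M)) (Q' M) (l t) = (\<Sum>m=3..M. real ((M - 1) choose (m - 1)) * transvection (Q m) m M (k - M) t)"
      using M by (intro funpow_deriv_transvection Q Q' rel t) auto
    then show "deriv l t ^ k * (theta_weight k M * (deriv ^^ (k - M)) (Q' M) (l t)) =
      (\<Sum>m=3..M. theta_weight k M * real ((M - 1) choose (m - 1)) * (deriv l t ^ k * transvection (Q m) m M (k - M) t))"
      by (simp only: sum_distrib_left mult_ac)
  qed simp
  also have "\<dots> = (\<Sum>M=3..k. \<Sum>m=3..M. ?g M m)"
    by (intro sum.cong refl) (simp only: trans sum_distrib_left mult_ac)
  also have "\<dots> = (\<Sum>M=3..k. \<Sum>m\<in>{m\<in>{3..k}. m \<le> M}. ?g M m)"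
    by (intro sum.cong) auto
  also have "\<dots> = (\<Sum>m=3..k. \<Sum>M\<in>{M\<in>{3..k}. m \<le> M}. ?g M m)"
    by (rule sum.swap_restrict) auto
  also have "\<dots> = (\<Sum>m=3..k. \<Sum>M=m..k. ?g M m)"
    by (intro sum.cong) auto
  also have "\<dots> = (\<Sum>m=3..k. \<Sum>a\<le>k - m. (\<Sum>M=m..k. theta_weight k M * real ((M - 1) choose (m - 1)) * ?e m M a) *
      (\<psi> t ^ (k - m - a) * (deriv ^^ a) (Q m) t))"
  proof (rule sum.cong)
    fix m
    show "(\<Sum>M=m..k. ?g M m) = (\<Sum>a\<le>k - m. (\<Sum>M=m..k. theta_weight k M * real ((M - 1) choose (m - 1)) * ?e m M a) *
      (\<psi> t ^ (k - m - a) * (deriv ^^ a) (Q m) t))"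
      unfolding sum_distrib_right by (rule sum.swap)
  qed simp
  also have "\<dots> = (\<Sum>m=3..k. \<Sum>a\<le>k - m. if a = k - m then theta_weight k m * (deriv ^^ (k - m)) (Q m) t else 0)"
  proof (intro sum.cong refl)
    fix m a assume "m \<in> {3..k}" "a \<in> {..k - m}"
    then have ma: "3 \<le> m" "m + a \<le> k" by auto
    show "(\<Sum>M=m..k. theta_weight k M * real ((M - 1) choose (m - 1)) * ?e m M a) * (\<psi> t ^ (k - m - a) * (deriv ^^ a) (Q m) t) =
        (if a = k - m then theta_weight k m * (deriv ^^ (k - m)) (Q m) t else 0)"
      unfolding theta_weight_sum[OF ma] using ma by auto
  qed
  finally show ?thesis by simp
qed

end

section \<open>Transformations between Laguerre-Forsyth forms\<close>

context pullback_parameters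
begin

text \<open>For \<open>\<omega> = 0\<close> and \<open>\<psi>' = - \<psi>\<^sup>2\<close> the function \<open>l\<close> is a Moebius transformation and
  \<open>\<kappa>\<close> a constant multiple of \<open>(l')^(- n / 2)\<close>.\<close>

lemma pull_coeff_moebius:
  assumes \<omega>: "\<And>t. t \<in> I \<Longrightarrow> \<omega> t = 0" and \<psi>': "\<And>t. t \<in> I \<Longrightarrow> deriv \<psi> t = - (\<psi> t)\<^sup>2"
  shows "j \<le> i \<Longrightarrow> t \<in> I \<Longrightarrow> pull_coeff \<kappa> l i j t =
    moebius_coeff (- real n) i j * ((- \<psi> t) ^ (i - j) * (\<kappa> t * deriv l t ^ j))"
proof (induction i arbitrary: j t)
  case (Suc i)
  show ?case
  proof (cases "j = Suc i")
    case True
    then show ?thesis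
      using pull_coeff_diag[of \<kappa> l "Suc i" t] by (simp add: moebius_coeff_closed_form del: pull_coeff.simps moebius_coeff.simps)
  next
    case False
    then have j: "j \<le> i" using Suc.prems by simp
    let ?R = "\<lambda>t. \<kappa> t * deriv l t ^ j"
    have "((\<lambda>t. (- \<psi> t) ^ (i - j)) has_real_derivative real (i - j) * ((\<psi> t)\<^sup>2 * (- \<psi> t) ^ (i - j - Suc 0))) (at t)"
      using DERIV_power[OF DERIV_minus[OF smooth_on_DERIV[OF smooth(3) Suc.prems(2)]], of "i - j"] \<psi>'[OF Suc.prems(2)]
      by simp
    moreover have "real (i - j) * ((\<psi> t)\<^sup>2 * (- \<psi> t) ^ (i - j - Suc 0)) = real (i - j) * (- \<psi> t) ^ Suc (i - j)"
      by (cases "i - j") (auto simp: power2_eq_square)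
    ultimately have D: "((\<lambda>t. (- \<psi> t) ^ (i - j)) has_real_derivative real (i - j) * (- \<psi> t) ^ Suc (i - j)) (at t)" by simp
    have "deriv (pull_coeff \<kappa> l i j) t = deriv (\<lambda>t. moebius_coeff (- real n) i j * ((- \<psi> t) ^ (i - j) * ?R t)) t"
      by (rule deriv_cong_open[OF open_I Suc.prems(2) Suc.IH[OF j]])
    also have "\<dots> = moebius_coeff (- real n) i j *
        (real (i - j) * (- \<psi> t) ^ Suc (i - j) * ?R t + ?R t * (real n * \<psi> t + \<omega> t - 2 * real j * \<psi> t) * (- \<psi> t) ^ (i - j))"
      by (intro DERIV_imp_deriv DERIV_cmult DERIV_mult D DERIV_\<kappa>_power Suc.prems)
    \<comment> \<open>The power of - \<psi> contributes i - j and \<kappa> l'^j contributes 2 j - n,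
      each times - \<psi>. Their sum is the recursion factor of \<open>moebius_coeff\<close> for r =
      - n.\<close>
    also have "\<dots> = (- real n + real i + real j) * moebius_coeff (- real n) i j * ((- \<psi> t) ^ (Suc i - j) * ?R t)"
      using j by (simp add: \<omega>[OF Suc.prems(2)] Suc_diff_le of_nat_diff algebra_simps)
    finally have 1: "deriv (pull_coeff \<kappa> l i j) t =
      (- real n + real i + real j) * moebius_coeff (- real n) i j * ((- \<psi> t) ^ (Suc i - j) * ?R t)" .
    have 2: "(if j = 0 then 0 else deriv l t * pull_coeff \<kappa> l i (j - 1) t) =
      (if j = 0 then 0 else moebius_coeff (- real n) i (j - 1)) * ((- \<psi> t) ^ (Suc i - j) * ?R t)"
    proof (cases j)
      case (Suc b)
      then have "Suc i - j = i - (j - 1)" by simp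
      then show ?thesis using Suc.IH[of "j - 1" t] Suc.prems j Suc by (simp add: mult_ac)
    qed simp
    show ?thesis
      unfolding pull_coeff.simps moebius_coeff.simps 1 2 by (simp only: distrib_right)
  qed
qed simp

end

lemma moebius_coeff_neg:
  assumes "j \<le> i" "i \<le> n"
  shows "moebius_coeff (- real n) i j = (-1) ^ (i - j) * (real (i choose j) * fact (n - j) / fact (n - i))"
proof -
  have e: "- real n + real j = - real (n - j)" "real (n - j) - real (i - j) + 1 = real (Suc (n - i))"
    "n - i + (i - j) = n - j"
    using assms by (simp_all add: of_nat_diff)
  have "pochhammer (- real n + real j) (i - j) = (-1) ^ (i - j) * (fact (n - j) / fact (n - i))"
    unfolding e(1) pochhammer_minus e(2) pochhammer_of_nat_eq_fact e(3) ..
  then show ?thesis using assms by (simp add: moebius_coeff_closed_form)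
qed

text \<open>The Pochhammer product passes through 0. This reflects that y^(n+1) = 0 is invariant
  under Moebius transformations combined with the factor (l')^(- n / 2).\<close>

lemma moebius_coeff_neg_Suc: "j \<le> n \<Longrightarrow> moebius_coeff (- real n) (n + 1) j = 0"
proof -
  assume j: "j \<le> n"
  then have "- real n + real j = - real (n - j)" by (simp add: of_nat_diff)
  then show ?thesis
    using j pochhammer_of_nat_eq_0_lemma[of "n - j" "n + 1 - j", where ?'a = real]
    by (simp add: moebius_coeff_closed_form del: moebius_coeff.simps)
qed

text \<open>Numbering and scaling of the coefficients as for \<^const>\<open>theta_weight\<close>.\<close>

definition scaled_coeff :: "nat \<Rightarrow> (nat \<Rightarrow> real \<Rightarrow> real) \<Rightarrow> nat \<Rightarrow> real \<Rightarrow> real" where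
  "scaled_coeff n q m t = fact (n + 1 - m) * q (n + 1 - m) t"

lemma funpow_deriv_cmult:
  fixes f :: "real \<Rightarrow> real"
  assumes "open S" "smooth_on S f"
  shows "x \<in> S \<Longrightarrow> (deriv ^^ i) (\<lambda>x. c * f x) x = c * (deriv ^^ i) f x"
proof (induction i arbitrary: x)
  case (Suc i)
  have "(deriv ^^ Suc i) (\<lambda>x. c * f x) x = deriv (\<lambda>x. c * (deriv ^^ i) f x) x"
    using deriv_cong_open[OF assms(1) Suc.prems Suc.IH] by simp
  also have "\<dots> = c * (deriv ^^ Suc i) f x"
    by (intro DERIV_imp_deriv DERIV_cmult smooth_on_DERIV_funpow[OF assms Suc.prems])
  finally show ?case .
qed simp

text \<open>The substitution m = k - j + 1 turns the order j - 1 into k - m and the index n + j - k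
  into n + 1 - m; the factorial of that index moves into \<open>scaled_coeff\<close>.\<close>

lemma theta_lf_eq:
  assumes k: "3 \<le> k" "k \<le> n + 1" and S: "open S" "s \<in> S" and q: "\<And>i. i \<le> n - 2 \<Longrightarrow> smooth_on S (q i)"
  shows "theta_lf n q k s = (\<Sum>m=3..k. theta_weight k m * (deriv ^^ (k - m)) (scaled_coeff n q m) s)"
proof -
  let ?g = "\<lambda>j. (-1) ^ (j + 1) * (fact (2 * k - j - 1) * fact (n + j - k))
    / (fact (k - j) * fact (j - 1)) * (deriv ^^ (j - 1)) (q (n + j - k)) s"
  have "theta_lf n q k s = (\<Sum>m=3..k. ?g (k - m + 1))"
    unfolding theta_lf_def
  proof (rule sum.reindex_bij_witness[of _ "\<lambda>m. k - m + 1" "\<lambda>j. k - j + 1"])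
    fix j assume "j \<in> {1..k - 2}"
    then show "k - (k - j + 1) + 1 = j" using k by auto
    then show "?g (k - (k - j + 1) + 1) = ?g j" by (simp only:)
  qed (use k in auto)
  also have "\<dots> = (\<Sum>m=3..k. theta_weight k m * (deriv ^^ (k - m)) (scaled_coeff n q m) s)"
  proof (rule sum.cong)
    fix m assume m: "m \<in> {3..k}"
    have e: "2 * k - (k - m + 1) - 1 = k + m - 2" "n + (k - m + 1) - k = n + 1 - m"
      "k - (k - m + 1) = m - 1" "k - m + 1 - 1 = k - m"
      using m k by auto
    have "smooth_on S (q (n + 1 - m))" using m by (intro q) auto
    from funpow_deriv_cmult[OF S(1) this S(2)]
    have d: "(deriv ^^ (k - m)) (scaled_coeff n q m) s = fact (n + 1 - m) * (deriv ^^ (k - m)) (q (n + 1 - m)) s"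
      by (simp add: scaled_coeff_def[abs_def])
    show "?g (k - m + 1) = theta_weight k m * (deriv ^^ (k - m)) (scaled_coeff n q m) s"
      unfolding e d theta_weight_def by simp
  qed simp
  finally show ?thesis .
qed

text \<open>Both equations have coefficient 0 in the orders n and n - 1. The first gives \<omega> =
  0, the second \<psi>' = - \<psi>^2, and what remains is the binomial law for the scaled
  coefficients that \<open>theta_transform\<close> requires.\<close>

theorem theta_lf_invariant:
  assumes n: "n \<ge> 2" and eq: "linear_equiv n (lf_coeffs n q) I l m (lf_coeffs n q')"
    and q: "\<And>i. i \<le> n - 2 \<Longrightarrow> smooth_on I (q i)" and q': "\<And>i. i \<le> n - 2 \<Longrightarrow> smooth_on (l ` I) (q' i)"
    and k: "3 \<le> k" "k \<le> n + 1" and t: "t \<in> I"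
  shows "theta_lf n q k t = deriv l t ^ k * theta_lf n q' k (l t)"
proof -
  define \<kappa> where "\<kappa> t = inverse (m t)" for t
  define \<psi> where "\<psi> t = - (deriv (deriv l) t / (2 * deriv l t))" for t
  define \<omega> where "\<omega> t = deriv \<kappa> t / \<kappa> t - real n * \<psi> t" for t
  have diff: "diffeo I (l ` I) l" and m: "smooth_on I m" "\<And>t. t \<in> I \<Longrightarrow> m t \<noteq> 0"
    and A: "\<And>t j. t \<in> I \<Longrightarrow> j \<le> n \<Longrightarrow> pull_lin n (lf_coeffs n q) \<kappa> l j t =
        pull_lin n (lf_coeffs n q) \<kappa> l (n + 1) t * lf_coeffs n q' j (l t)"
    using eq unfolding linear_equiv_iff \<kappa>_def[abs_def] by auto
  have oI: "open I" "open (l ` I)" and l: "smooth_on I l" using diff by (auto simp: diffeo_def)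
  have l': "deriv l t \<noteq> 0" if "t \<in> I" for t by (rule diffeo_deriv_nonzero[OF diff that])
  have \<kappa>: "smooth_on I \<kappa>" "\<And>t. t \<in> I \<Longrightarrow> \<kappa> t \<noteq> 0"
    unfolding \<kappa>_def[abs_def] using m by (auto intro!: smooth_on_inverse oI)
  have \<psi>: "smooth_on I \<psi>"
    unfolding \<psi>_def[abs_def]
    by (intro smooth_on_minus smooth_on_divide smooth_on_mult smooth_on_const smooth_on_deriv oI l) (simp add: l')
  have \<omega>: "smooth_on I \<omega>"
    unfolding \<omega>_def[abs_def]
    by (intro smooth_on_diff smooth_on_divide smooth_on_mult smooth_on_const smooth_on_deriv oI \<kappa> \<psi>)
  interpret pullback_parameters n I \<kappa> l \<psi> \<omega>
  proof
    show "deriv \<kappa> t = (real n * \<psi> t + \<omega> t) * \<kappa> t" if "t \<in> I" for t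
      using \<kappa>(2)[OF that] by (simp add: \<omega>_def)
    show "deriv (deriv l) t = - 2 * \<psi> t * deriv l t" if "t \<in> I" for t
      using l'[OF that] by (simp add: \<psi>_def)
  qed (use oI \<kappa> l \<psi> \<omega> in auto)
  have \<omega>0: "\<omega> t = 0" if "t \<in> I" for t
  proof -
    have "\<not> n \<le> n - 2" using n by simp
    then have "\<kappa> t * deriv l t ^ n * (real (n + 1) * \<omega> t) = 0"
      using pull_lin_n[OF that, of "lf_coeffs n q"] A[OF that, of n] by (simp add: lf_coeffs_def)
    moreover have "real (n + 1) \<noteq> 0" by simp
    ultimately show ?thesis using l'[OF that] \<kappa>(2)[OF that] by (metis mult_eq_0_iff power_eq_0_iff)
  qed
  have d\<omega>: "deriv \<omega> t = 0" if "t \<in> I" for t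
    using deriv_cong_open[OF oI(1) that, of \<omega> "\<lambda>_. 0"] \<omega>0 by simp
  have \<psi>': "deriv \<psi> t = - (\<psi> t)\<^sup>2" if t: "t \<in> I" for t
  proof -
    obtain b where b: "n = Suc b" "lf_coeffs n q n t = 0" "lf_coeffs n q b t = 0" "lf_coeffs n q' b (l t) = 0"
      using n by (cases n) (auto simp: lf_coeffs_def)
    have "(\<Sum>q\<le>n. second_coeff_term q t) = 0"
      using pull_lin_pred[OF t b(1), of "lf_coeffs n q"] A[OF t, of b] b l'[OF t] \<kappa>(2)[OF t] by simp
    \<comment> \<open>With \<omega> = \<omega>' = 0, \<open>sub_coeff_moment\<close> shows that
      \<psi>^2 and \<psi>' have the same factor, which leaves \<psi>^2 + \<psi>' times a positive
      number.\<close>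
    moreover have "(\<Sum>q\<le>n. second_coeff_term q t) =
        (\<Sum>q\<le>n. (\<psi> t)\<^sup>2 * ((real n - 2 * (real q - 1)) * sub_coeff n q) + deriv \<psi> t * sub_coeff n q)"
      unfolding second_coeff_term_def \<omega>0[OF t] d\<omega>[OF t] by (simp add: power2_eq_square algebra_simps)
    moreover have "\<dots> = (\<psi> t)\<^sup>2 * sub_coeff_sum n + deriv \<psi> t * sub_coeff_sum n"
      unfolding sum.distrib sum_distrib_left[symmetric] sub_coeff_moment by (simp add: sub_coeff_sum_def)
    moreover have "sub_coeff_sum n > 0" using n by (intro sub_coeff_sum_pos) simp
    ultimately have "((\<psi> t)\<^sup>2 + deriv \<psi> t) * sub_coeff_sum n = 0" "sub_coeff_sum n \<noteq> 0"
      by (simp_all add: algebra_simps)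
    then show ?thesis by simp
  qed
  interpret projective_parameter I l \<psi>
    using oI l \<psi> l' deriv_l \<psi>' by unfold_locales auto
  have rel: "deriv l t ^ M * scaled_coeff n q' M (l t) =
      (\<Sum>m=3..M. real ((M - 1) choose (m - 1)) * \<psi> t ^ (M - m) * scaled_coeff n q m t)"
    if M: "M \<in> {3..k}" and t: "t \<in> I" for M t
  proof -
    define j where "j = n + 1 - M"
    have j: "j \<le> n - 2" "j \<le> n" "M = n + 1 - j" "n + 1 = M + j" using M k n by (auto simp: j_def)
    \<comment> \<open>The leading term contributes nothing, by
      \<open>moebius_coeff_neg_Suc\<close>.\<close>
    have "pull_lin n (lf_coeffs n q) \<kappa> l j t =
        (\<Sum>i\<le>n. lf_coeffs n q i t * pull_coeff \<kappa> l i j t)"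
      using pull_coeff_moebius[OF \<omega>0 \<psi>', of j "n + 1" t] moebius_coeff_neg_Suc[of j n] j t
      by (simp add: pull_lin_def del: pull_coeff.simps moebius_coeff.simps)
    also have "\<dots> = (\<Sum>i=j..n - 2. q i t * pull_coeff \<kappa> l i j t)"
      using n by (intro sum.mono_neutral_cong_right) (auto simp: pull_coeff_eq_0 lf_coeffs_def not_le)
    also have "\<dots> = (\<Sum>i=j..n - 2. \<kappa> t * deriv l t ^ j *
        (q i t * (real (i choose j) * fact (n - j) / fact (n - i)) * \<psi> t ^ (i - j)))"
    proof (rule sum.cong)
      fix i assume i: "i \<in> {j..n - 2}"
      have sgn: "(-1) ^ (i - j) * (- \<psi> t) ^ (i - j) = \<psi> t ^ (i - j)"
        by (simp flip: power_mult_distrib)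
      have "pull_coeff \<kappa> l i j t = ((-1) ^ (i - j) * (- \<psi> t) ^ (i - j)) *
          (real (i choose j) * fact (n - j) / fact (n - i)) * (\<kappa> t * deriv l t ^ j)"
        using i n by (subst pull_coeff_moebius[OF \<omega>0 \<psi>' _ t]) (auto simp: moebius_coeff_neg)
      then show "q i t * pull_coeff \<kappa> l i j t = \<kappa> t * deriv l t ^ j *
        (q i t * (real (i choose j) * fact (n - j) / fact (n - i)) * \<psi> t ^ (i - j))"
        unfolding sgn by simp
    qed simp
    finally have "\<kappa> t * deriv l t ^ (n + 1) * q' j (l t) = \<kappa> t * deriv l t ^ j *
        (\<Sum>i=j..n - 2. q i t * (real (i choose j) * fact (n - j) / fact (n - i)) * \<psi> t ^ (i - j))"
      using A[OF t j(2)] j(1) unfolding pull_lin_top sum_distrib_left by (simp add: lf_coeffs_def)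
    then have e: "deriv l t ^ M * q' j (l t) =
        (\<Sum>i=j..n - 2. q i t * (real (i choose j) * fact (n - j) / fact (n - i)) * \<psi> t ^ (i - j))"
      using \<kappa>(2)[OF t] l'[OF t] unfolding j(4) by (simp add: power_add)
    have "deriv l t ^ M * scaled_coeff n q' M (l t) = fact j * (deriv l t ^ M * q' j (l t))"
      by (simp add: scaled_coeff_def j_def)
    also have "\<dots> =
        (\<Sum>i=j..n - 2. fact j * (q i t * (real (i choose j) * fact (n - j) / fact (n - i)) * \<psi> t ^ (i - j)))"
      unfolding e by (rule sum_distrib_left)
    also have "\<dots> = (\<Sum>m=3..M. real ((M - 1) choose (m - 1)) * \<psi> t ^ (M - m) * scaled_coeff n q m t)"
    proof (rule sum.reindex_bij_witness[of _ "\<lambda>m. n + 1 - m" "\<lambda>i. n + 1 - i"])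
      fix i assume i: "i \<in> {j..n - 2}"
      have e: "M - 1 = n - j" "n + 1 - i - 1 = n - i" "M - (n + 1 - i) = i - j" "n + 1 - (n + 1 - i) = i"
        using i j n by auto
      have c: "real ((n - j) choose (n - i)) = fact (n - j) / (fact (n - i) * fact (i - j))"
        using i n by (subst binomial_fact[where ?'a = real]) auto
      have c': "real (i choose j) = fact i / (fact j * fact (i - j))"
        using i by (subst binomial_fact[where ?'a = real]) auto
      show "real ((M - 1) choose (n + 1 - i - 1)) * \<psi> t ^ (M - (n + 1 - i)) * scaled_coeff n q (n + 1 - i) t =
          fact j * (q i t * (real (i choose j) * fact (n - j) / fact (n - i)) * \<psi> t ^ (i - j))"
        unfolding scaled_coeff_def e c c' by (simp add: mult_ac)
    qed (use j n in auto)
    finally show ?thesis .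
  qed
  have sm: "smooth_on I (scaled_coeff n q m)" "smooth_on (l ` I) (scaled_coeff n q' m)" if "m \<in> {3..k}" for m
    unfolding scaled_coeff_def[abs_def] using that q q'
    by (auto intro!: smooth_on_mult smooth_on_const oI)
  have "theta_lf n q k t = (\<Sum>m=3..k. theta_weight k m * (deriv ^^ (k - m)) (scaled_coeff n q m) t)"
    by (rule theta_lf_eq[OF k oI(1) t]) (rule q)
  also have "\<dots> = deriv l t ^ k * (\<Sum>m=3..k. theta_weight k m * (deriv ^^ (k - m)) (scaled_coeff n q' m) (l t))"
    by (rule theta_transform[OF sm rel t, symmetric])
  also have "(\<Sum>m=3..k. theta_weight k m * (deriv ^^ (k - m)) (scaled_coeff n q' m) (l t)) = theta_lf n q' k (l t)"
    by (rule theta_lf_eq[OF k oI(2) imageI[OF t], symmetric]) (rule q')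
  finally show ?thesis .
qed

section \<open>Wilczynski's invariant as a relation: uniqueness, existence, covariance\<close>

definition theta_value :: "nat \<Rightarrow> (nat \<Rightarrow> real \<Rightarrow> real) \<Rightarrow> nat \<Rightarrow> real \<Rightarrow> real \<Rightarrow> bool" where
  "theta_value n p k x v \<longleftrightarrow>
     (\<exists>I l m q. x \<in> I \<and> brings_to_lf n p I l m q \<and> v = deriv l x ^ k * theta_lf n q k (l x))"

text \<open>Inverting one transformation and following it by the other leads, over the common
  interval, from one Laguerre-Forsyth form to another, where \<open>theta_lf_invariant\<close>
  applies. The chain rule for the transition matches the factors.\<close>

theorem theta_value_unique:
  assumes n: "n \<ge> 2" and k: "3 \<le> k" "k \<le> n + 1" and v: "theta_value n p k x v" and v': "theta_value n p k x v'"
  shows "v = v'"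
proof -
  obtain I l m q where 1: "x \<in> I" "brings_to_lf n p I l m q" "v = deriv l x ^ k * theta_lf n q k (l x)"
    using v unfolding theta_value_def by blast
  obtain I' l' m' q' where 2: "x \<in> I'" "brings_to_lf n p I' l' m' q'" "v' = deriv l' x ^ k * theta_lf n q' k (l' x)"
    using v' unfolding theta_value_def by blast
  define J where "J = I \<inter> I'"
  have J: "x \<in> J" "open_interval J"
    using 1 2 by (auto simp: J_def brings_to_lf_def intro: open_interval_inter)
  have e: "linear_equiv n p J l m (lf_coeffs n q)" "linear_equiv n p J l' m' (lf_coeffs n q')"
    using 1(2) 2(2) J unfolding brings_to_lf_iff[OF n] by (auto simp: J_def intro: linear_equiv_restrict)
  let ?g = "the_inv_into J l"
  have dl: "diffeo J (l ` J) l" "diffeo J (l' ` J) l'" using e by (auto simp: linear_equiv_def)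
  have g: "?g ` (l ` J) = J" "\<And>t. t \<in> J \<Longrightarrow> ?g (l t) = t" "smooth_on (l ` J) ?g"
    using diffeo_inv_eq[OF dl(1)] diffeo_inverse[OF dl(1)] by (auto simp: image_image diffeo_def)
  have "linear_equiv n (lf_coeffs n q) (l ` J) (\<lambda>s. l' (?g s)) (\<lambda>s. m' (?g s) * inverse (m (?g s))) (lf_coeffs n q')"
    using linear_equiv_compose[OF linear_equiv_inverse[OF e(1)], of l' m'] e(2) g(1) by simp
  moreover have im: "(\<lambda>s. l' (?g s)) ` (l ` J) = l' ` J" using g(2) by force
  moreover have "smooth_on (l ` J) (q i)" "smooth_on (l' ` J) (q' i)" if "i \<le> n - 2" for i
  proof -
    have "smooth_on (l ` I) (q i)" "smooth_on (l' ` I') (q' i)"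
      using 1(2) 2(2) that unfolding brings_to_lf_def by auto
    then show "smooth_on (l ` J) (q i)" "smooth_on (l' ` J) (q' i)"
      by (auto simp: J_def elim!: smooth_on_subset)
  qed
  ultimately have "theta_lf n q k (l x) = deriv (\<lambda>s. l' (?g s)) (l x) ^ k * theta_lf n q' k (l' (?g (l x)))"
    using J(1) by (intro theta_lf_invariant[OF n _ _ _ k]) auto
  moreover have "deriv (\<lambda>s. l' (?g s)) (l x) * deriv l x = deriv l' x"
  proof -
    have "deriv l' x = deriv (\<lambda>t. l' (?g (l t))) x"
      by (rule deriv_cong_open[of J]) (use J g in \<open>auto simp: open_interval_def\<close>)
    also have "\<dots> = deriv (\<lambda>s. l' (?g s)) (l x) * deriv l x"
      by (rule deriv_diffeo_compose[of J l "l ` J"])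
         (use dl J g in \<open>auto simp: diffeo_def intro!: smooth_on_compose[of _ ?g J l']\<close>)
    finally show ?thesis by simp
  qed
  ultimately show ?thesis
    using J(1) g(2) 1(3) 2(3) by (simp flip: power_mult_distrib add: mult_ac)
qed

lemma wilczynski_theta_eqI:
  assumes "n \<ge> 2" "3 \<le> k" "k \<le> n + 1" "theta_value n p k x v"
  shows "wilczynski_theta n p k x = v"
  unfolding wilczynski_theta_def theta_value_def[symmetric]
  using assms theta_value_unique by (intro the_equality) blast+

lemma theta_value_wilczynski_theta:
  assumes "n \<ge> 2" "3 \<le> k" "k \<le> n + 1" "open_interval N" "x \<in> N" "\<And>i. i \<le> n \<Longrightarrow> smooth_on N (p i)"
  shows "theta_value n p k x (wilczynski_theta n p k x)"
proof -
  obtain I l m q where "x \<in> I" "brings_to_lf n p I l m q"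
    using laguerre_forsyth_exists[of n N x p, OF assms(1,4,5) assms(6)] by blast
  then have v: "theta_value n p k x (deriv l x ^ k * theta_lf n q k (l x))"
    unfolding theta_value_def by (intro exI conjI) (assumption | rule refl)+
  then show ?thesis by (simp only: wilczynski_theta_eqI[OF assms(1-3) v])
qed

lemma brings_to_lf_restrict:
  "n \<ge> 2 \<Longrightarrow> brings_to_lf n p I l m q \<Longrightarrow> open_interval J \<Longrightarrow> J \<subseteq> I \<Longrightarrow> brings_to_lf n p J l m q"
  by (auto simp: brings_to_lf_iff intro: linear_equiv_restrict smooth_on_subset)

text \<open>The value depends only on the coefficients near \<open>x\<close>, because a
  transformation to Laguerre-Forsyth form can be restricted. Solutions are compared only near a
  point, so this locality is essential.\<close>

lemma theta_value_cong:
  assumes n: "n \<ge> 2" and N: "open_interval N" "x \<in> N" and p: "\<And>i t. i \<le> n \<Longrightarrow> t \<in> N \<Longrightarrow> p i t = p' i t"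
    and v: "theta_value n p k x v"
  shows "theta_value n p' k x v"
proof -
  obtain I l m q where *: "x \<in> I" "brings_to_lf n p I l m q" "v = deriv l x ^ k * theta_lf n q k (l x)"
    using v unfolding theta_value_def by blast
  have "open_interval I" using *(2) by (simp add: brings_to_lf_def)
  then have "brings_to_lf n p (I \<inter> N) l m q"
    using N by (intro brings_to_lf_restrict[OF n *(2)] open_interval_inter) auto
  moreover have "linear_lhs n p y t = linear_lhs n p' y t" if "t \<in> I \<inter> N" for y t
    unfolding linear_lhs_def using p that by auto
  ultimately have "brings_to_lf n p' (I \<inter> N) l m q"
    unfolding brings_to_lf_def by auto
  then show ?thesis unfolding theta_value_def using * N(2) by blast
qed

text \<open>A transformation between arbitrary linear equations composes with a transformation to
  Laguerre-Forsyth form.\<close>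

theorem theta_value_linear_equiv:
  assumes n: "n \<ge> 2" and eq: "linear_equiv n p I l m p'" and x: "x \<in> I" and v: "theta_value n p' k (l x) v"
  shows "theta_value n p k x (deriv l x ^ k * v)"
proof -
  obtain J l' m' q where J: "l x \<in> J" "brings_to_lf n p' J l' m' q" "v = deriv l' (l x) ^ k * theta_lf n q k (l' (l x))"
    using v unfolding theta_value_def by blast
  let ?g = "the_inv_into I l"
  have dl: "diffeo I (l ` I) l" and I: "open_interval I" using eq by (auto simp: linear_equiv_def)
  \<comment> \<open>The transformations compose only where the range of \<open>l\<close> meets the
    domain of \<open>l'\<close>; \<open>I'\<close> is the preimage of this overlap.\<close>
  define K where "K = J \<inter> l ` I"
  have oJ: "open_interval J" using J(2) by (simp add: brings_to_lf_def)
  have K: "open_interval K" "l x \<in> K"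
    using open_interval_inter[OF oJ open_interval_image[OF I dl]] J(1) x by (auto simp: K_def)
  define I' where "I' = ?g ` K"
  have I': "open_interval I'" "I' \<subseteq> I" "l ` I' = K" "x \<in> I'"
  proof -
    have "diffeo K I' ?g"
      using diffeo_restrict[OF diffeo_inverse[OF dl] K(1)] by (auto simp: K_def I'_def)
    then show "open_interval I'" by (rule open_interval_image[OF K(1)])
    show "I' \<subseteq> I" using diffeo_inv_in[OF dl] by (auto simp: I'_def K_def)
    show "l ` I' = K" using diffeo_eq_inv[OF dl] by (force simp: I'_def K_def image_image)
    show "x \<in> I'" using K(2) diffeo_inv_eq[OF dl x] by (force simp: I'_def)
  qed
  have JK: "brings_to_lf n p' K l' m' q" by (rule brings_to_lf_restrict[OF n J(2) K(1)]) (simp add: K_def)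
  have "linear_equiv n p I' (\<lambda>t. l' (l t)) (\<lambda>t. m' (l t) * m t) (lf_coeffs n q)"
    using linear_equiv_compose[OF linear_equiv_restrict[OF eq I'(1,2)], of l' m'] JK I'(3)
    by (simp add: brings_to_lf_iff[OF n])
  moreover have "(\<lambda>t. l' (l t)) ` I' = l' ` K" using I'(3) by (simp add: image_image[of l' l, symmetric])
  ultimately have "brings_to_lf n p I' (\<lambda>t. l' (l t)) (\<lambda>t. m' (l t) * m t) q"
    using JK by (simp add: brings_to_lf_iff[OF n])
  moreover have "deriv (\<lambda>t. l' (l t)) x = deriv l' (l x) * deriv l x"
    by (rule deriv_diffeo_compose[of I l K]) (use dl JK x K(2) in \<open>auto simp: diffeo_def brings_to_lf_def\<close>)
  ultimately show ?thesis
    unfolding theta_value_def using I'(4) J(3)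
    by (intro exI[of _ I'] exI[of _ "\<lambda>t. l' (l t)"] exI conjI) (auto simp: power_mult_distrib)
qed

section \<open>Jet coordinates\<close>

lemma ynum_strict_mono: "i < j \<Longrightarrow> ynum (i :: 'l::{finite,linorder}) < ynum j"
  unfolding ynum_def by (intro psubset_card_mono) auto

lemma inj_ynum: "inj (ynum :: 'l::{finite,linorder} \<Rightarrow> nat)"
  by (rule injI) (metis linorder_neqE nat_neq_iff ynum_strict_mono)

lemma ynum_less_card: "ynum (i :: 'l::{finite,linorder}) < CARD('l)"
  unfolding ynum_def by (intro psubset_card_mono) auto

lemma range_ynum: "range (ynum :: 'l::{finite,linorder} \<Rightarrow> nat) = {..<CARD('l)}"
  by (rule card_subset_eq) (auto simp: ynum_less_card card_image inj_ynum)

lemma yidx_ynum [simp]: "yidx (ynum i) = (i :: 'l::{finite,linorder})"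
  unfolding yidx_def by (rule inv_f_f[OF inj_ynum])

lemma ynum_yidx [simp]: "k < CARD('l) \<Longrightarrow> ynum (yidx k :: 'l::{finite,linorder}) = k"
  unfolding yidx_def by (rule f_inv_into_f) (simp add: range_ynum)

text \<open>On \<open>'l jet \<times> real\<close> the index \<open>CARD('l)\<close> stands for the last component.\<close>

definition xcoord :: "'l::{finite,linorder} jet \<times> real \<Rightarrow> real" where
  "xcoord p = fst (fst p)"

definition ycoord :: "nat \<Rightarrow> 'l::{finite,linorder} jet \<times> real \<Rightarrow> real" where
  "ycoord i p = (if i < CARD('l) then snd (fst p) $ yidx i else snd p)"

definition jetvec :: "real \<Rightarrow> (nat \<Rightarrow> real) \<Rightarrow> 'l::{finite,linorder} jet \<times> real" where
  "jetvec a b = ((a, \<chi> i. b (ynum i)), b (CARD('l)))"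

lemma xcoord_jetvec [simp]: "xcoord (jetvec a b) = a"
  by (simp add: xcoord_def jetvec_def)

lemma ycoord_jetvec [simp]: "i \<le> CARD('l) \<Longrightarrow> ycoord i (jetvec a b :: 'l::{finite,linorder} jet \<times> real) = b i"
  by (auto simp: ycoord_def jetvec_def)

lemma jet_eqI:
  fixes p q :: "'l::{finite,linorder} jet \<times> real"
  assumes "xcoord p = xcoord q" "\<And>i. i \<le> CARD('l) \<Longrightarrow> ycoord i p = ycoord i q"
  shows "p = q"
proof -
  have "snd (fst p) $ i = snd (fst q) $ i" for i
    using assms(2)[of "ynum i"] ynum_less_card[of i] by (simp add: ycoord_def)
  moreover have "snd p = snd q" using assms(2)[of "CARD('l)"] by (simp add: ycoord_def)
  ultimately show ?thesis using assms(1) by (simp add: prod_eq_iff vec_eq_iff xcoord_def)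
qed

lemma bounded_linear_xcoord: "bounded_linear xcoord"
  unfolding xcoord_def[abs_def]
  by (intro bounded_linear_compose[OF bounded_linear_fst] bounded_linear_fst)

lemma bounded_linear_ycoord: "bounded_linear (ycoord i)"
proof (cases "i < CARD('a)")
  case True
  then show ?thesis unfolding ycoord_def[abs_def]
    by (simp add: bounded_linear_compose[OF bounded_linear_vec_nth]
        bounded_linear_compose[OF bounded_linear_snd] bounded_linear_fst)
next
  case False
  then show ?thesis unfolding ycoord_def[abs_def] by (simp add: bounded_linear_snd)
qed

lemmas linear_xcoord = bounded_linear.linear[OF bounded_linear_xcoord]
  and linear_ycoord = bounded_linear.linear[OF bounded_linear_ycoord]

lemmas xcoord_simps [simp] = linear_add[OF linear_xcoord] linear_diff[OF linear_xcoord]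
    linear_scale[OF linear_xcoord] linear_0[OF linear_xcoord] linear_sum[OF linear_xcoord]
  and ycoord_simps [simp] = linear_add[OF linear_ycoord] linear_diff[OF linear_ycoord]
    linear_scale[OF linear_ycoord] linear_0[OF linear_ycoord] linear_sum[OF linear_ycoord]

definition yvec :: "nat \<Rightarrow> 'l::{finite,linorder} jet \<times> real" where
  "yvec j = jetvec 0 (\<lambda>i. if i = j then 1 else 0)"

lemma jetvec_sum:
  "(jetvec a b :: 'l::{finite,linorder} jet \<times> real) = a *\<^sub>R jetvec 1 (\<lambda>i. 0) + (\<Sum>j\<le>CARD('l). b j *\<^sub>R yvec j)"
  by (rule jet_eqI) (auto simp: yvec_def mult_delta_right sum.delta')

lemma vertical_sum:
  fixes v :: "'l::{finite,linorder} jet \<times> real"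
  assumes "xcoord v = 0"
  shows "v = (\<Sum>j\<le>CARD('l). ycoord j v *\<^sub>R yvec j)"
  by (rule jet_eqI) (use assms in \<open>auto simp: yvec_def mult_delta_right sum.delta'\<close>)

lemma has_vector_derivative_jetvec:
  assumes "(a has_real_derivative a') (at t)" "\<And>i. ((\<lambda>t. b t i) has_real_derivative b' i) (at t)"
  shows "((\<lambda>t. jetvec (a t) (b t) :: 'l::{finite,linorder} jet \<times> real) has_vector_derivative jetvec a' b') (at t)"
proof -
  have "((\<lambda>t. a t *\<^sub>R jetvec 1 (\<lambda>i. 0) + (\<Sum>j\<le>CARD('l). b t j *\<^sub>R (yvec j :: 'l jet \<times> real))) has_vector_derivative
      a' *\<^sub>R jetvec 1 (\<lambda>i. 0) + (\<Sum>j\<le>CARD('l). b' j *\<^sub>R yvec j)) (at t)"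
    using assms unfolding has_real_derivative_iff_has_vector_derivative
    by (intro has_vector_derivative_add has_vector_derivative_sum
        bounded_linear.has_vector_derivative[OF bounded_linear_scaleR_left])
  then show ?thesis by (simp only: jetvec_sum[symmetric])
qed

lemma smooth_on_jetvec:
  assumes "open I" "smooth_on I a" "\<And>i. smooth_on I (\<lambda>t. b t i)"
  shows "smooth_on I (\<lambda>t. jetvec (a t) (b t) :: 'l::{finite,linorder} jet \<times> real)"
  unfolding jetvec_def using assms by (intro smooth_on_Pair smooth_on_vec_lambda)

text \<open>The lift of a curve to \<open>J^(n+1)\<close>, for \<open>CARD('l) = n + 1\<close>.\<close>

definition full_lift :: "(real \<Rightarrow> real) \<Rightarrow> real \<Rightarrow> 'l::{finite,linorder} jet \<times> real" where
  "full_lift y t = jetvec t (\<lambda>i. (deriv ^^ i) y t)"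

lemma full_lift_eq: "(full_lift y t :: 'l::{finite,linorder} jet \<times> real) = (lift_jet y t, (deriv ^^ CARD('l)) y t)"
  by (simp add: full_lift_def jetvec_def lift_jet_def)

lemma full_lift_derivative:
  assumes "open I" "smooth_on I y" "t \<in> I"
  shows "(full_lift y has_vector_derivative jetvec 1 (\<lambda>i. (deriv ^^ Suc i) y t)) (at t)"
  unfolding full_lift_def[abs_def]
  by (intro has_vector_derivative_jetvec DERIV_ident smooth_on_DERIV_funpow[OF assms])

lemma smooth_on_full_lift:
  assumes "open I" "smooth_on I y"
  shows "smooth_on I (full_lift y :: real \<Rightarrow> 'l::{finite,linorder} jet \<times> real)"
  unfolding full_lift_def[abs_def]
  by (intro smooth_on_jetvec smooth_on_ident smooth_on_funpow_deriv assms)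

text \<open>The two generators span the common kernel of the forms dy_i - y_(i+1) dx, i \<le> n. In
  this dual description the contact condition is a set of scalar equations that can be
  differentiated.\<close>

lemma contact_plane_iff:
  fixes p v :: "'l::{finite,linorder} jet \<times> real"
  assumes card: "CARD('l) = n + 1"
  shows "v \<in> contact_plane n p \<longleftrightarrow> (\<forall>i\<le>n. ycoord i v = ycoord (Suc i) p * xcoord v)"
proof -
  obtain u c where p: "p = (u, c)" by fastforce
  let ?b = "jetvec 1 (\<lambda>i. if i \<le> n then ycoord (Suc i) p else 0) :: 'l jet \<times> real"
  have gen: "(((0, 0), 1) :: 'l jet \<times> real) = yvec (n + 1)"
    "(((1, \<chi> i. if ynum i < n then snd u $ yidx (ynum i + 1) else c), 0) :: 'l jet \<times> real) = ?b"
  proof -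
    have "ynum (i :: 'l) \<le> n" "ynum i \<noteq> Suc n" for i using ynum_less_card[of i] card by simp_all
    then show "(((0, 0), 1) :: 'l jet \<times> real) = yvec (n + 1)"
      "(((1, \<chi> i. if ynum i < n then snd u $ yidx (ynum i + 1) else c), 0) :: 'l jet \<times> real) = ?b"
      using card by (auto simp: yvec_def jetvec_def vec_eq_iff p ycoord_def zero_prod_def not_le)
  qed
  have "v \<in> contact_plane n p \<longleftrightarrow> (\<exists>a b. v = a *\<^sub>R yvec (n + 1) + b *\<^sub>R ?b)"
    unfolding contact_plane_def p prod.case gen[unfolded p]
    by (auto simp: span_insert span_singleton algebra_simps)
  also have "\<dots> \<longleftrightarrow> (\<forall>i\<le>n. ycoord i v = ycoord (Suc i) p * xcoord v)"
  proof safe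
    assume *: "\<forall>i\<le>n. ycoord i v = ycoord (Suc i) p * xcoord v"
    have "v = ycoord (n + 1) v *\<^sub>R yvec (n + 1) + xcoord v *\<^sub>R ?b"
      by (rule jet_eqI) (use * card in \<open>auto simp: yvec_def le_Suc_eq\<close>)
    then show "\<exists>a b. v = a *\<^sub>R yvec (n + 1) + b *\<^sub>R ?b" by blast
  qed (use card in \<open>auto simp: yvec_def\<close>)
  finally show ?thesis .
qed


section \<open>Tangent spaces of equations\<close>

lemma mem_equation_iff: "p \<in> equation A f \<longleftrightarrow> fst p \<in> A \<and> snd p = f (fst p)"
  by (cases p) (auto simp: equation_def)

lemma tangent_space_equation:
  fixes f :: "'l::{finite,linorder} jet \<Rightarrow> real"
  assumes A: "open A" and f: "smooth_on A f" and u: "u \<in> A"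
  shows "v \<in> tangent_space (equation A f) (u, f u) \<longleftrightarrow> snd v = fderiv f u (fst v)"
proof
  assume "v \<in> tangent_space (equation A f) (u, f u)"
  then obtain \<gamma> e where e: "e > 0" and \<gamma>: "\<forall>t\<in>{-e<..<e}. \<gamma> t \<in> equation A f" "\<gamma> 0 = (u, f u)"
    and d: "(\<gamma> has_vector_derivative v) (at 0)"
    unfolding tangent_space_def by blast
  have "((\<lambda>t. f (fst (\<gamma> t))) has_vector_derivative fderiv f u (fst v)) (at 0)"
    using has_vector_derivative_chain[OF bounded_linear.has_vector_derivative[OF bounded_linear_fst d] f] u \<gamma>(2) by simp
  then have "((\<lambda>t. snd (\<gamma> t)) has_vector_derivative fderiv f u (fst v)) (at 0)"
    by (rule has_vector_derivative_transform_within_open[where S = "{-e<..<e}"])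
       (use e \<gamma>(1) in \<open>auto simp: mem_equation_iff\<close>)
  then show "snd v = fderiv f u (fst v)"
    using vector_derivative_unique_at bounded_linear.has_vector_derivative[OF bounded_linear_snd d] by blast
next
  assume v: "snd v = fderiv f u (fst v)"
  \<comment> \<open>A tangent vector of a graph is realized by a straight line in the base, lifted
    to the graph.\<close>
  define c where "c t = u + t *\<^sub>R fst v" for t
  have c: "(c has_vector_derivative fst v) (at t)" for t
    unfolding c_def[abs_def] by (auto intro!: derivative_eq_intros)
  have "open (c -` A)"
    using A continuous_on_open_vimage[of UNIV c] c
    by (metis Int_UNIV_right continuous_at_imp_continuous_on has_vector_derivative_continuous open_UNIV)
  moreover have "0 \<in> c -` A" using u by (simp add: c_def)
  ultimately obtain e where e: "e > 0" "ball 0 e \<subseteq> c -` A" using open_contains_ball by blast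
  have cA: "c t \<in> A" if "t \<in> {-e<..<e}" for t
    using that e(2) by (auto simp: dist_real_def abs_if subset_iff split: if_splits)
  have csm: "smooth_on {-e<..<e} c"
    unfolding c_def[abs_def] by (intro smooth_on_intros) auto
  have "((\<lambda>t. (c t, f (c t))) has_vector_derivative (fst v, snd v)) (at 0)"
    unfolding v using has_vector_derivative_chain[OF c f, of 0] cA[of 0] e(1)
    by (intro has_vector_derivative_Pair c) (simp add: c_def)
  moreover have "smooth_on {-e<..<e} (\<lambda>t. (c t, f (c t)))"
    by (intro smooth_on_Pair csm smooth_on_compose[OF _ _ csm f]) (use cA in auto)
  ultimately show "v \<in> tangent_space (equation A f) (u, f u)"
    unfolding tangent_space_def mem_equation_iff using e(1) cA
    by (intro CollectI exI[of _ "\<lambda>t. (c t, f (c t))"] exI[of _ e]) (auto simp: c_def)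
qed

lemma tangent_space_image_subset:
  fixes \<phi> :: "'a::euclidean_space \<Rightarrow> 'b::real_normed_vector"
  assumes U: "open U" and \<phi>: "smooth_on U \<phi>" and img: "\<phi> ` (U \<inter> M) \<subseteq> M'" and p: "p \<in> U"
    and v: "v \<in> tangent_space M p"
  shows "fderiv \<phi> p v \<in> tangent_space M' (\<phi> p)"
proof -
  obtain \<gamma> e where e: "e > 0" and sm: "smooth_on {-e<..<e} \<gamma>"
    and \<gamma>: "\<forall>t\<in>{-e<..<e}. \<gamma> t \<in> M" "\<gamma> 0 = p" and d: "(\<gamma> has_vector_derivative v) (at 0)"
    using v unfolding tangent_space_def by blast
  have "isCont \<gamma> 0" using d by (rule has_vector_derivative_continuous)
  obtain r where r: "r > 0" "ball p r \<subseteq> U" using U p open_contains_ball by blast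
  obtain e' where e': "e' > 0" "\<And>t. dist t 0 < e' \<Longrightarrow> dist (\<gamma> t) p < r"
    using \<open>isCont \<gamma> 0\<close> r(1) \<gamma>(2) unfolding continuous_at_eps_delta by metis
  define d' where "d' = min e e'"
  have d': "d' > 0" using e e' by (simp add: d'_def)
  have in': "t \<in> {-e<..<e}" "\<gamma> t \<in> U" if "t \<in> {-d'<..<d'}" for t
  proof -
    show "t \<in> {-e<..<e}" using that by (auto simp: d'_def)
    have "dist t 0 < e'" using that by (auto simp: d'_def dist_real_def)
    from e'(2)[OF this] show "\<gamma> t \<in> U" using r(2) by (auto simp: dist_commute)
  qed
  have "smooth_on {-d'<..<d'} (\<lambda>t. \<phi> (\<gamma> t))"
    by (rule smooth_on_compose[OF _ _ smooth_on_subset[OF sm] \<phi>]) (use in' in auto)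
  moreover have "((\<lambda>t. \<phi> (\<gamma> t)) has_vector_derivative fderiv \<phi> p v) (at 0)"
    using has_vector_derivative_chain[OF d \<phi>] \<gamma>(2) p by simp
  moreover have "\<forall>t\<in>{-d'<..<d'}. \<phi> (\<gamma> t) \<in> M'" using img in' \<gamma>(1) by blast
  ultimately show ?thesis unfolding tangent_space_def using d' \<gamma>(2) by blast
qed

lemma tangent_space_image:
  fixes \<phi> :: "'a::euclidean_space \<Rightarrow> 'b::euclidean_space"
  assumes \<phi>: "diffeo U V \<phi>" and img: "\<phi> ` (U \<inter> M) = V \<inter> M'" and p: "p \<in> U"
  shows "fderiv \<phi> p ` tangent_space M p = tangent_space M' (\<phi> p)"
proof -
  let ?g = "the_inv_into U \<phi>"
  have g: "diffeo V U ?g" by (rule diffeo_inverse[OF \<phi>])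
  have \<phi>p: "\<phi> p \<in> V" "?g (\<phi> p) = p" using diffeo_image[OF \<phi>] diffeo_inv_eq[OF \<phi> p] p by auto
  have img': "?g ` (V \<inter> M') \<subseteq> M"
    unfolding img[symmetric] using diffeo_inv_eq[OF \<phi>] by auto
  show ?thesis
  proof
    show "fderiv \<phi> p ` tangent_space M p \<subseteq> tangent_space M' (\<phi> p)"
      using tangent_space_image_subset[of U \<phi> M M' p] \<phi> img p by (auto simp: diffeo_def)
    show "tangent_space M' (\<phi> p) \<subseteq> fderiv \<phi> p ` tangent_space M p"
    proof
      fix w assume w: "w \<in> tangent_space M' (\<phi> p)"
      have "fderiv ?g (\<phi> p) w \<in> tangent_space M p"
        using tangent_space_image_subset[of V ?g M' M "\<phi> p" w] g img' \<phi>p w by (auto simp: diffeo_def)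
      moreover have "fderiv \<phi> p (fderiv ?g (\<phi> p) w) = w"
      proof -
        have "fderiv (the_inv_into V ?g) (?g (\<phi> p)) (fderiv ?g (\<phi> p) w) = w"
          by (rule diffeo_derivative_inverse[OF g \<phi>p(1)])
        moreover have "fderiv (the_inv_into V ?g) p = fderiv \<phi> p"
        proof (rule frechet_derivative_cong_open[of U])
          show "the_inv_into V ?g x = \<phi> x" if "x \<in> U" for x
          proof -
            have "the_inv_into V ?g (?g (\<phi> x)) = \<phi> x"
              by (rule diffeo_inv_eq[OF g]) (use that diffeo_image[OF \<phi>] in auto)
            then show ?thesis by (simp add: diffeo_inv_eq[OF \<phi> that])
          qed
        qed (use \<phi> p in \<open>auto simp: diffeo_def\<close>)
        ultimately show ?thesis by (simp add: \<phi>p(2))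
      qed
      ultimately show "w \<in> fderiv \<phi> p ` tangent_space M p" by (metis imageI)
    qed
  qed
qed

section \<open>Lifted solutions\<close>

text \<open>The field D in the coordinates (x, y_0, ..., y_n). Its x-component 1 makes x the time
  along integral curves.\<close>

definition ode_field :: "('l::{finite,linorder} jet \<Rightarrow> real) \<Rightarrow> 'l jet \<Rightarrow> 'l jet" where
  "ode_field f u = (1, \<chi> i. if Suc (ynum i) < CARD('l) then snd u $ yidx (Suc (ynum i)) else f u)"

lemma smooth_on_ode_field:
  assumes "open A" "smooth_on A f"
  shows "smooth_on A (ode_field f)"
  unfolding ode_field_def[abs_def]
proof (intro smooth_on_Pair smooth_on_const smooth_on_vec_lambda assms)
  fix i :: 'a
  show "smooth_on A (\<lambda>u. if Suc (ynum i) < CARD('a) then snd u $ yidx (Suc (ynum i)) else f u)"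
    by (cases "Suc (ynum i) < CARD('a)") (simp_all add: assms smooth_on_vec_nth smooth_on_snd smooth_on_ident)
qed

lemma lift_jet_derivative:
  fixes f :: "'l::{finite,linorder} jet \<Rightarrow> real"
  assumes card: "CARD('l) = n + 1" and y: "solution_on n A f I y" and t: "t \<in> I"
  shows "(lift_jet y has_vector_derivative ode_field f (lift_jet y t)) (at t)"
proof -
  have I: "open I" "smooth_on I y" using y by (auto simp: solution_on_def open_interval_def)
  have "((\<lambda>t. fst (full_lift y t :: 'l jet \<times> real)) has_vector_derivative fst (jetvec 1 (\<lambda>i. (deriv ^^ Suc i) y t) :: 'l jet \<times> real)) (at t)"
    by (rule bounded_linear.has_vector_derivative[OF bounded_linear_fst full_lift_derivative[OF I t]])
  moreover have "fst (jetvec 1 (\<lambda>i. (deriv ^^ Suc i) y t) :: 'l jet \<times> real) = ode_field f (lift_jet y t)"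
  proof -
    have "(deriv ^^ Suc (ynum i)) y t = f (lift_jet y t)" if "\<not> Suc (ynum i) < CARD('l)" for i :: 'l
    proof -
      have "Suc (ynum i) = n + 1" using that ynum_less_card[of i] card by simp
      then show ?thesis using y t unfolding solution_on_def by metis
    qed
    then show ?thesis
      by (auto simp: jetvec_def ode_field_def lift_jet_def vec_eq_iff simp del: funpow.simps)
  qed
  ultimately show ?thesis by (simp add: full_lift_eq)
qed

text \<open>The solution is the y_0-component of an integral curve of D; the shape of D forces the
  other coordinates to be its derivatives.\<close>

lemma solution_exists:
  fixes f :: "'l::{finite,linorder} jet \<Rightarrow> real"
  assumes card: "CARD('l) = n + 1" and A: "open A" "smooth_on A f" and u: "u \<in> A"
  shows "\<exists>I y. solution_on n A f I y \<and> fst u \<in> I \<and> lift_jet y (fst u) = u"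
proof -
  let ?x = "fst u"
  obtain e w where e: "e > 0" and w0: "w ?x = u" and w: "\<And>t. t \<in> {?x-e<..<?x+e} \<Longrightarrow>
      w t \<in> A \<and> (w has_vector_derivative ode_field f (w t)) (at t)"
    using integral_curve_exists[OF A(1) smooth_on_ode_field[OF A] u, of ?x] by auto
  define I where "I = {?x-e<..<?x+e}"
  have I: "open I" "open_interval I" "?x \<in> I" using e by (auto simp: I_def open_interval_def is_interval_convex_1)
  have wI: "w t \<in> A" "(w has_vector_derivative ode_field f (w t)) (at t)" if "t \<in> I" for t
    using w[of t] that by (auto simp: I_def)
  have sm: "smooth_on I w"
    by (rule smooth_on_integral_curve[OF I(1) A(1) smooth_on_ode_field[OF A]]) (use wI in auto)
  have fstw: "fst (w t) = t" if "t \<in> I" for t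
  proof (rule unit_speed_eq[of I ?x "\<lambda>t. fst (w t)"])
    show "((\<lambda>t. fst (w t)) has_real_derivative 1) (at s)" if "s \<in> I" for s
      using bounded_linear.has_vector_derivative[OF bounded_linear_fst wI(2)[OF that]]
      by (simp add: has_real_derivative_iff_has_vector_derivative ode_field_def)
  qed (use I that w0 in \<open>auto simp: open_interval_def\<close>)
  define y where "y t = snd (w t) $ (yidx 0 :: 'l)" for t
  have D: "((\<lambda>t. snd (w t) $ (yidx i :: 'l)) has_real_derivative snd (ode_field f (w t)) $ yidx i) (at t)" if "t \<in> I" for t i
    using bounded_linear.has_vector_derivative[OF bounded_linear_compose[OF bounded_linear_vec_nth bounded_linear_snd] wI(2)[OF that]]
    by (simp add: has_real_derivative_iff_has_vector_derivative)
  have jets: "t \<in> I \<Longrightarrow> i < CARD('l) \<Longrightarrow> (deriv ^^ i) y t = snd (w t) $ (yidx i :: 'l)" for i t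
  proof (induction i arbitrary: t)
    case (Suc i)
    have "(deriv ^^ Suc i) y t = deriv (\<lambda>t. snd (w t) $ (yidx i :: 'l)) t"
      using deriv_cong_open[OF I(1) Suc.prems(1), of "(deriv ^^ i) y" "\<lambda>t. snd (w t) $ yidx i"] Suc by simp
    also have "\<dots> = snd (w t) $ (yidx (Suc i) :: 'l)"
      using DERIV_imp_deriv[OF D[OF Suc.prems(1)]] Suc.prems(2) by (simp add: ode_field_def)
    finally show ?case .
  qed (simp add: y_def)
  have lift: "lift_jet y t = w t" if "t \<in> I" for t
    using fstw[OF that] jets[OF that] ynum_less_card[where ?'l = 'l] by (simp add: lift_jet_def prod_eq_iff vec_eq_iff)
  have "(deriv ^^ (n + 1)) y t = f (w t)" if "t \<in> I" for t
  proof -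
    have "(deriv ^^ Suc n) y t = deriv (\<lambda>t. snd (w t) $ (yidx n :: 'l)) t"
      using deriv_cong_open[OF I(1) that, of "(deriv ^^ n) y" "\<lambda>t. snd (w t) $ yidx n"] jets card by simp
    also have "\<dots> = f (w t)"
      using DERIV_imp_deriv[OF D[OF that]] card by (simp add: ode_field_def)
    finally show ?thesis by simp
  qed
  moreover have "smooth_on I y"
    unfolding y_def by (intro smooth_on_vec_nth smooth_on_snd I sm)
  ultimately have "solution_on n A f I y"
    unfolding solution_on_def using I lift wI(1) by simp
  then show ?thesis using I(3) lift[OF I(3)] w0 by metis
qed

lemma solution_unique_local:
  fixes f :: "'l::{finite,linorder} jet \<Rightarrow> real"
  assumes card: "CARD('l) = n + 1" and A: "open A" "smooth_on A f"
    and y: "solution_on n A f I y" "x \<in> I" and z: "solution_on n A f J z" "x \<in> J"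
    and eq: "lift_jet y x = (lift_jet z x :: 'l jet)"
  shows "\<exists>e>0. \<forall>t\<in>{x-e<..<x+e}. lift_jet y t = (lift_jet z t :: 'l jet)"
proof -
  have "open (I \<inter> J)" "x \<in> I \<inter> J" using y z by (auto simp: solution_on_def open_interval_def)
  from integral_curve_unique_local[OF A(1) smooth_on_ode_field[OF A] this, of "lift_jet y" "lift_jet z"]
  show ?thesis
    using lift_jet_derivative[OF card y(1)] lift_jet_derivative[OF card z(1)] y z eq
    unfolding solution_on_def by blast
qed

definition linearization :: "('l::{finite,linorder} jet \<Rightarrow> real) \<Rightarrow> (real \<Rightarrow> real) \<Rightarrow> nat \<Rightarrow> real \<Rightarrow> real" where
  "linearization f y i t = - d_dy i f (lift_jet y t)"

lemma smooth_on_lift_jet: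
  assumes "open I" "smooth_on I y"
  shows "smooth_on I (lift_jet y :: real \<Rightarrow> 'l::{finite,linorder} jet)"
  using smooth_on_fst[OF assms(1) smooth_on_full_lift[OF assms]] by (simp add: full_lift_eq)

lemma smooth_on_linearization:
  fixes f :: "'l::{finite,linorder} jet \<Rightarrow> real"
  assumes A: "open A" "smooth_on A f" and y: "solution_on n A f I y"
  shows "smooth_on I (linearization f y i)"
proof -
  have I: "open I" "smooth_on I y" "(lift_jet y :: real \<Rightarrow> 'l jet) ` I \<subseteq> A"
    using y by (auto simp: solution_on_def open_interval_def)
  show ?thesis unfolding linearization_def[abs_def] d_dy_def
    by (intro smooth_on_minus I smooth_on_compose[OF I(1,3) smooth_on_lift_jet[OF I(1,2)]]
        smooth_on_frechet_derivative A)
qed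

text \<open>Lifts of two solutions through \<open>u\<close> agree near \<open>fst u\<close>, so the
  linearizations agree there too, and \<open>theta_value_cong\<close> gives the same value.\<close>

lemma wilczynski_fun_eq:
  fixes f :: "'l::{finite,linorder} jet \<Rightarrow> real"
  assumes n: "n \<ge> 2" and card: "CARD('l) = n + 1" and A: "open A" "smooth_on A f" and k: "3 \<le> k" "k \<le> n + 1"
    and y: "solution_on n A f I y" "fst u \<in> I" "lift_jet y (fst u) = u"
  shows "wilczynski_fun n A f k u = wilczynski_theta n (linearization f y) k (fst u)"
  unfolding wilczynski_fun_def
proof (rule the_equality)
  show "\<exists>I z. solution_on n A f I z \<and> fst u \<in> I \<and> lift_jet z (fst u) = u \<and>
      wilczynski_theta n (linearization f y) k (fst u) = wilczynski_theta n (\<lambda>i t. - d_dy i f (lift_jet z t)) k (fst u)"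
    using y unfolding linearization_def[abs_def] by blast
next
  fix w assume "\<exists>I y. solution_on n A f I y \<and> fst u \<in> I \<and> lift_jet y (fst u) = u \<and>
      w = wilczynski_theta n (\<lambda>i t. - d_dy i f (lift_jet y t)) k (fst u)"
  then obtain J z where z: "solution_on n A f J z" "fst u \<in> J" "lift_jet z (fst u) = u"
    "w = wilczynski_theta n (linearization f z) k (fst u)"
    unfolding linearization_def[abs_def] by blast
  obtain e where e: "e > 0" "\<forall>t\<in>{fst u-e<..<fst u+e}. lift_jet y t = (lift_jet z t :: 'l jet)"
    using solution_unique_local[OF card A y(1,2) z(1,2)] y(3) z(3) by auto
  have "theta_value n (linearization f y) k (fst u) (wilczynski_theta n (linearization f y) k (fst u))"
    by (rule theta_value_wilczynski_theta[OF n k _ y(2) smooth_on_linearization[OF A y(1)]])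
       (use y(1) in \<open>simp add: solution_on_def\<close>)
  then have "theta_value n (linearization f z) k (fst u) (wilczynski_theta n (linearization f y) k (fst u))"
    by (rule theta_value_cong[OF n, where N = "{fst u-e<..<fst u+e}", rotated -1])
       (use e in \<open>auto simp: open_interval_def is_interval_convex_1 linearization_def\<close>)
  from wilczynski_theta_eqI[OF n k this]
  show "w = wilczynski_theta n (linearization f y) k (fst u)" using z(4) by simp
qed

section \<open>Contact equivalences of equations\<close>

locale contact_equivalence =
  fixes n :: nat and A A' :: "'l::{finite,linorder} jet set" and f f' :: "'l jet \<Rightarrow> real"
    and U V :: "('l jet \<times> real) set" and \<phi> :: "'l jet \<times> real \<Rightarrow> 'l jet \<times> real"
  assumes n: "n \<ge> 2" and card: "CARD('l) = n + 1"
    and A: "open A" "smooth_on A f" and A': "open A'" "smooth_on A' f'"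
    and contact: "contact_transformation n U V \<phi>"
    and image_equation: "\<phi> ` (U \<inter> equation A f) = V \<inter> equation A' f'"
begin

abbreviation d\<phi> :: "'l jet \<times> real \<Rightarrow> 'l jet \<times> real \<Rightarrow> 'l jet \<times> real" where
  "d\<phi> p \<equiv> fderiv \<phi> p"

lemma diffeo_\<phi>: "diffeo U V \<phi>"
  using contact by (simp add: contact_transformation_def)

lemma U: "open U" "smooth_on U \<phi>"
  using diffeo_\<phi> by (auto simp: diffeo_def)

lemma linear_d\<phi>: "p \<in> U \<Longrightarrow> linear (d\<phi> p)"
  using smooth_on_has_derivative[OF U(2)] has_derivative_linear by blast

lemma inj_d\<phi>: "p \<in> U \<Longrightarrow> inj (d\<phi> p)"
  by (rule injI) (metis diffeo_derivative_inverse[OF diffeo_\<phi>])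

lemma surj_d\<phi>: "p \<in> U \<Longrightarrow> surj (d\<phi> p)"
  using linear_injective_imp_surjective[OF linear_d\<phi> inj_d\<phi>] by simp

lemma d\<phi>_contact: "p \<in> U \<Longrightarrow> v \<in> contact_plane n p \<Longrightarrow> d\<phi> p v \<in> contact_plane n (\<phi> p)"
  using contact by (auto simp: contact_transformation_def)

lemma d\<phi>_tangent_space:
  assumes "p \<in> U"
  shows "d\<phi> p ` tangent_space (equation A f) p = tangent_space (equation A' f') (\<phi> p)"
  by (rule tangent_space_image[OF diffeo_\<phi> image_equation assms])

lemma d\<phi>_line_bundle:
  assumes "p \<in> U"
  shows "d\<phi> p ` line_bundle n (equation A f) p = line_bundle n (equation A' f') (\<phi> p)"
  using contact assms d\<phi>_tangent_space[OF assms]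
  by (simp add: line_bundle_def image_Int[OF inj_d\<phi>[OF assms]] contact_transformation_def)

lemma \<phi>_equation: "p \<in> U \<Longrightarrow> p \<in> equation A f \<Longrightarrow> \<phi> p \<in> equation A' f'"
  using image_equation by blast

text \<open>Injectivity of the differential turns the equality of tangent spaces into an equivalence
  for every single vector. Applied to variations it compares the two linearized equations.\<close>

lemma d\<phi>_tangent_iff:
  assumes "p \<in> U" "p \<in> equation A f"
  shows "snd (d\<phi> p v) = fderiv f' (fst (\<phi> p)) (fst (d\<phi> p v)) \<longleftrightarrow>
    snd v = fderiv f (fst p) (fst v)"
proof -
  have p: "p = (fst p, f (fst p))" "fst p \<in> A" and q: "\<phi> p = (fst (\<phi> p), f' (fst (\<phi> p)))" "fst (\<phi> p) \<in> A'"
    using assms \<phi>_equation[OF assms] by (auto simp: mem_equation_iff prod_eq_iff)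
  have "d\<phi> p v \<in> tangent_space (equation A' f') (\<phi> p) \<longleftrightarrow> v \<in> tangent_space (equation A f) p"
    unfolding d\<phi>_tangent_space[OF assms(1), symmetric] by (rule inj_image_mem_iff[OF inj_d\<phi>[OF assms(1)]])
  then show ?thesis
    using tangent_space_equation[OF A p(2), of v] tangent_space_equation[OF A' q(2), of "d\<phi> p v"] p(1) q(1)
    by simp
qed

end

section \<open>The image curve of a lifted solution\<close>

locale lifted_solution = contact_equivalence +
  fixes I :: "real set" and y :: "real \<Rightarrow> real"
  assumes sol: "solution_on n A f I y" and lift_in_U: "t \<in> I \<Longrightarrow> full_lift y t \<in> U"
begin

definition \<gamma> :: "real \<Rightarrow> 'a jet \<times> real" where "\<gamma> t = full_lift y t"

definition \<gamma>' :: "real \<Rightarrow> 'a jet \<times> real" where "\<gamma>' t = jetvec 1 (\<lambda>i. (deriv ^^ Suc i) y t)"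

definition \<Gamma>' :: "real \<Rightarrow> 'a jet \<times> real" where "\<Gamma>' t = d\<phi> (\<gamma> t) (\<gamma>' t)"

definition new_x :: "real \<Rightarrow> real" where "new_x t = xcoord (\<phi> (\<gamma> t))"

definition speed :: "real \<Rightarrow> real" where "speed t = xcoord (\<Gamma>' t)"

text \<open>The second case is meant for the index n + 2: the quotient dy_(n+1) / dx along the image
  curve is its y_(n+2), which lies beyond the coordinates of J^(n+1).\<close>

definition new_y :: "nat \<Rightarrow> real \<Rightarrow> real" where
  "new_y i t = (if i \<le> n + 1 then ycoord i (\<phi> (\<gamma> t)) else ycoord (n + 1) (\<Gamma>' t) / speed t)"

lemma I: "open I" "open_interval I" and smooth_y: "smooth_on I y"
  using sol by (auto simp: solution_on_def open_interval_def)

lemma \<gamma>_in_U: "t \<in> I \<Longrightarrow> \<gamma> t \<in> U"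
  unfolding \<gamma>_def by (rule lift_in_U)

lemma \<gamma>_equation: "t \<in> I \<Longrightarrow> \<gamma> t \<in> equation A f"
  using sol by (simp add: solution_on_def \<gamma>_def full_lift_eq mem_equation_iff card del: funpow.simps)

lemma \<gamma>_derivative: "t \<in> I \<Longrightarrow> (\<gamma> has_vector_derivative \<gamma>' t) (at t)"
  unfolding \<gamma>_def[abs_def] \<gamma>'_def by (rule full_lift_derivative[OF I(1) smooth_y])

lemma smooth_on_\<gamma>: "smooth_on I \<gamma>"
  unfolding \<gamma>_def[abs_def] by (rule smooth_on_full_lift[OF I(1) smooth_y])

lemma \<Gamma>_derivative: "t \<in> I \<Longrightarrow> ((\<lambda>t. \<phi> (\<gamma> t)) has_vector_derivative \<Gamma>' t) (at t)"
  unfolding \<Gamma>'_def by (rule has_vector_derivative_chain[OF \<gamma>_derivative U(2) \<gamma>_in_U])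

lemma smooth_on_\<Gamma>: "smooth_on I (\<lambda>t. \<phi> (\<gamma> t))"
  by (rule smooth_on_compose[OF I(1) _ smooth_on_\<gamma> U(2)]) (use \<gamma>_in_U in auto)

lemma \<gamma>'_contact: "t \<in> I \<Longrightarrow> \<gamma>' t \<in> contact_plane n (\<gamma> t)"
  by (simp add: contact_plane_iff[OF card] \<gamma>'_def \<gamma>_def full_lift_def card del: funpow.simps)

lemma \<gamma>'_tangent:
  assumes t: "t \<in> I"
  shows "snd (\<gamma>' t) = fderiv f (fst (\<gamma> t)) (fst (\<gamma>' t))"
proof -
  have "((\<lambda>t. f (fst (\<gamma> t))) has_vector_derivative fderiv f (fst (\<gamma> t)) (fst (\<gamma>' t))) (at t)"
    using \<gamma>_equation[OF t]
    by (intro has_vector_derivative_chain[OF _ A(2)] bounded_linear.has_vector_derivative[OF bounded_linear_fst] \<gamma>_derivative t)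
       (simp add: mem_equation_iff)
  then have "((\<lambda>t. snd (\<gamma> t)) has_vector_derivative fderiv f (fst (\<gamma> t)) (fst (\<gamma>' t))) (at t)"
    by (rule has_vector_derivative_transform_within_open[OF _ I(1) t])
       (use \<gamma>_equation in \<open>auto simp: mem_equation_iff\<close>)
  then show ?thesis
    using vector_derivative_unique_at bounded_linear.has_vector_derivative[OF bounded_linear_snd \<gamma>_derivative[OF t]] by blast
qed

lemma \<Gamma>'_tangent:
  assumes t: "t \<in> I"
  shows "snd (\<Gamma>' t) = fderiv f' (fst (\<phi> (\<gamma> t))) (fst (\<Gamma>' t))"
  unfolding \<Gamma>'_def using d\<phi>_tangent_iff[OF \<gamma>_in_U[OF t] \<gamma>_equation[OF t]] \<gamma>'_tangent[OF t] by blast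

lemma \<Gamma>'_contact: "t \<in> I \<Longrightarrow> i \<le> n \<Longrightarrow> ycoord i (\<Gamma>' t) = ycoord (Suc i) (\<phi> (\<gamma> t)) * speed t"
  using d\<phi>_contact[OF \<gamma>_in_U \<gamma>'_contact] unfolding contact_plane_iff[OF card] \<Gamma>'_def speed_def by blast

text \<open>A contact vector with x-component 0 is a multiple of \<partial>_(y_(n+1)), and if it is
  also tangent to the graph y_(n+1) = f', it is 0. But \<Gamma>' is the image of a nonzero vector
  under an injective map.\<close>

lemma speed_nonzero:
  assumes t: "t \<in> I"
  shows "speed t \<noteq> 0"
proof
  assume 0: "speed t = 0"
  then have y0: "ycoord i (\<Gamma>' t) = 0" if "i \<le> n" for i using \<Gamma>'_contact[OF t that] by simp
  have "fst (\<Gamma>' t) = 0"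
  proof -
    have "snd (fst (\<Gamma>' t)) $ i = 0" for i
      using y0[of "ynum i"] ynum_less_card[of i] card by (simp add: ycoord_def)
    then show ?thesis using 0 by (simp add: prod_eq_iff vec_eq_iff speed_def xcoord_def)
  qed
  moreover have "linear (fderiv f' (fst (\<phi> (\<gamma> t))))"
    using smooth_on_has_derivative[OF A'(2)] \<phi>_equation[OF \<gamma>_in_U[OF t] \<gamma>_equation[OF t]] has_derivative_linear
    unfolding mem_equation_iff by blast
  ultimately have "snd (\<Gamma>' t) = 0" using \<Gamma>'_tangent[OF t] linear_0 by metis
  then have "d\<phi> (\<gamma> t) (\<gamma>' t) = d\<phi> (\<gamma> t) 0"
    using \<open>fst (\<Gamma>' t) = 0\<close> linear_0[OF linear_d\<phi>[OF \<gamma>_in_U[OF t]]] by (simp add: \<Gamma>'_def prod_eq_iff)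
  then have "\<gamma>' t = 0" using inj_d\<phi>[OF \<gamma>_in_U[OF t]] by (simp add: inj_eq)
  then have "xcoord (\<gamma>' t) = 0" by simp
  then show False by (simp add: \<gamma>'_def)
qed

lemma new_y_derivative:
  assumes t: "t \<in> I" and i: "i \<le> n + 1"
  shows "(new_y i has_real_derivative speed t * new_y (Suc i) t) (at t)"
proof -
  have "((\<lambda>t. ycoord i (\<phi> (\<gamma> t))) has_real_derivative ycoord i (\<Gamma>' t)) (at t)"
    unfolding has_real_derivative_iff_has_vector_derivative
    by (rule bounded_linear.has_vector_derivative[OF bounded_linear_ycoord \<Gamma>_derivative[OF t]])
  moreover have "new_y i = (\<lambda>t. ycoord i (\<phi> (\<gamma> t)))" using i by (simp add: new_y_def fun_eq_iff)
  moreover have "ycoord i (\<Gamma>' t) = speed t * new_y (Suc i) t"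
    using i \<Gamma>'_contact[OF t, of i] speed_nonzero[OF t] by (cases "i = n + 1") (auto simp: new_y_def)
  ultimately show ?thesis by simp
qed

lemma new_x_derivative: "t \<in> I \<Longrightarrow> (new_x has_real_derivative speed t) (at t)"
  unfolding has_real_derivative_iff_has_vector_derivative new_x_def[abs_def] speed_def
  by (rule bounded_linear.has_vector_derivative[OF bounded_linear_xcoord \<Gamma>_derivative])

lemma deriv_new_x: "t \<in> I \<Longrightarrow> deriv new_x t = speed t"
  using new_x_derivative DERIV_imp_deriv by blast

lemma smooth_on_new_x: "smooth_on I new_x"
  unfolding new_x_def[abs_def]
  by (rule smooth_on_linear_compose[OF bounded_linear_xcoord I(1) smooth_on_\<Gamma>])

lemma diffeo_new_x: "diffeo I (new_x ` I) new_x"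
  by (rule diffeo_intervalI[OF I(2) smooth_on_new_x]) (simp add: deriv_new_x speed_nonzero)

text \<open>The forms \<open>dy_i - y_(i+1) dx\<close> of the target, evaluated at \<open>d\<phi> v\<close>.  For \<open>i = n + 1\<close> the missing
  coordinate \<open>y_(n+2)\<close> is that of the image curve.\<close>

definition contact_form :: "nat \<Rightarrow> real \<Rightarrow> 'a jet \<times> real \<Rightarrow> real" where
  "contact_form i t v = ycoord i (d\<phi> (\<gamma> t) v) - new_y (Suc i) t * xcoord (d\<phi> (\<gamma> t) v)"

text \<open>The \<epsilon>-derivative of the lift of y + \<epsilon> h.\<close>

definition variation :: "(real \<Rightarrow> real) \<Rightarrow> real \<Rightarrow> 'a jet \<times> real" where
  "variation h t = jetvec 0 (\<lambda>i. (deriv ^^ i) h t)"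

lemma linear_contact_form:
  assumes "t \<in> I"
  shows "linear (contact_form i t)"
proof -
  have l: "linear (d\<phi> (\<gamma> t))" by (rule linear_d\<phi>[OF \<gamma>_in_U[OF assms]])
  show ?thesis
    by (rule linearI) (simp_all add: contact_form_def linear_add[OF l] linear_scale[OF l] algebra_simps)
qed

lemma contact_form_contact:
  assumes "t \<in> I" "i \<le> n" "v \<in> contact_plane n (\<gamma> t)"
  shows "contact_form i t v = 0"
  using d\<phi>_contact[OF \<gamma>_in_U[OF assms(1)] assms(3)] assms(2)
  by (simp add: contact_form_def new_y_def contact_plane_iff[OF card])

text \<open>The contact condition for the lift of \<open>y + \<epsilon> h\<close>, differentiated in \<open>\<epsilon>\<close> and combined with the
  symmetry of the second derivative of \<open>\<phi>\<close>.\<close>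

lemma contact_form_variation_derivative:
  assumes h: "smooth_on I h" and t: "t \<in> I" and i: "i \<le> n"
  shows "((\<lambda>t. contact_form i t (variation h t)) has_real_derivative
    speed t * contact_form (Suc i) t (variation h t)) (at t)"
proof -
  define J where "J = variation h t"
  define J' where "J' = (jetvec 0 (\<lambda>i. (deriv ^^ Suc i) h t) :: 'a jet \<times> real)"
  \<comment> \<open>The mixed derivative of \<phi> along the lifts of y + \<epsilon> h: the
    \<epsilon>-derivative of the image of the velocity, and by symmetry the t-derivative of the
    image of the variation.\<close>
  define Z where "Z = fderiv (\<lambda>x. d\<phi> x (\<gamma>' t)) (\<gamma> t) J + d\<phi> (\<gamma> t) J'"
  have dJ: "(variation h has_vector_derivative J') (at t)"
    unfolding variation_def[abs_def] J'_def
    by (intro has_vector_derivative_jetvec DERIV_const smooth_on_DERIV_funpow[OF I(1) h t])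
  have "((\<lambda>s. d\<phi> (\<gamma> s) (variation h s)) has_vector_derivative
      fderiv (\<lambda>x. d\<phi> x J) (\<gamma> t) (\<gamma>' t) + d\<phi> (\<gamma> t) J') (at t)"
    unfolding J_def
    by (rule has_vector_derivative_frechet_along_curve[OF U \<gamma>_in_U[OF t] \<gamma>_derivative[OF t] dJ])
  then have W: "((\<lambda>s. d\<phi> (\<gamma> s) (variation h s)) has_vector_derivative Z) (at t)"
    unfolding Z_def by (simp only: second_derivative_symmetric[OF U \<gamma>_in_U[OF t], of J "\<gamma>' t"])
  \<comment> \<open>Lifting is affine in the function, so at fixed \<open>t\<close> the lift of y +
    \<epsilon> h is exactly \<open>q \<epsilon>\<close> and its velocity is
    \<open>r \<epsilon>\<close>.\<close>
  define q where "q \<epsilon> = \<gamma> t + \<epsilon> *\<^sub>R J" for \<epsilon>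
  define r where "r \<epsilon> = \<gamma>' t + \<epsilon> *\<^sub>R J'" for \<epsilon>
  have q: "(q has_vector_derivative J) (at 0)" "q 0 = \<gamma> t" and r: "(r has_vector_derivative J') (at 0)" "r 0 = \<gamma>' t"
    unfolding q_def[abs_def] r_def[abs_def] by (auto intro!: derivative_eq_intros)
  have Wq: "((\<lambda>\<epsilon>. d\<phi> (q \<epsilon>) (r \<epsilon>)) has_vector_derivative Z) (at 0)"
    using has_vector_derivative_frechet_along_curve[OF U _ q(1) r(1)] \<gamma>_in_U[OF t] unfolding q(2) r(2) Z_def by blast
  have \<phi>q: "((\<lambda>\<epsilon>. \<phi> (q \<epsilon>)) has_vector_derivative d\<phi> (\<gamma> t) J) (at 0)"
    using has_vector_derivative_chain[OF q(1) U(2)] \<gamma>_in_U[OF t] unfolding q(2) by blast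
  have "isCont q 0" using q(1) by (rule has_vector_derivative_continuous)
  then have "\<exists>S. open S \<and> 0 \<in> S \<and> (\<forall>\<epsilon>\<in>S. q \<epsilon> \<in> U)"
    using U(1) \<gamma>_in_U[OF t] q(2) unfolding continuous_at_open by simp
  then obtain S where S: "open S" "0 \<in> S" "\<And>\<epsilon>. \<epsilon> \<in> S \<Longrightarrow> q \<epsilon> \<in> U" by blast
  have con: "ycoord i (d\<phi> (q \<epsilon>) (r \<epsilon>)) = ycoord (Suc i) (\<phi> (q \<epsilon>)) * xcoord (d\<phi> (q \<epsilon>) (r \<epsilon>))" if "\<epsilon> \<in> S" for \<epsilon>
  proof -
    have "r \<epsilon> \<in> contact_plane n (q \<epsilon>)"
      by (simp add: contact_plane_iff[OF card] r_def q_def \<gamma>'_def \<gamma>_def full_lift_def J_def J'_def variation_def card del: funpow.simps)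
    from d\<phi>_contact[OF S(3)[OF that] this] show ?thesis using i by (simp add: contact_plane_iff[OF card])
  qed
  have "((\<lambda>\<epsilon>. ycoord (Suc i) (\<phi> (q \<epsilon>)) * xcoord (d\<phi> (q \<epsilon>) (r \<epsilon>))) has_vector_derivative
      ycoord (Suc i) (\<phi> (q 0)) * xcoord Z + ycoord (Suc i) (d\<phi> (\<gamma> t) J) * xcoord (d\<phi> (q 0) (r 0))) (at 0)"
    by (rule bounded_bilinear.has_vector_derivative[OF bounded_bilinear_mult
        bounded_linear.has_vector_derivative[OF bounded_linear_ycoord \<phi>q]
        bounded_linear.has_vector_derivative[OF bounded_linear_xcoord Wq]])
  then have "((\<lambda>\<epsilon>. ycoord i (d\<phi> (q \<epsilon>) (r \<epsilon>))) has_vector_derivative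
      ycoord (Suc i) (\<phi> (q 0)) * xcoord Z + ycoord (Suc i) (d\<phi> (\<gamma> t) J) * xcoord (d\<phi> (q 0) (r 0))) (at 0)"
    by (rule has_vector_derivative_transform_within_open[OF _ S(1,2)]) (simp only: con)
  with bounded_linear.has_vector_derivative[OF bounded_linear_ycoord Wq]
  have "ycoord i Z = ycoord (Suc i) (\<phi> (q 0)) * xcoord Z + ycoord (Suc i) (d\<phi> (\<gamma> t) J) * xcoord (d\<phi> (q 0) (r 0))"
    using vector_derivative_unique_at by blast
  then have Zi: "ycoord i Z = new_y (Suc i) t * xcoord Z + ycoord (Suc i) (d\<phi> (\<gamma> t) J) * speed t"
    using i unfolding q(2) r(2) by (simp add: new_y_def speed_def \<Gamma>'_def)
  have "((\<lambda>s. contact_form i s (variation h s)) has_real_derivative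
      ycoord i Z - (speed t * new_y (Suc (Suc i)) t * xcoord (d\<phi> (\<gamma> t) J) + xcoord Z * new_y (Suc i) t)) (at t)"
    unfolding contact_form_def J_def
  proof (intro DERIV_diff DERIV_mult new_y_derivative[OF t])
    show "((\<lambda>s. ycoord i (d\<phi> (\<gamma> s) (variation h s))) has_real_derivative ycoord i Z) (at t)"
      unfolding has_real_derivative_iff_has_vector_derivative
      by (rule bounded_linear.has_vector_derivative[OF bounded_linear_ycoord W])
    show "((\<lambda>s. xcoord (d\<phi> (\<gamma> s) (variation h s))) has_real_derivative xcoord Z) (at t)"
      unfolding has_real_derivative_iff_has_vector_derivative
      by (rule bounded_linear.has_vector_derivative[OF bounded_linear_xcoord W])
  qed (use i in simp)
  \<comment> \<open>After \<open>Zi\<close> is inserted, the two terms with \<open>xcoord Z\<close>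
    cancel and \<open>speed t\<close> factors out.\<close>
  then show ?thesis
    unfolding Zi contact_form_def J_def[symmetric] by (simp add: algebra_simps)
qed

end

section \<open>Triangular form of the pulled-back contact forms, and the image solution\<close>

context lifted_solution
begin

lemma contact_form_variation:
  assumes "t \<in> I"
  shows "contact_form i t (variation h t) = (\<Sum>j\<le>n + 1. (deriv ^^ j) h t * contact_form i t (yvec j))"
proof -
  have "variation h t = (\<Sum>j\<le>n + 1. (deriv ^^ j) h t *\<^sub>R yvec j)"
    unfolding variation_def by (subst jetvec_sum) (simp add: card)
  then show ?thesis
    by (simp only: linear_sum[OF linear_contact_form[OF assms]] linear_scale[OF linear_contact_form[OF assms]] real_scaleR_def)
qed

lemma contact_form_yvec_differentiable:
  assumes i: "i \<le> n" and t: "t \<in> I"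
  shows "((\<lambda>t. contact_form i t (yvec j)) has_real_derivative deriv (\<lambda>t. contact_form i t (yvec j)) t) (at t)"
proof -
  have "smooth_on I (\<lambda>t. d\<phi> (\<gamma> t) (yvec j))"
    by (rule smooth_on_compose[OF I(1) _ smooth_on_\<gamma> smooth_on_frechet_derivative[OF U(2)]]) (use \<gamma>_in_U in auto)
  moreover have "smooth_on I (\<lambda>t. ycoord (Suc i) (\<phi> (\<gamma> t)))"
    by (rule smooth_on_linear_compose[OF bounded_linear_ycoord I(1) smooth_on_\<Gamma>])
  then have "smooth_on I (new_y (Suc i))"
    using i by (simp add: new_y_def[abs_def])
  ultimately have "smooth_on I (\<lambda>t. contact_form i t (yvec j))"
    unfolding contact_form_def
    by (intro smooth_on_diff smooth_on_mult I smooth_on_linear_compose[OF bounded_linear_ycoord]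
        smooth_on_linear_compose[OF bounded_linear_xcoord])
  then show ?thesis using t by (rule smooth_on_DERIV)
qed

text \<open>The transformation preserves the derived flag of the contact distribution.  The coefficient of
  \<open>h^(j+1)\<close> in the derivative of \<open>contact_form i t (variation h t)\<close> is isolated by a monomial \<open>h\<close>.\<close>

lemma contact_form_triangular:
  "n + 1 - j \<le> d \<Longrightarrow> i < j \<Longrightarrow> j \<le> n + 1 \<Longrightarrow> t \<in> I \<Longrightarrow> contact_form i t (yvec j) = 0"
proof (induction d arbitrary: i j t)
  case 0
  then have j: "j = n + 1" by simp
  \<comment> \<open>The induction descends from the last column, where \<partial>_(y_(n+1)) is
    itself a contact vector; \<open>d\<close> bounds the distance to that column.\<close>
  have "yvec j \<in> contact_plane n (\<gamma> t)"
    unfolding contact_plane_iff[OF card] yvec_def using j by (simp add: card)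
  then show ?case using 0 j by (intro contact_form_contact) auto
next
  case (Suc d)
  show ?case
  proof (cases "j = n + 1")
    case True
    then show ?thesis using Suc by (intro Suc.IH) auto
  next
    case False
    \<comment> \<open>At \<open>t\<close> only the derivative of order j + 1 is nonzero. The
      derivative relation then equates entry (i, j) with \<open>speed t\<close> times entry (i + 1,
      j + 1), which is 0 by induction.\<close>
    define h where "h x = 1 * (x - t) ^ Suc j / fact (Suc j)" for x :: real
    have h: "smooth_on I h" unfolding h_def by (rule smooth_on_monomial[OF I(1)])
    have hl: "(deriv ^^ l) h t = (if l = Suc j then 1 else 0)" for l
      unfolding h_def funpow_deriv_monomial by (auto simp: power_0_left simp del: power_Suc fact_Suc)
    have i: "i \<le> n" using Suc.prems by simp
    have zero: "contact_form i' s (yvec l) = 0" if "j < l" "l \<le> n + 1" "i' \<le> j" "s \<in> I" for i' l s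
      using that Suc.prems(1) by (intro Suc.IH) auto
    have K: "contact_form i s (variation h s) = (\<Sum>l\<le>j. (deriv ^^ l) h s * contact_form i s (yvec l))" if "s \<in> I" for s
      unfolding contact_form_variation[OF that]
      using Suc.prems zero[OF _ _ _ that, of _ i] by (intro sum.mono_neutral_right) auto
    let ?a = "\<lambda>l s. contact_form i s (yvec l)"
    have "((\<lambda>s. \<Sum>l\<le>j. (deriv ^^ l) h s * ?a l s) has_real_derivative
        (\<Sum>l\<le>j. (deriv ^^ Suc l) h t * ?a l t + deriv (?a l) t * (deriv ^^ l) h t)) (at t)"
      by (intro DERIV_sum DERIV_mult smooth_on_DERIV_funpow[OF I(1) h] contact_form_yvec_differentiable i Suc.prems)
    then have "deriv (\<lambda>s. contact_form i s (variation h s)) t =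
        (\<Sum>l\<le>j. (deriv ^^ Suc l) h t * ?a l t + deriv (?a l) t * (deriv ^^ l) h t)"
      using deriv_cong_open[OF I(1) Suc.prems(4) K] DERIV_imp_deriv by simp
    also have "\<dots> = (\<Sum>l\<le>j. if l = j then ?a j t else 0)"
      unfolding hl by (intro sum.cong) auto
    also have "\<dots> = ?a j t" by simp
    finally have "?a j t = speed t * contact_form (Suc i) t (variation h t)"
      using DERIV_imp_deriv[OF contact_form_variation_derivative[OF h Suc.prems(4) i]] by simp
    also have "contact_form (Suc i) t (variation h t) = (\<Sum>l\<le>n + 1. if l = Suc j then contact_form (Suc i) t (yvec (Suc j)) else 0)"
      unfolding contact_form_variation[OF Suc.prems(4)] hl by (intro sum.cong) auto
    also have "\<dots> = contact_form (Suc i) t (yvec (Suc j))"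
      using Suc.prems(3) False by simp
    also have "\<dots> = 0" using Suc.prems False by (intro zero) auto
    finally show ?thesis by simp
  qed
qed

definition multiplier :: "real \<Rightarrow> real" where
  "multiplier t = contact_form 0 t (yvec 0)"

lemma contact_form_0_variation:
  assumes t: "t \<in> I"
  shows "contact_form 0 t (variation h t) = multiplier t * h t"
proof -
  have "contact_form 0 t (variation h t) = (\<Sum>j\<in>{0}. (deriv ^^ j) h t * contact_form 0 t (yvec j))"
    unfolding contact_form_variation[OF t]
  proof (rule sum.mono_neutral_right)
    show "\<forall>j\<in>{..n + 1} - {0}. (deriv ^^ j) h t * contact_form 0 t (yvec j) = 0"
      using t by (auto intro!: contact_form_triangular[of _ "n + 1"])
  qed auto
  then show ?thesis by (simp add: multiplier_def)
qed

text \<open>Otherwise dy_0 - y_1 dx would vanish on the images of all vertical vectors and of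
  \<gamma>', hence everywhere, as the differential is onto. But it is 1 on \<partial>_(y_0).\<close>

lemma multiplier_nonzero:
  assumes t: "t \<in> I"
  shows "multiplier t \<noteq> 0"
proof
  assume 0: "multiplier t = 0"
  note lin = linear_contact_form[OF t, of 0]
  have "contact_form 0 t v = 0" for v
  proof -
    define w where "w = v - xcoord v *\<^sub>R \<gamma>' t"
    have "xcoord w = 0" by (simp add: w_def \<gamma>'_def)
    then have "w = (\<Sum>j\<le>n + 1. ycoord j w *\<^sub>R yvec j)"
      using vertical_sum[of w] card by simp
    then have "contact_form 0 t w = contact_form 0 t (\<Sum>j\<le>n + 1. ycoord j w *\<^sub>R yvec j)"
      by (rule arg_cong)
    also have "\<dots> = (\<Sum>j\<le>n + 1. ycoord j w * contact_form 0 t (yvec j))"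
      by (simp only: linear_sum[OF lin] linear_scale[OF lin] real_scaleR_def)
    also have "\<dots> = 0"
    proof (rule sum.neutral, rule ballI)
      fix j assume "j \<in> {..n + 1}"
      then show "ycoord j w * contact_form 0 t (yvec j) = 0"
        using 0 t by (cases "j = 0") (auto simp: multiplier_def intro!: contact_form_triangular[of _ "n + 1"])
    qed
    finally have "contact_form 0 t w = 0" .
    moreover have "contact_form 0 t (\<gamma>' t) = 0"
      by (rule contact_form_contact[OF t _ \<gamma>'_contact[OF t]]) simp
    moreover have "v = w + xcoord v *\<^sub>R \<gamma>' t" by (simp add: w_def)
    ultimately show ?thesis by (metis linear_add[OF lin] linear_scale[OF lin] add_0 scaleR_zero_right)
  qed
  moreover obtain v where v: "yvec 0 = d\<phi> (\<gamma> t) v"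
    using surjD[OF surj_d\<phi>[OF \<gamma>_in_U[OF t]]] by blast
  have "contact_form 0 t v = 1"
    by (simp add: contact_form_def v[symmetric] yvec_def)
  ultimately show False by (metis zero_neq_one)
qed

lemma smooth_on_multiplier: "smooth_on I multiplier"
proof -
  have "smooth_on I (\<lambda>t. d\<phi> (\<gamma> t) (yvec 0))"
    by (rule smooth_on_compose[OF I(1) _ smooth_on_\<gamma> smooth_on_frechet_derivative[OF U(2)]]) (use \<gamma>_in_U in auto)
  moreover have "smooth_on I (new_y (Suc 0))"
    using smooth_on_linear_compose[OF bounded_linear_ycoord I(1) smooth_on_\<Gamma>, of "Suc 0"] by (simp add: new_y_def[abs_def])
  ultimately show ?thesis
    unfolding multiplier_def[abs_def] contact_form_def
    by (intro smooth_on_diff smooth_on_mult I smooth_on_linear_compose[OF bounded_linear_ycoord]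
        smooth_on_linear_compose[OF bounded_linear_xcoord])
qed

text \<open>Differentiation in the new variable is d/dt divided by \<open>speed\<close>. This serves
  both for the coordinates of the image curve and for the contact forms on a variation.\<close>

lemma funpow_deriv_new_x:
  assumes k: "smooth_on (new_x ` I) k"
    and step: "\<And>i t. i < N \<Longrightarrow> t \<in> I \<Longrightarrow> (F i has_real_derivative speed t * F (Suc i) t) (at t)"
    and F0: "\<And>t. t \<in> I \<Longrightarrow> k (new_x t) = F 0 t"
  shows "i \<le> N \<Longrightarrow> t \<in> I \<Longrightarrow> (deriv ^^ i) k (new_x t) = F i t"
proof (induction i arbitrary: t)
  case (Suc i)
  have J: "open (new_x ` I)" using diffeo_new_x by (simp add: diffeo_def)
  have "((\<lambda>t. (deriv ^^ i) k (new_x t)) has_real_derivative (deriv ^^ Suc i) k (new_x t) * speed t) (at t)"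
    by (rule DERIV_chain2[OF smooth_on_DERIV_funpow[OF J k] new_x_derivative]) (use Suc.prems in auto)
  from DERIV_imp_deriv[OF this]
  have "(deriv ^^ Suc i) k (new_x t) * speed t = deriv (\<lambda>t. (deriv ^^ i) k (new_x t)) t" by (rule sym)
  also have "\<dots> = deriv (F i) t"
    by (rule deriv_cong_open[OF I(1) Suc.prems(2)]) (use Suc in auto)
  also have "\<dots> = F (Suc i) t * speed t"
    using DERIV_imp_deriv[OF step[of i t]] Suc.prems by simp
  finally show ?case using speed_nonzero[OF Suc.prems(2)] by (simp only: mult_cancel_right) blast
qed (simp add: F0)

definition new_solution :: "real \<Rightarrow> real" where
  "new_solution s = new_y 0 (the_inv_into I new_x s)"

lemma smooth_on_new_solution: "smooth_on (new_x ` I) new_solution"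
proof -
  have g: "open (new_x ` I)" "smooth_on (new_x ` I) (the_inv_into I new_x)"
    using diffeo_new_x by (auto simp: diffeo_def)
  have "smooth_on I (new_y 0)"
    using smooth_on_linear_compose[OF bounded_linear_ycoord I(1) smooth_on_\<Gamma>, of 0] by (simp add: new_y_def[abs_def])
  then show ?thesis unfolding new_solution_def[abs_def]
    by (intro smooth_on_compose[OF g(1) _ g(2)]) (use diffeo_inv_in[OF diffeo_new_x] in auto)
qed

lemma funpow_deriv_new_solution:
  assumes "i \<le> n + 1" "t \<in> I"
  shows "(deriv ^^ i) new_solution (new_x t) = ycoord i (\<phi> (\<gamma> t))"
proof -
  have "(deriv ^^ i) new_solution (new_x t) = new_y i t"
    by (rule funpow_deriv_new_x[OF smooth_on_new_solution, of "n + 1" new_y])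
       (use assms new_y_derivative diffeo_inv_eq[OF diffeo_new_x] in \<open>auto simp: new_solution_def\<close>)
  then show ?thesis using assms by (simp add: new_y_def)
qed

lemma lift_jet_new_solution:
  assumes "t \<in> I"
  shows "lift_jet new_solution (new_x t) = fst (\<phi> (\<gamma> t))"
proof -
  have "(full_lift new_solution (new_x t) :: 'a jet \<times> real) = \<phi> (\<gamma> t)"
  proof (rule jet_eqI)
    show "xcoord (full_lift new_solution (new_x t) :: 'a jet \<times> real) = xcoord (\<phi> (\<gamma> t))"
      by (simp add: full_lift_def new_x_def)
    show "ycoord i (full_lift new_solution (new_x t) :: 'a jet \<times> real) = ycoord i (\<phi> (\<gamma> t))" if "i \<le> CARD('a)" for i
      using funpow_deriv_new_solution[OF _ assms, of i] that card by (simp add: full_lift_def)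
  qed
  then show ?thesis by (metis full_lift_eq fst_conv)
qed

lemma solution_on_new_solution: "solution_on n A' f' (new_x ` I) new_solution"
  unfolding solution_on_def
proof (intro conjI ballI)
  show "open_interval (new_x ` I)" by (rule open_interval_image[OF I(2) diffeo_new_x])
  fix s assume "s \<in> new_x ` I"
  then obtain t where t: "t \<in> I" "s = new_x t" by blast
  have eq: "\<phi> (\<gamma> t) \<in> equation A' f'" by (rule \<phi>_equation[OF \<gamma>_in_U[OF t(1)] \<gamma>_equation[OF t(1)]])
  then show "(lift_jet new_solution s :: 'a jet) \<in> A'"
    using lift_jet_new_solution[OF t(1)] t(2) by (simp add: mem_equation_iff)
  show "(deriv ^^ (n + 1)) new_solution s = f' (lift_jet new_solution s)"
    using eq funpow_deriv_new_solution[of "n + 1" t] lift_jet_new_solution[OF t(1)] t card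
    by (simp add: mem_equation_iff ycoord_def del: funpow.simps)
qed (rule smooth_on_new_solution)

end

text \<open>The right-hand side is d(y_(n+1) - f) on the vertical vector \<open>v\<close>, so the
  linearized equation at a point expresses tangency of \<open>v\<close> to the equation.\<close>

lemma linear_lhs_linearization:
  fixes f :: "'l::{finite,linorder} jet \<Rightarrow> real"
  assumes card: "CARD('l) = n + 1" and f: "f differentiable (at (lift_jet y t))"
    and v: "xcoord v = 0" "\<And>i. i \<le> n + 1 \<Longrightarrow> ycoord i v = (deriv ^^ i) h t"
  shows "linear_lhs n (linearization f y) h t = snd v - fderiv f (lift_jet y t) (fst v)"
proof -
  let ?Df = "fderiv f (lift_jet y t)"
  have lin: "linear ?Df" by (rule linear_frechet_derivative[OF f])
  have y1: "fst (yvec i :: 'l jet \<times> real) = (0, axis (yidx i) 1)" if "i \<le> n" for i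
    using that card by (auto simp: yvec_def jetvec_def vec_eq_iff axis_def)
  have y2: "fst (yvec (n + 1) :: 'l jet \<times> real) = 0"
  proof -
    have "ynum (i :: 'l) \<noteq> n + 1" for i using ynum_less_card[of i] card by simp
    then show ?thesis by (simp add: yvec_def jetvec_def vec_eq_iff zero_prod_def)
  qed
  have "v = (\<Sum>i\<le>n + 1. ycoord i v *\<^sub>R yvec i)"
    using vertical_sum[OF v(1)] card by simp
  then have "fst v = (\<Sum>i\<le>n + 1. ycoord i v *\<^sub>R fst (yvec i))"
    by (metis (no_types, lifting) fst_sum fst_scaleR sum.cong)
  also have "\<dots> = (\<Sum>i\<le>n. (deriv ^^ i) h t *\<^sub>R (0, axis (yidx i) 1))"
    using v(2) by (simp add: y1 y2[simplified])
  finally have "?Df (fst v) = (\<Sum>i\<le>n. (deriv ^^ i) h t * d_dy i f (lift_jet y t))"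
    by (simp only: linear_sum[OF lin] linear_scale[OF lin] d_dy_def real_scaleR_def)
  moreover have "snd v = (deriv ^^ (n + 1)) h t"
    using v(2)[of "n + 1"] card by (simp add: ycoord_def)
  ultimately show ?thesis
    unfolding linear_lhs_def linearization_def by (simp add: sum_negf mult.commute del: funpow.simps)
qed

section \<open>Equivalence of the two linearizations\<close>

context lifted_solution
begin

text \<open>Both equations express tangency, which \<phi> preserves. The image of a variation need
  not be vertical; subtracting a multiple of \<Gamma>', itself tangent to the target equation, makes
  it so. The coordinates of the difference are the contact forms, that is the derivatives of
  \<open>k\<close>.\<close>

theorem linear_equiv_linearizations:
  "linear_equiv n (linearization f y) I new_x multiplier (linearization f' new_solution)"
  unfolding linear_equiv_def
proof (intro conjI allI impI ballI I diffeo_new_x smooth_on_multiplier multiplier_nonzero)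
  fix h k t assume h: "smooth_on I h" and k: "smooth_on (new_x ` I) k"
    and hk: "\<forall>t\<in>I. k (new_x t) = multiplier t * h t" and t: "t \<in> I"
  let ?v = "variation h t"
  let ?w = "d\<phi> (\<gamma> t) ?v"
  define r where "r = ?w - (xcoord ?w / speed t) *\<^sub>R \<Gamma>' t"
  have ki: "(deriv ^^ i) k (new_x t) = contact_form i t (variation h t)" if "i \<le> n + 1" for i
    by (rule funpow_deriv_new_x[OF k, of "n + 1" "\<lambda>i t. contact_form i t (variation h t)"])
       (use that t hk contact_form_variation_derivative[OF h] contact_form_0_variation in auto)
  have "ycoord i r = contact_form i t ?v" if "i \<le> n + 1" for i
  proof (cases "i = n + 1")
    case True
    then show ?thesis by (simp add: r_def contact_form_def new_y_def)
  next
    case False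
    then show ?thesis
      using that \<Gamma>'_contact[OF t, of i] speed_nonzero[OF t] by (simp add: r_def contact_form_def new_y_def)
  qed
  with ki have r: "xcoord r = 0" "\<And>i. i \<le> n + 1 \<Longrightarrow> ycoord i r = (deriv ^^ i) k (new_x t)"
    using speed_nonzero[OF t] by (simp_all add: r_def speed_def[symmetric])
  have lift: "lift_jet y t = fst (\<gamma> t)" "lift_jet new_solution (new_x t) = fst (\<phi> (\<gamma> t))"
    using lift_jet_new_solution[OF t] by (simp_all add: \<gamma>_def full_lift_eq)
  have eqs: "\<gamma> t \<in> equation A f" "\<phi> (\<gamma> t) \<in> equation A' f'"
    using \<gamma>_equation[OF t] \<phi>_equation[OF \<gamma>_in_U[OF t] \<gamma>_equation[OF t]] by auto
  have df: "f differentiable (at (fst (\<gamma> t)))" "f' differentiable (at (fst (\<phi> (\<gamma> t))))"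
    using smooth_on_has_derivative[OF A(2)] smooth_on_has_derivative[OF A'(2)] eqs
    unfolding mem_equation_iff differentiable_def by blast+
  let ?Df' = "fderiv f' (fst (\<phi> (\<gamma> t)))"
  have lin: "linear ?Df'" by (rule linear_frechet_derivative[OF df(2)])
  have "linear_lhs n (linearization f' new_solution) k (new_x t) = snd r - ?Df' (fst r)"
    using linear_lhs_linearization[OF card, of f' new_solution "new_x t" r k] df(2) r by (simp add: lift)
  also have "\<dots> = snd ?w - ?Df' (fst ?w)"
    unfolding r_def using \<Gamma>'_tangent[OF t] by (simp add: linear_diff[OF lin] linear_scale[OF lin])
  finally have 1: "linear_lhs n (linearization f' new_solution) k (new_x t) = 0 \<longleftrightarrow> snd ?w = ?Df' (fst ?w)" by simp
  have "linear_lhs n (linearization f y) h t = snd ?v - fderiv f (fst (\<gamma> t)) (fst ?v)"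
    using linear_lhs_linearization[OF card, of f y t ?v h] df(1) card
    by (simp add: lift(1) variation_def del: funpow.simps)
  then show "linear_lhs n (linearization f y) h t = 0 \<longleftrightarrow>
      linear_lhs n (linearization f' new_solution) k (new_x t) = 0"
    unfolding 1 d\<phi>_tangent_iff[OF \<gamma>_in_U[OF t] eqs(1)] by simp
qed

text \<open>E is spanned by \<gamma>', whose x-component is 1, and the x-component of its image
  \<Gamma>' is \<open>speed t\<close>.\<close>

lemma d\<phi>_line:
  assumes t: "t \<in> I" and v: "v \<in> line_bundle n (equation A f) (\<gamma> t)"
  shows "xcoord (d\<phi> (\<gamma> t) v) = speed t * xcoord v"
proof -
  have eq: "\<gamma> t = (fst (\<gamma> t), f (fst (\<gamma> t)))" "fst (\<gamma> t) \<in> A"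
    using \<gamma>_equation[OF t] by (auto simp: mem_equation_iff prod_eq_iff)
  have tan: "snd v = fderiv f (fst (\<gamma> t)) (fst v)"
    using v tangent_space_equation[OF A eq(2), of v] eq(1) by (simp add: line_bundle_def)
  have con: "ycoord i v = ycoord (Suc i) (\<gamma> t) * xcoord v" if "i \<le> n" for i
    using v that by (simp add: line_bundle_def contact_plane_iff[OF card])
  have lin: "linear (fderiv f (fst (\<gamma> t)))"
    using smooth_on_has_derivative[OF A(2) eq(2)] has_derivative_linear by blast
  have y: "ycoord i v = xcoord v * ycoord i (\<gamma>' t)" if "i \<le> n" for i
    using con[OF that] \<gamma>'_contact[OF t] that by (simp add: contact_plane_iff[OF card]) (simp add: \<gamma>'_def)
  have "fst v = xcoord v *\<^sub>R fst (\<gamma>' t)"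
  proof -
    have "snd (fst v) $ i = xcoord v * (snd (fst (\<gamma>' t)) $ i)" for i
      using y[of "ynum i"] ynum_less_card[of i] card by (simp add: ycoord_def)
    moreover have "xcoord (\<gamma>' t) = 1" by (simp add: \<gamma>'_def)
    ultimately show ?thesis by (simp add: prod_eq_iff vec_eq_iff xcoord_def)
  qed
  moreover from this have "snd v = xcoord v *\<^sub>R snd (\<gamma>' t)"
    using tan \<gamma>'_tangent[OF t] by (simp add: linear_scale[OF lin])
  ultimately have "v = xcoord v *\<^sub>R \<gamma>' t" by (simp add: prod_eq_iff)
  then have "d\<phi> (\<gamma> t) v = xcoord v *\<^sub>R \<Gamma>' t"
    unfolding \<Gamma>'_def by (metis linear_scale[OF linear_d\<phi>[OF \<gamma>_in_U[OF t]]])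
  then show ?thesis by (simp add: speed_def)
qed

end

section \<open>Comparison of the invariants at a point\<close>

context contact_equivalence
begin

lemma lifted_solution_through:
  assumes p: "p \<in> U" "p \<in> equation A f"
  obtains I y where "lifted_solution n A A' f f' U V \<phi> I y" "fst (fst p) \<in> I" "full_lift y (fst (fst p)) = p"
proof -
  let ?x = "fst (fst p)"
  have pA: "fst p \<in> A" "snd p = f (fst p)" using p by (auto simp: mem_equation_iff)
  obtain I y where y: "solution_on n A f I y" "?x \<in> I" "lift_jet y ?x = fst p"
    using solution_exists[OF card A pA(1)] by blast
  have I: "open I" "open_interval I" "smooth_on I y" using y(1) by (auto simp: solution_on_def open_interval_def)
  have lift: "full_lift y ?x = p"
    using y pA(2) unfolding solution_on_def full_lift_eq card by (metis prod.collapse)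
  have "continuous_on I (full_lift y :: real \<Rightarrow> 'l jet \<times> real)"
    by (rule smooth_on_imp_continuous_on[OF smooth_on_full_lift[OF I(1,3)]])
  then have "open (I \<inter> full_lift y -` U)"
    using continuous_on_open_vimage[OF I(1)] U(1) by (metis Int_commute)
  then obtain e where e: "e > 0" "ball ?x e \<subseteq> I \<inter> full_lift y -` U"
    using lift p(1) y(2) open_contains_ball by (metis IntI vimageI)
  define J where "J = ball ?x e"
  have J: "open_interval J" "?x \<in> J" "J \<subseteq> I"
    using e by (auto simp: J_def open_interval_def is_interval_convex_1)
  have "lifted_solution n A A' f f' U V \<phi> J y"
  proof
    show "solution_on n A f J y"
      using y(1) J smooth_on_subset[OF I(3) J(3)] unfolding solution_on_def by blast
    show "full_lift y t \<in> U" if "t \<in> J" for t using that e(2) by (auto simp: J_def)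
  qed
  then show thesis using that J(2) lift by blast
qed

text \<open>The factor \<open>c\<close> is the derivative of the new independent variable along the
  solution through \<open>p\<close>. The same number governs the covariance of \<theta>_k and the
  x-components of vectors of E.\<close>

theorem wilczynski_fun_transform:
  assumes p: "p \<in> U" "p \<in> equation A f" and k: "3 \<le> k" "k \<le> n + 1"
  shows "\<exists>c. wilczynski_fun n A f k (fst p) = c ^ k * wilczynski_fun n A' f' k (fst (\<phi> p)) \<and>
    (\<forall>v\<in>line_bundle n (equation A f) p. fst (fst (d\<phi> p v)) = c * fst (fst v))"
proof -
  define x where "x = fst (fst p)"
  obtain I y where ls: "lifted_solution n A A' f f' U V \<phi> I y" and x: "x \<in> I" "full_lift y x = p"
    using lifted_solution_through[OF p] unfolding x_def by blast
  interpret lifted_solution n A A' f f' U V \<phi> I y by (rule ls)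
  have \<gamma>x: "\<gamma> x = p" using x(2) by (simp add: \<gamma>_def)
  let ?x' = "new_x x"
  have fx': "fst (fst (\<phi> p)) = ?x'" by (simp add: new_x_def \<gamma>x xcoord_def)
  have x': "?x' \<in> new_x ` I" using x(1) by blast
  have lift: "lift_jet y x = fst p" "lift_jet new_solution ?x' = fst (\<phi> p)"
    using x(2) lift_jet_new_solution[OF x(1)] by (auto simp: full_lift_eq \<gamma>x)
  have 1: "wilczynski_fun n A f k (fst p) = wilczynski_theta n (linearization f y) k x"
    using wilczynski_fun_eq[OF n card A k sol, of "fst p"] x(1) lift(1) by (simp add: x_def[symmetric])
  have 2: "wilczynski_fun n A' f' k (fst (\<phi> p)) = wilczynski_theta n (linearization f' new_solution) k ?x'"
    using wilczynski_fun_eq[OF n card A' k solution_on_new_solution, of "fst (\<phi> p)"] x' lift(2) fx' by simp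
  have "theta_value n (linearization f' new_solution) k ?x' (wilczynski_theta n (linearization f' new_solution) k ?x')"
    by (rule theta_value_wilczynski_theta[OF n k _ x' smooth_on_linearization[OF A' solution_on_new_solution]])
       (use solution_on_new_solution in \<open>simp add: solution_on_def\<close>)
  from wilczynski_theta_eqI[OF n k theta_value_linear_equiv[OF n linear_equiv_linearizations x(1) this]]
  have "wilczynski_fun n A f k (fst p) = speed x ^ k * wilczynski_fun n A' f' k (fst (\<phi> p))"
    unfolding 1 2 by (simp add: deriv_new_x[OF x(1)])
  moreover have "\<forall>v\<in>line_bundle n (equation A f) p. fst (fst (d\<phi> p v)) = speed x * fst (fst v)"
    using d\<phi>_line[OF x(1)] by (simp add: \<gamma>x xcoord_def)
  ultimately show ?thesis by blast
qed

end

theorem theorem3: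
  fixes n :: nat
    and A A' :: "'l::{finite,linorder} jet set"
    and f f' :: "'l jet \<Rightarrow> real"
    and U V :: "('l jet \<times> real) set"
    and \<phi> :: "'l jet \<times> real \<Rightarrow> 'l jet \<times> real"
  assumes "n \<ge> 2" and "CARD('l) = n + 1"
    and "open A" and "smooth_on A f"
    and "open A'" and "smooth_on A' f'"
    and "contact_transformation n U V \<phi>"
    and "\<phi> ` (U \<inter> equation A f) = V \<inter> equation A' f'"
  shows "(\<forall>p \<in> U \<inter> equation A f.
            frechet_derivative \<phi> (at p) ` line_bundle n (equation A f) p
              = line_bundle n (equation A' f') (\<phi> p)) \<and>
         (\<forall>k \<in> {3..n + 1}. \<forall>p \<in> U \<inter> equation A f. \<forall>vs.
            (\<forall>i<k. vs i \<in> line_bundle n (equation A f) p) \<longrightarrow>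
            wilczynski_form n A' f' k (\<phi> p) (\<lambda>i. frechet_derivative \<phi> (at p) (vs i))
              = wilczynski_form n A f k p vs)"
proof -
  interpret contact_equivalence n A A' f f' U V \<phi>
    using assms by unfold_locales
  have "wilczynski_form n A' f' k (\<phi> p) (\<lambda>i. frechet_derivative \<phi> (at p) (vs i)) = wilczynski_form n A f k p vs"
    if k: "k \<in> {3..n + 1}" and p: "p \<in> U \<inter> equation A f"
      and vs: "\<forall>i<k. vs i \<in> line_bundle n (equation A f) p" for k p vs
  proof -
    obtain c where c: "wilczynski_fun n A f k (fst p) = c ^ k * wilczynski_fun n A' f' k (fst (\<phi> p))"
      "\<And>v. v \<in> line_bundle n (equation A f) p \<Longrightarrow> fst (fst (frechet_derivative \<phi> (at p) v)) = c * fst (fst v)"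
      using wilczynski_fun_transform[of p k] k p by auto
    \<comment> \<open>The k vectors contribute k factors \<open>c\<close>, exactly the power by
      which the invariants differ.\<close>
    have "(\<Prod>i<k. fst (fst (frechet_derivative \<phi> (at p) (vs i)))) = (\<Prod>i<k. c * fst (fst (vs i)))"
      using c(2) vs by (intro prod.cong) auto
    then show ?thesis by (simp add: wilczynski_form_def c(1) prod.distrib)
  qed
  then show ?thesis using d\<phi>_line_bundle by blast
qed

end
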